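(* Let $t\ge 1$ be an integer and $\mathbf{x}=(x_1,\dots,x_t)$ be independent variables. Then $$\sum_{\omega\in\mathcal{P}_{(t)}} (-1)^{|H_{<t}(\omega)|}\,T^{|\omega|}\, s_{\mu}(\mathbf{x})\prod_{i=1}^t x_i^{-\ell(\omega)}=(T;T)_\infty^{t-1}\prod_{1\le i<j\le t}(Tx_ix_j^{-1};T)_\infty\,(Tx_i^{-1}x_j;T)_\infty ,$$ where the sum runs over all $t$-core partitions $\omega$, $\ell(\omega)$ is the number of parts of $\omega$, $H_{<t}(\omega)=\{s\in\omega\mid h_s<t\}$, and $\mu=\mu(\omega)$ is the partition given by $\mu_i=v_i-v_t+i-t$ for $1\le i\le t$, with $\mathbf{v}=(v_1,\dots,v_t)$ the $V_{t,t}$-coding of $\omega$.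
   Context: $(a;T)_\infty=\prod_{j\ge0}(1-aT^j)$; the identity is between formal power series in $T$ with coefficients Laurent polynomials in $x_1,\dots,x_t$. For a box $s$ of the Ferrers diagram of a partition, $h_s$ is its hook length. A partition is a $t$-core if none of its hook lengths is divisible by $t$; $\mathcal{P}_{(t)}$ is the set of $t$-cores (it contains the empty partition). Word of a partition: $\psi(\lambda)=(c_k)_{k\in\mathbb{Z}}\in\{0,1\}^{\mathbb{Z}}$ encodes the border of the Ferrers diagram (English convention, extended along the axes) read from South-West to North-East, with $0$ for a vertical step and $1$ for a horizontal step, indexed so that $\#\{k\le -1: c_k=1\}=\#\{k\ge 0: c_k=0\}$. Equivalently $c_k=0$ if and only if $k=\lambda_i-i$ for some $i\ge1$ (with $\lambda_i=0$ for $i>\ell(\lambda)$). $V_{g,t}$-coding ($t\le g$): for $i\in\{0,\dots,g-1\}$ let $\beta_i=\max\{(k+1)g+i\mid k\in\mathbb{Z},\ c_{kg+i}=0\}$; order these $g$ distinct integers decreasingly; the $V_{g,t}$-coding is $\mathbf{v}=(v_1,\dots,v_t)$, consisting of the $t$ largest of them, $v_1>\dots>v_t$. Here $g=t$. Schur polynomial: $s_\mu(\mathbf{x})=\det_{1\le i,j\le t}(x_i^{\mu_j+t-j})/\det_{1\le i,j\le t}(x_i^{t-j})$. *)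

theory Defs
  imports
    "HOL-Analysis.Infinite_Sum"
    "HOL-Analysis.Infinite_Products"
    "HOL-Computational_Algebra.Formal_Power_Series"
    "HOL-Library.Poly_Mapping"
    "Jordan_Normal_Form.Determinant"
begin

subsection \<open>Partitions, hook lengths, cores\<close>

definition is_partition :: "nat list \<Rightarrow> bool" where
  "is_partition l \<longleftrightarrow> sorted_wrt (\<ge>) l \<and> 0 \<notin> set l"

text \<open>\<open>part l i\<close> is the \<open>i\<close>-th part, counted from 1 and extended by zeros.\<close>

definition part :: "nat list \<Rightarrow> nat \<Rightarrow> nat" where
  "part l i = (if 1 \<le> i \<and> i \<le> length l then l ! (i - 1) else 0)"

definition diagram :: "nat list \<Rightarrow> (nat \<times> nat) set" where
  "diagram l = {(i, j). 1 \<le> i \<and> i \<le> length l \<and> 1 \<le> j \<and> j \<le> part l i}"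

fun hook :: "nat list \<Rightarrow> nat \<times> nat \<Rightarrow> (nat \<times> nat) set" where
  "hook l (i, j) = {(a, b) \<in> diagram l. (a = i \<and> j \<le> b) \<or> (b = j \<and> i \<le> a)}"

definition hook_length :: "nat list \<Rightarrow> nat \<times> nat \<Rightarrow> nat" where
  "hook_length l s = card (hook l s)"

definition cores :: "nat \<Rightarrow> nat list set" where
  "cores t = {l. is_partition l \<and> (\<forall>s\<in>diagram l. \<not> t dvd hook_length l s)}"

definition short_hooks :: "nat \<Rightarrow> nat list \<Rightarrow> (nat \<times> nat) set" where
  "short_hooks t l = {s \<in> diagram l. hook_length l s < t}"


subsection \<open>The word of a partition and its V-coding\<close>

text \<open>
  The south-west to north-east border word, 0 for vertical and 1 for horizontal steps:
  the vertical step at the end of row \<open>i\<close> (counted from 1, empty rows included)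
  has index \<open>part l i - i\<close>.
\<close>

definition word :: "nat list \<Rightarrow> int \<Rightarrow> nat" where
  "word l k = (if \<exists>i\<ge>1. k = int (part l i) - int i then 0 else 1)"

definition beta :: "nat \<Rightarrow> nat list \<Rightarrow> nat \<Rightarrow> int" where
  "beta g l i = (GREATEST b. \<exists>k::int. b = (k + 1) * int g + int i \<and> word l (k * int g + int i) = 0)"

definition V_coding :: "nat \<Rightarrow> nat \<Rightarrow> nat list \<Rightarrow> int list" where
  "V_coding g t l = take t (rev (sort (map (beta g l) [0..<g])))"

text \<open>
  The partition \<open>\<mu>\<close> of the \<open>V\<^sub>t\<^sub>,\<^sub>t\<close>-coding, as a function of \<open>i \<in> {1..t}\<close>.
  The entries of the coding are strictly decreasing integers, so the argument of
  \<^const>\<open>nat\<close> is nonnegative.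
\<close>

definition coding_partition :: "nat \<Rightarrow> nat list \<Rightarrow> nat \<Rightarrow> nat" where
  "coding_partition t l i =
     (let v = (\<lambda>i. V_coding t t l ! (i - 1)) in nat (v i - v t + int i - int t))"


subsection \<open>Laurent polynomials and Schur polynomials\<close>

text \<open>
  Laurent polynomials over the integers in variables indexed by \<^typ>\<open>nat\<close>: finitely supported
  families of coefficients indexed by finitely supported exponent vectors, with the
  convolution product of \<^typ>\<open>'a \<Rightarrow>\<^sub>0 'b\<close>.
\<close>

type_synonym laurent = "(nat \<Rightarrow>\<^sub>0 int) \<Rightarrow>\<^sub>0 int"

text \<open>\<open>xpow i n\<close> is the \<open>n\<close>-th power, \<open>n\<close> possibly negative, of the variable \<open>x\<^sub>i\<close>.\<close>

definition xpow :: "nat \<Rightarrow> int \<Rightarrow> laurent" where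
  "xpow i n = Poly_Mapping.single (Poly_Mapping.single i n) 1"

text \<open>
  \<open>alternant t e\<close> is the determinant with entries \<open>x\<^sub>i\<close> to the power \<open>e j\<close>,
  for \<open>1 \<le> i, j \<le> t\<close>; matrix indices start at 0, hence the shift.
\<close>

definition alternant :: "nat \<Rightarrow> (nat \<Rightarrow> nat) \<Rightarrow> laurent" where
  "alternant t e = det (mat t t (\<lambda>(i, j). xpow (i + 1) (int (e (j + 1)))))"

text \<open>
  The quotient of alternants. Laurent polynomials form an integral domain and the Vandermonde
  determinant is nonzero, so the exact quotient is the only \<open>s\<close> satisfying the equation.
\<close>

definition schur :: "nat \<Rightarrow> (nat \<Rightarrow> nat) \<Rightarrow> laurent" where
  "schur t \<mu> = (THE s. s * alternant t (\<lambda>j. t - j) = alternant t (\<lambda>j. \<mu> j + t - j))"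


subsection \<open>The infinite Pochhammer symbol\<close>

text \<open>The infinite product is taken in the topology of formal power series in \<open>T\<close> = \<^const>\<open>fps_X\<close>.\<close>

definition qpochhammer :: "laurent fps \<Rightarrow> laurent fps" where
  "qpochhammer a = prodinf (\<lambda>j. 1 - a * fps_X ^ j)"

end

theory Submission
  imports Defs "HOL-Computational_Algebra.Polynomial_FPS"
begin

text \<open>
  Multiplied by the Vandermonde determinant, the right-hand side is a product of theta
  functions \<open>\<theta>(x\<^sub>i / x\<^sub>j)\<close>. Expanding each of them by Jacobi's triple product, the coefficient of a
  monomial \<open>x^m\<close> becomes a signed count of families of integers \<open>k i j\<close> with
  \<open>k i j + k j i = 1\<close>. Relabelling such a family shows that these coefficients are antisymmetric in
  \<open>m\<close>, and the shift \<open>k i j + \<nu> j - \<nu> i\<close> that they are quasi-periodic under \<open>m \<mapsto> m + t \<nu>\<close> with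
  \<open>\<Sum>\<nu> = 0\<close>. Hence the product is a sum over such \<open>\<nu>\<close> of the alternants with exponents
  \<open>j + t \<nu> j\<close>, up to a factor depending on \<open>T\<close> only, which evaluation at \<open>t\<close>-th roots of unity
  determines. On the other side, \<open>t\<close>-cores correspond to such \<open>\<nu>\<close> through
  \<open>\<beta>\<^sub>j = j + t \<nu> j\<close>: boxes are the inversions of the word, the smallest \<open>\<beta>\<^sub>j\<close> is minus the number of
  parts, and the number of short hooks has the parity of the permutation sorting the \<open>\<beta>\<^sub>j\<close>.
\<close>

subsection \<open>Graded sums and congruences of power series\<close>

text \<open>A Schur polynomial is accessible only through its product with the Vandermonde
  determinant, so the identity is proved after multiplication by it, and it is cancelled at the very
  end, Laurent polynomials being a domain. Antisymmetry and quasi-periodicity suffice for this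
  reason: if two entries of \<open>m\<close> are congruent modulo \<open>t\<close>, a transposition
  and a translation act on \<open>m\<close> alike, with signs \<open>-1\<close> and
  \<open>+1\<close>, so the coefficient vanishes; every other \<open>m\<close> in the support is an
  image of the base point \<open>(0, ..., t - 1)\<close>, and a single series in \<open>T\<close>
  remains unknown. At the roots of unity every \<open>x\<^sub>i^t\<close> is 1 and the alternants
  collapse to one, so the lattice sum becomes the count of lattice points by weight. That count is
  found separately, as a constant term in the triple product split into residue classes, and it
  agrees with the evaluated product up to powers of \<open>(T;T)\<close>. On the combinatorial side
  the short hooks give the right sign because the total charge is 0: the extra parities
  \<open>\<nu> i + \<nu> j\<close> add up to 0 over all pairs.\<close>

definition fps_cong :: "nat \<Rightarrow> 'a::zero fps \<Rightarrow> 'a fps \<Rightarrow> bool" where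
  "fps_cong n F G \<longleftrightarrow> (\<forall>m\<le>n. fps_nth F m = fps_nth G m)"

lemma fps_cong_refl [simp]: "fps_cong n F F"
  by (simp add: fps_cong_def)

lemma fps_cong_sym: "fps_cong n F G \<Longrightarrow> fps_cong n G F"
  by (simp add: fps_cong_def)

lemma fps_cong_trans [trans]: "fps_cong n F G \<Longrightarrow> fps_cong n G H \<Longrightarrow> fps_cong n F H"
  by (simp add: fps_cong_def)

lemma fps_cong_mult:
  fixes F G :: "'a::semiring_0 fps"
  shows "fps_cong n F F' \<Longrightarrow> fps_cong n G G' \<Longrightarrow> fps_cong n (F * G) (F' * G')"
  by (simp add: fps_cong_def fps_mult_nth)

lemma fps_cong_sum:
  fixes F G :: "'i \<Rightarrow> 'a::comm_monoid_add fps"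
  assumes "\<And>i. i \<in> A \<Longrightarrow> fps_cong n (F i) (G i)"
  shows "fps_cong n (\<Sum>i\<in>A. F i) (\<Sum>i\<in>A. G i)"
  using assms by (simp add: fps_cong_def fps_sum_nth)

text \<open>A series with constant term 1 is a unit over any commutative ring, so the common factor
  is removed by multiplying with its inverse.\<close>

lemma fps_cong_cancel:
  fixes F G :: "'a::comm_ring_1 fps"
  assumes "fps_cong n (F * H) (G * H)" "fps_nth H 0 = 1"
  shows "fps_cong n F G"
proof -
  have "H * fps_right_inverse H 1 = 1"
    using assms(2) by (intro fps_right_inverse) simp
  moreover have "fps_cong n (F * H * fps_right_inverse H 1) (G * H * fps_right_inverse H 1)"
    by (intro fps_cong_mult assms) simp
  ultimately show ?thesis
    by (simp add: mult.assoc)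
qed

text \<open>Finitely many coefficients become stationary simultaneously. In this form limits inherit
  compatibility with products from \<open>fps_cong_mult\<close>.\<close>

lemma fps_tendsto_iff_cong:
  fixes F :: "nat \<Rightarrow> 'a::group_add fps"
  shows "F \<longlonglongrightarrow> L \<longleftrightarrow> (\<forall>n. eventually (\<lambda>N. fps_cong n (F N) L) sequentially)"
proof -
  have "eventually (\<lambda>N. fps_cong n (F N) L) sequentially"
    if "\<forall>n. eventually (\<lambda>N. fps_nth (F N) n = fps_nth L n) sequentially" for n
    using that unfolding fps_cong_def
    by (intro eventually_ball_finite[of "{..n}", simplified Ball_def atMost_iff]) auto
  then show ?thesis
    unfolding tendsto_fps_iff by (auto simp: fps_cong_def elim!: eventually_mono)
qed

lemma fps_tendsto_mult:
  fixes F G :: "nat \<Rightarrow> 'a::ring fps"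
  assumes "F \<longlonglongrightarrow> L" "G \<longlonglongrightarrow> M"
  shows "(\<lambda>N. F N * G N) \<longlonglongrightarrow> L * M"
  unfolding fps_tendsto_iff_cong
proof
  fix n
  show "eventually (\<lambda>N. fps_cong n (F N * G N) (L * M)) sequentially"
    using assms[unfolded fps_tendsto_iff_cong, rule_format, of n]
    by (rule eventually_elim2) (rule fps_cong_mult)
qed

lemma fps_tendsto_prod:
  fixes F :: "'i \<Rightarrow> nat \<Rightarrow> 'a::comm_ring_1 fps"
  assumes "\<And>i. i \<in> A \<Longrightarrow> F i \<longlonglongrightarrow> L i"
  shows "(\<lambda>N. \<Prod>i\<in>A. F i N) \<longlonglongrightarrow> (\<Prod>i\<in>A. L i)"
  using assms by (induction A rule: infinite_finite_induct) (auto intro!: fps_tendsto_mult)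

text \<open>The factor \<open>F k\<close> is 1 modulo \<open>T^(k+1)\<close>, so all partial
  products from the \<open>n\<close>-th on agree modulo \<open>T^(n+1)\<close>.\<close>

lemma fps_tendsto_infprod:
  fixes F :: "nat \<Rightarrow> 'a::comm_ring_1 fps"
  assumes "\<And>k. fps_cong k (F k) 1"
  obtains L where "(\<lambda>N. \<Prod>k<N. F k) \<longlonglongrightarrow> L" "fps_nth L 0 = 1"
proof -
  let ?P = "\<lambda>N. \<Prod>k<N. F k"
  have stable: "fps_cong n (?P N) (?P n)" if "n \<le> N" for n N
    using that
  proof (induction rule: dec_induct)
    case (step m)
    have "fps_cong n (F m) 1"
      using assms[of m] step by (auto simp: fps_cong_def)
    then have "fps_cong n (?P m * F m) (?P n * 1)"
      using step by (intro fps_cong_mult)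
    then show ?case by (simp add: mult.commute)
  qed simp
  \<comment> \<open>The \<open>n\<close>-th coefficient is final after \<open>n\<close> factors, so
    the limit is read off along the diagonal.\<close>
  define L where "L = Abs_fps (\<lambda>n. fps_nth (?P n) n)"
  have "fps_nth (?P N) n = fps_nth L n" if "n \<le> N" for n N
    using stable[OF that] by (simp add: fps_cong_def L_def)
  then have "?P \<longlonglongrightarrow> L"
    unfolding tendsto_fps_iff by (auto simp: eventually_sequentially)
  moreover have "fps_nth L 0 = 1" by (simp add: L_def)
  ultimately show ?thesis by (rule that)
qed

lemma fps_cong_one_plus_X_power:
  fixes a :: "'a::comm_ring_1 fps"
  shows "k < m \<Longrightarrow> fps_cong k (1 + a * fps_X ^ m) 1"
    and "k < m \<Longrightarrow> fps_cong k (1 - a * fps_X ^ m) 1"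
  by (auto simp: fps_cong_def fps_X_power_mult_right_nth)

section \<open>Generating series of graded index sets\<close>

definition graded :: "'i set \<Rightarrow> ('i \<Rightarrow> nat) \<Rightarrow> bool" where
  "graded I w \<longleftrightarrow> (\<forall>n. finite {i \<in> I. w i \<le> n})"

text \<open>The series \<open>\<Sum> u i T^(w i)\<close>, given coefficientwise so that identities
  can be proved by finite sums; under \<open>graded\<close> it is the actual infinite sum, by
  \<open>gser_has_sum\<close>.\<close>

definition gser :: "'i set \<Rightarrow> ('i \<Rightarrow> nat) \<Rightarrow> ('i \<Rightarrow> 'a::comm_ring_1) \<Rightarrow> 'a fps" where
  "gser I w u = Abs_fps (\<lambda>n. \<Sum>i\<in>{i \<in> I. w i = n}. u i)"

lemma graded_finite_eq: "graded I w \<Longrightarrow> finite {i \<in> I. w i = n}"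
  by (rule finite_subset[of _ "{i \<in> I. w i \<le> n}"]) (auto simp: graded_def)

lemma gser_cong:
  assumes "\<And>i. i \<in> I \<Longrightarrow> w i = w' i" "\<And>i. i \<in> I \<Longrightarrow> u i = u' i"
  shows "gser I w u = gser I w' u'"
  unfolding gser_def using assms by (intro arg_cong[of _ _ Abs_fps] ext sum.cong) auto

lemma gser_reindex:
  assumes "bij_betw h I J"
  shows "gser J w u = gser I (w \<circ> h) (u \<circ> h)"
proof -
  have "bij_betw h {i \<in> I. w (h i) = n} {j \<in> J. w j = n}" for n
    using assms by (auto simp: bij_betw_def inj_on_def)
  then show ?thesis
    unfolding gser_def
    by (intro arg_cong[of _ _ Abs_fps] ext) (simp add: sum.reindex_bij_betw[symmetric])
qed

lemma graded_reindex:
  assumes "bij_betw h I J" "graded I (w \<circ> h)"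
  shows "graded J w"
  unfolding graded_def
proof
  fix n
  have "{j \<in> J. w j \<le> n} \<subseteq> h ` {i \<in> I. (w \<circ> h) i \<le> n}"
    using assms(1) by (auto simp: bij_betw_def)
  then show "finite {j \<in> J. w j \<le> n}"
    by (rule finite_subset) (use assms(2) in \<open>auto simp: graded_def\<close>)
qed

lemma fps_cong_gser:
  assumes "graded I w"
  shows "fps_cong n (gser I w u) (\<Sum>i\<in>{i \<in> I. w i \<le> n}. fps_const (u i) * fps_X ^ w i)"
  unfolding fps_cong_def
proof safe
  fix m assume "m \<le> n"
  have "(\<Sum>i\<in>{i \<in> I. w i \<le> n}. fps_nth (fps_const (u i) * fps_X ^ w i) m)
      = (\<Sum>i\<in>{i \<in> I. w i \<le> n}. if w i = m then u i else 0)"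
    by (intro sum.cong) (auto simp: fps_X_power_nth)
  also have "\<dots> = (\<Sum>i\<in>{i \<in> I. w i = m}. u i)"
    using assms \<open>m \<le> n\<close> by (intro sum.mono_neutral_cong_right) (auto simp: graded_def)
  finally show "fps_nth (gser I w u) m
      = fps_nth (\<Sum>i\<in>{i \<in> I. w i \<le> n}. fps_const (u i) * fps_X ^ w i) m"
    by (simp add: gser_def fps_sum_nth)
qed

lemma gser_has_sum:
  fixes u :: "'i \<Rightarrow> 'a::comm_ring_1"
  assumes "graded I w"
  shows "((\<lambda>i. fps_const (u i) * fps_X ^ w i) has_sum gser I w u) I"
  unfolding has_sum_def tendsto_fps_iff
proof safe
  fix n
  \<comment> \<open>Once a finite set contains all indices of weight \<open>n\<close>, further terms
    do not touch the \<open>n\<close>-th coefficient.\<close>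
  have "fps_nth (\<Sum>i\<in>A. fps_const (u i) * fps_X ^ w i) n = fps_nth (gser I w u) n"
    if A: "finite A" "{i \<in> I. w i = n} \<subseteq> A" "A \<subseteq> I" for A
  proof -
    have "(\<Sum>i\<in>A. fps_nth (fps_const (u i) * fps_X ^ w i) n) = (\<Sum>i\<in>A. if w i = n then u i else 0)"
      by (intro sum.cong) (auto simp: fps_X_power_nth)
    also have "\<dots> = (\<Sum>i\<in>{i \<in> I. w i = n}. u i)"
      using A by (intro sum.mono_neutral_cong_right) auto
    finally show ?thesis by (simp add: gser_def fps_sum_nth)
  qed
  then show "\<forall>\<^sub>F A in finite_subsets_at_top I.
      fps_nth (\<Sum>i\<in>A. fps_const (u i) * fps_X ^ w i) n = fps_nth (gser I w u) n"
    unfolding eventually_finite_subsets_at_top using graded_finite_eq[OF assms]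
    by (intro exI[of _ "{i \<in> I. w i = n}"]) auto
qed

lemma graded_times:
  assumes "graded I w" "graded J v"
  shows "graded (I \<times> J) (\<lambda>(i, j). w i + v j)"
  unfolding graded_def
proof
  fix n
  have "{p \<in> I \<times> J. (case p of (i, j) \<Rightarrow> w i + v j) \<le> n} \<subseteq> {i \<in> I. w i \<le> n} \<times> {j \<in> J. v j \<le> n}"
    by auto
  then show "finite {p \<in> I \<times> J. (case p of (i, j) \<Rightarrow> w i + v j) \<le> n}"
    by (rule finite_subset) (use assms in \<open>auto simp: graded_def\<close>)
qed

lemma gser_mult:
  assumes "graded I w" "graded J v"
  shows "gser I w u * gser J v u' = gser (I \<times> J) (\<lambda>(i, j). w i + v j) (\<lambda>(i, j). u i * u' j)"
proof (rule fps_ext)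
  fix n
  have "fps_nth (gser I w u * gser J v u') n
      = (\<Sum>m=0..n. \<Sum>(i, j)\<in>{i \<in> I. w i = m} \<times> {j \<in> J. v j = n - m}. u i * u' j)"
    by (simp add: fps_mult_nth gser_def sum_product sum.cartesian_product)
  also have "\<dots> = (\<Sum>(i, j)\<in>(\<Union>m\<in>{0..n}. {i \<in> I. w i = m} \<times> {j \<in> J. v j = n - m}). u i * u' j)"
    by (subst sum.UNION_disjoint) (auto intro!: finite_cartesian_product graded_finite_eq assms)
  also have "(\<Union>m\<in>{0..n}. {i \<in> I. w i = m} \<times> {j \<in> J. v j = n - m})
      = {p \<in> I \<times> J. (case p of (i, j) \<Rightarrow> w i + v j) = n}"
    by auto
  finally show "fps_nth (gser I w u * gser J v u') n
      = fps_nth (gser (I \<times> J) (\<lambda>(i, j). w i + v j) (\<lambda>(i, j). u i * u' j)) n"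
    by (simp add: gser_def)
qed

text \<open>Multiplying out picks one index from each factor, hence the choice functions in
  \<open>PiE A I\<close>. Gradedness goes through the same induction because
  \<open>gser_mult\<close> requires it for the remaining factors.\<close>

lemma gser_prod:
  assumes "finite A" "\<And>a. a \<in> A \<Longrightarrow> graded (I a) (w a)"
  shows "graded (PiE A I) (\<lambda>f. \<Sum>a\<in>A. w a (f a))"
    and "(\<Prod>a\<in>A. gser (I a) (w a) (u a))
       = gser (PiE A I) (\<lambda>f. \<Sum>a\<in>A. w a (f a)) (\<lambda>f. \<Prod>a\<in>A. u a (f a))"
proof -
  have "graded (PiE A I) (\<lambda>f. \<Sum>a\<in>A. w a (f a)) \<and> (\<Prod>a\<in>A. gser (I a) (w a) (u a))
       = gser (PiE A I) (\<lambda>f. \<Sum>a\<in>A. w a (f a)) (\<lambda>f. \<Prod>a\<in>A. u a (f a))"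
    using assms
  proof (induction A rule: finite_induct)
    case empty
    \<comment> \<open>\<open>PiE\<close> over the empty set has one element, of weight 0, which
      gives the series 1.\<close>
    have *: "{i. i = (\<lambda>_. undefined) \<and> P} = (if P then {\<lambda>_. undefined} else {})" for P
      by auto
    show ?case by (auto simp: graded_def gser_def fps_eq_iff *)
  next
    case (insert b A)
    let ?h = "\<lambda>(y, g). g(b := y)"
    let ?W = "\<lambda>(y, f). w b y + (\<Sum>a\<in>A. w a (f a))"
    have bij: "bij_betw ?h (I b \<times> PiE A I) (PiE (insert b A) I)"
      unfolding bij_betw_def
    proof
      show "inj_on ?h (I b \<times> PiE A I)"
        using insert.hyps by (auto simp: inj_on_def fun_eq_iff PiE_iff extensional_def split: if_splits)
      show "?h ` (I b \<times> PiE A I) = PiE (insert b A) I"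
        by (rule PiE_insert_eq[symmetric])
    qed
    have g: "graded (I b \<times> PiE A I) ?W"
      using insert by (intro graded_times) auto
    have W: "(\<lambda>f. \<Sum>a\<in>insert b A. w a (f a)) \<circ> ?h = ?W"
      using insert.hyps by (intro ext) (auto intro!: sum.cong)
    then have "graded (PiE (insert b A) I) (\<lambda>f. \<Sum>a\<in>insert b A. w a (f a))"
      by (intro graded_reindex[OF bij]) (simp only: W g)
    moreover have "(\<Prod>a\<in>insert b A. gser (I a) (w a) (u a))
        = gser (I b) (w b) (u b) * gser (PiE A I) (\<lambda>f. \<Sum>a\<in>A. w a (f a)) (\<lambda>f. \<Prod>a\<in>A. u a (f a))"
      using insert by simp
    moreover have "\<dots> = gser (I b \<times> PiE A I) ?W (\<lambda>(y, f). u b y * (\<Prod>a\<in>A. u a (f a)))"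
      using insert by (intro gser_mult) auto
    moreover have "\<dots> = gser (PiE (insert b A) I) (\<lambda>f. \<Sum>a\<in>insert b A. w a (f a))
          (\<lambda>f. \<Prod>a\<in>insert b A. u a (f a))"
      unfolding gser_reindex[OF bij] W
      using insert.hyps by (intro gser_cong) (auto intro!: arg_cong[of _ _ "(*) _"] prod.cong)
    ultimately show ?case by simp
  qed
  then show "graded (PiE A I) (\<lambda>f. \<Sum>a\<in>A. w a (f a))"
    and "(\<Prod>a\<in>A. gser (I a) (w a) (u a))
       = gser (PiE A I) (\<lambda>f. \<Sum>a\<in>A. w a (f a)) (\<lambda>f. \<Prod>a\<in>A. u a (f a))"
    by auto
qed

subsection \<open>Jacobi's triple product\<close>

text \<open>Gaussian binomial coefficients, by one of the two q-Pascal rules, so that no division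
  occurs; the quotient formula becomes \<open>qbin_qfac\<close>.\<close>

fun qbin :: "'a::comm_ring_1 \<Rightarrow> nat \<Rightarrow> nat \<Rightarrow> 'a" where
  "qbin q n 0 = 1"
| "qbin q 0 (Suc k) = 0"
| "qbin q (Suc n) (Suc k) = qbin q n (Suc k) + q ^ (n - k) * qbin q n k"

definition qfac :: "'a::comm_ring_1 \<Rightarrow> nat \<Rightarrow> 'a" where
  "qfac q n = (\<Prod>k<n. 1 - q ^ Suc k)"

lemma qfac_0 [simp]: "qfac q 0 = 1"
  and qfac_Suc: "qfac q (Suc n) = qfac q n * (1 - q ^ Suc n)"
  by (simp_all add: qfac_def)

lemma qbin_eq_0: "n < k \<Longrightarrow> qbin q n k = 0"
  by (induction q n k rule: qbin.induct) auto

text \<open>Pascal's rule reduces this to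
  \<open>(1 - q^(r+1)) + q^(r+1) (1 - q^(j+1)) = 1 - q^(j+r+2)\<close>.\<close>

lemma qbin_qfac: "k \<le> n \<Longrightarrow> qbin q n k * (qfac q k * qfac q (n - k)) = qfac q n"
proof (induction n arbitrary: k)
  case (Suc n)
  show ?case
  proof (cases k)
    case (Suc j)
    show ?thesis
    proof (cases "j = n")
      case True
      then show ?thesis
        using Suc Suc.IH[of n] by (simp add: qbin_eq_0 qfac_Suc mult.assoc[symmetric])
    next
      case False
      define r where "r = n - Suc j"
      have n: "n = Suc j + r"
        using Suc Suc.prems False by (simp add: r_def)
      have "qbin q n (Suc j) * (qfac q (Suc j) * qfac q r) = qfac q n"
        "qbin q n j * (qfac q j * qfac q (Suc r)) = qfac q n"
        using Suc.IH[of "Suc j"] Suc.IH[of j] by (simp_all add: n)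
      then have *: "qbin q n (Suc j) * qfac q (Suc j) * qfac q r * (1 - q ^ Suc r) = qfac q n * (1 - q ^ Suc r)"
        "q ^ Suc r * (qbin q n j * qfac q j * qfac q (Suc r)) * (1 - q ^ Suc j) = q ^ Suc r * qfac q n * (1 - q ^ Suc j)"
        by (simp_all add: algebra_simps)
      have "qbin q (Suc n) k * (qfac q k * qfac q (Suc n - k))
          = (qbin q n (Suc j) + q ^ Suc r * qbin q n j) * (qfac q (Suc j) * qfac q (Suc r))"
        using Suc by (simp add: n)
      also have "\<dots> = qbin q n (Suc j) * qfac q (Suc j) * qfac q r * (1 - q ^ Suc r)
          + q ^ Suc r * (qbin q n j * qfac q j * qfac q (Suc r)) * (1 - q ^ Suc j)"
        by (simp add: qfac_Suc algebra_simps del: power_Suc)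
      also have "\<dots> = qfac q n * (1 - q ^ Suc r * q ^ Suc j)"
        unfolding * by (simp add: algebra_simps del: power_Suc)
      also have "\<dots> = qfac q (Suc n)"
        unfolding power_add[symmetric] by (simp add: qfac_Suc n add_ac)
      finally show ?thesis .
    qed
  qed simp
qed simp

text \<open>The mirror image of the defining q-Pascal rule, obtained by cancelling q-factorials. The
  finite triple product uses it for the factors with \<open>b\<close> and the defining rule for
  those with \<open>a\<close>.\<close>

lemma qbin_Suc_Suc':
  fixes q :: "'a::idom"
  assumes "\<And>n. qfac q n \<noteq> 0"
  shows "qbin q (Suc n) (Suc k) = q ^ Suc k * qbin q n (Suc k) + qbin q n k"
proof (cases "k < n")
  case False
  then show ?thesis by (cases "k = n") (auto simp: qbin_eq_0)
next
  case True
  define r where "r = n - Suc k"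
  have n: "n = Suc k + r"
    using True by (simp add: r_def)
  have "qbin q n (Suc k) * (qfac q (Suc k) * qfac q r) = qfac q n"
    "qbin q n k * (qfac q k * qfac q (Suc r)) = qfac q n"
    using qbin_qfac[of "Suc k" n q] qbin_qfac[of k n q] by (simp_all add: n)
  then have *: "qbin q n (Suc k) * (qfac q k * (1 - q ^ Suc k) * qfac q r) = qfac q n"
    "qbin q n k * (qfac q k * (qfac q r * (1 - q ^ Suc r))) = qfac q n"
    by (simp_all only: qfac_Suc)
  have "(qbin q n (Suc k) * (1 - q ^ Suc k)) * (qfac q k * qfac q r)
      = (qbin q n k * (1 - q ^ Suc r)) * (qfac q k * qfac q r)"
    using * by (simp only: mult_ac)
  then have "qbin q n (Suc k) * (1 - q ^ Suc k) = qbin q n k * (1 - q ^ Suc r)"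
    using assms by simp
  moreover have "n - k = Suc r" by (simp add: n)
  ultimately show ?thesis by (simp add: algebra_simps)
qed

text \<open>
  The two product rules say that \<open>f j\<close> behaves like \<open>a^j q^(j (j - 1) / 2)\<close> for \<open>q = a b\<close>, in a form that
  needs no negative powers.
\<close>

lemma finite_triple_product:
  fixes q :: "'a::idom" and f :: "int \<Rightarrow> 'a"
  assumes "\<And>n. qfac q n \<noteq> 0" and f0: "f 0 = 1"
    and up: "\<And>(M::nat) j. j \<le> int M \<Longrightarrow> a * q ^ M * f j = q ^ nat (int M - j) * f (j + 1)"
    and down: "\<And>(N::nat) j. - int N \<le> j \<Longrightarrow> b * q ^ N * f j = q ^ nat (int N + j) * f (j - 1)"
  shows "(\<Prod>k<M. 1 + a * q ^ k) * (\<Prod>k<N. 1 + b * q ^ k)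
       = (\<Sum>i\<le>M + N. qbin q (M + N) i * f (int i - int N))"
proof (induction M)
  \<comment> \<open>With \<open>M = 0\<close> the factors with \<open>b\<close> are absorbed one at
    a time through \<open>down\<close>; the outer induction then absorbs the factors with
    \<open>a\<close> through \<open>up\<close>.\<close>
  case 0
  show ?case
  proof (induction N)
    case (Suc N)
    have "(\<Prod>k<Suc N. 1 + b * q ^ k)
        = (\<Sum>i\<le>N. qbin q N i * f (int i - int N)) + (\<Sum>i\<le>N. qbin q N i * (b * q ^ N * f (int i - int N)))"
      using Suc by (simp add: algebra_simps sum_distrib_left sum.distrib)
    also have "(\<Sum>i\<le>N. qbin q N i * (b * q ^ N * f (int i - int N)))
        = (\<Sum>i\<le>N. q ^ i * qbin q N i * f (int i - int (Suc N)))"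
      by (intro sum.cong refl, subst down) (auto simp: algebra_simps)
    also have "\<dots> = (\<Sum>i\<le>Suc N. q ^ i * qbin q N i * f (int i - int (Suc N)))"
      by (simp add: qbin_eq_0)
    also have "\<dots> = f (- int (Suc N)) + (\<Sum>i\<le>N. q ^ Suc i * qbin q N (Suc i) * f (int i - int N))"
      by (subst sum.atMost_Suc_shift) simp
    also have "(\<Sum>i\<le>N. qbin q N i * f (int i - int N))
          + (f (- int (Suc N)) + (\<Sum>i\<le>N. q ^ Suc i * qbin q N (Suc i) * f (int i - int N)))
        = f (- int (Suc N)) + (\<Sum>i\<le>N. qbin q (Suc N) (Suc i) * f (int i - int N))"
      unfolding qbin_Suc_Suc'[OF assms(1)] by (simp add: algebra_simps sum.distrib)
    also have "\<dots> = (\<Sum>i\<le>Suc N. qbin q (Suc N) i * f (int i - int (Suc N)))"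
      by (subst sum.atMost_Suc_shift) simp
    finally show ?case by simp
  qed (simp add: f0)
next
  case (Suc M)
  let ?n = "M + N"
  have "(\<Prod>k<Suc M. 1 + a * q ^ k) * (\<Prod>k<N. 1 + b * q ^ k)
      = (\<Sum>i\<le>?n. qbin q ?n i * f (int i - int N)) + (\<Sum>i\<le>?n. qbin q ?n i * (a * q ^ M * f (int i - int N)))"
    using Suc by (simp add: algebra_simps sum_distrib_left sum.distrib)
  also have "(\<Sum>i\<le>?n. qbin q ?n i * (a * q ^ M * f (int i - int N)))
      = (\<Sum>i\<le>?n. q ^ (?n - i) * qbin q ?n i * f (int (Suc i) - int N))"
  proof (intro sum.cong refl)
    fix i assume "i \<in> {..?n}"
    then have "a * q ^ M * f (int i - int N) = q ^ nat (int M - (int i - int N)) * f (int i - int N + 1)"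
      by (intro up) auto
    moreover have "nat (int M - (int i - int N)) = ?n - i" "int i - int N + 1 = int (Suc i) - int N"
      by auto
    ultimately show "qbin q ?n i * (a * q ^ M * f (int i - int N))
        = q ^ (?n - i) * qbin q ?n i * f (int (Suc i) - int N)"
      by (simp only: mult_ac)
  qed
  also have "(\<Sum>i\<le>?n. qbin q ?n i * f (int i - int N)) = (\<Sum>i\<le>Suc ?n. qbin q ?n i * f (int i - int N))"
    by (simp add: qbin_eq_0)
  also have "\<dots> = f (- int N) + (\<Sum>i\<le>?n. qbin q ?n (Suc i) * f (int (Suc i) - int N))"
    by (subst sum.atMost_Suc_shift) simp
  also have "\<dots> + (\<Sum>i\<le>?n. q ^ (?n - i) * qbin q ?n i * f (int (Suc i) - int N))
      = f (- int N) + (\<Sum>i\<le>?n. qbin q (Suc ?n) (Suc i) * f (int (Suc i) - int N))"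
    by (simp add: algebra_simps sum.distrib)
  also have "\<dots> = (\<Sum>i\<le>Suc ?n. qbin q (Suc ?n) i * f (int i - int N))"
    by (subst sum.atMost_Suc_shift) simp
  finally show ?case by simp
qed

section \<open>Triangular numbers and the exponents of theta series\<close>

definition tri :: "int \<Rightarrow> int" where
  "tri j = j * (j - 1) div 2"

lemma two_tri: "2 * tri j = j * (j - 1)"
  unfolding tri_def by (cases "even j") auto

text \<open>Products of consecutive integers are nonnegative: \<open>(j - 1) (j - 2)\<close> bounds
  \<open>j - 1\<close> and \<open>j (j + 1)\<close> bounds \<open>- j\<close>. This growth makes
  theta series graded.\<close>

lemma tri_bound: "\<bar>j\<bar> \<le> tri j + 1"
proof -
  have "0 \<le> (j - 1) * (j - 2)"
    by (cases "j \<le> 1") (auto simp: zero_le_mult_iff)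
  moreover have "0 \<le> j * (j + 1)"
    by (cases "j < 0") (auto simp: zero_le_mult_iff)
  ultimately have "2 * (j - 1) \<le> 2 * tri j" "2 * (- j) \<le> 2 * tri j"
    unfolding two_tri by (simp_all add: algebra_simps)
  then show ?thesis by (simp add: abs_le_iff)
qed

lemma tri_nonneg: "0 \<le> tri j"
  unfolding tri_def by (cases "j \<le> 0") (auto simp: zero_le_mult_iff)

lemma tri_add: "tri (i + j) = tri i + tri j + i * j"
proof -
  have "2 * tri (i + j) = 2 * (tri i + tri j + i * j)"
    unfolding distrib_left two_tri by (simp add: algebra_simps)
  then show ?thesis by simp
qed

lemma tri_Suc: "tri (j + 1) = tri j + j"
  by (simp add: tri_add) (simp add: tri_def)

lemma tri_0_1 [simp]: "tri 0 = 0" "tri 1 = 0"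
  by (simp_all add: tri_def)

text \<open>The exponent of \<open>T\<close> in \<open>a^j q^(j (j - 1) / 2)\<close> for
  \<open>a = x T^\<alpha>\<close>, \<open>b = x^(-1) T^\<beta>\<close> and \<open>q = a b\<close>,
  arranged as a sum of terms that are nonnegative for every integer \<open>j\<close>.\<close>

definition triwt :: "nat \<Rightarrow> nat \<Rightarrow> int \<Rightarrow> nat" where
  "triwt \<alpha> \<beta> j = nat (int \<alpha> * tri (j + 1) + int \<beta> * tri j)"

lemma int_triwt: "int (triwt \<alpha> \<beta> j) = int \<alpha> * tri (j + 1) + int \<beta> * tri j"
  by (simp add: triwt_def tri_nonneg)

lemma abs_le_triwt:
  assumes "0 < \<alpha> + \<beta>"
  shows "\<bar>j\<bar> \<le> int (triwt \<alpha> \<beta> j) + 1 + 1"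
proof -
  have "\<bar>j\<bar> \<le> tri j + 2" "\<bar>j\<bar> \<le> tri (j + 1) + 2"
    using tri_bound[of j] tri_bound[of "j + 1"] by linarith+
  moreover have "tri j \<le> int (triwt \<alpha> \<beta> j) \<or> tri (j + 1) \<le> int (triwt \<alpha> \<beta> j)"
  proof (cases "\<alpha> = 0")
    case True
    then have "1 * tri j \<le> int \<beta> * tri j"
      using assms by (intro mult_right_mono) (auto simp: tri_nonneg)
    then show ?thesis using True by (simp add: int_triwt)
  next
    case False
    then have "1 * tri (j + 1) \<le> int \<alpha> * tri (j + 1)"
      by (intro mult_right_mono) (auto simp: tri_nonneg)
    then show ?thesis using tri_nonneg[of j] by (simp add: int_triwt add_increasing2)
  qed
  ultimately show ?thesis by linarith
qed

lemma graded_triwt: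
  assumes "0 < \<alpha> + \<beta>"
  shows "graded UNIV (triwt \<alpha> \<beta>)"
  unfolding graded_def
proof
  fix n
  have "{j \<in> UNIV. triwt \<alpha> \<beta> j \<le> n} \<subseteq> {- (int n + 2)..int n + 2}"
    using abs_le_triwt[OF assms] by (auto simp: abs_le_iff) (smt (verit) of_nat_mono)+
  then show "finite {j \<in> UNIV. triwt \<alpha> \<beta> j \<le> n}"
    by (rule finite_subset) simp
qed

text \<open>\<open>U\<close> stands for the integer powers of a unit, signs included. The finite
  form is taken with equally many factors of both kinds; the central Gaussian binomials times the
  last product tend to 1.\<close>

theorem jacobi_triple_product:
  fixes U :: "int \<Rightarrow> 'a::idom"
  assumes s: "s = \<alpha> + \<beta>" "0 < s"
    and U: "U 0 = 1" "\<And>i j. U (i + j) = U i * U j"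
  shows "(\<lambda>N. (\<Prod>k<N. 1 + fps_const (U 1) * fps_X ^ (\<alpha> + s * k))
            * (\<Prod>k<N. 1 + fps_const (U (- 1)) * fps_X ^ (\<beta> + s * k))
            * (\<Prod>k<N. 1 - fps_X ^ (s * Suc k))) \<longlonglongrightarrow> gser UNIV (triwt \<alpha> \<beta>) U"
proof -
  let ?a = "fps_const (U 1) * fps_X ^ \<alpha>" and ?b = "fps_const (U (- 1)) * fps_X ^ \<beta>"
  let ?q = "fps_X ^ s :: 'a fps"
  define f where "f j = fps_const (U j) * fps_X ^ triwt \<alpha> \<beta> j" for j
  have qfac_nth_0: "fps_nth (qfac ?q n) 0 = 1" for n
    using s by (induction n) (auto simp: qfac_Suc power_0_left)
  have qfac_nz: "qfac ?q n \<noteq> 0" for n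
    using qfac_nth_0[of n] by auto
  have up: "?a * ?q ^ M * f j = ?q ^ nat (int M - j) * f (j + 1)" if "j \<le> int M" for M :: nat and j
  proof -
    have "int (\<alpha> + s * M + triwt \<alpha> \<beta> j) = int (s * nat (int M - j) + triwt \<alpha> \<beta> (j + 1))"
      using that by (simp only: of_nat_add of_nat_mult int_triwt tri_Suc s) (simp add: algebra_simps)
    then have "\<alpha> + s * M + triwt \<alpha> \<beta> j = s * nat (int M - j) + triwt \<alpha> \<beta> (j + 1)"
      by (rule of_nat_eq_iff[THEN iffD1])
    then have "fps_X ^ \<alpha> * ?q ^ M * fps_X ^ triwt \<alpha> \<beta> j
        = ?q ^ nat (int M - j) * fps_X ^ triwt \<alpha> \<beta> (j + 1)"
      by (simp add: power_add[symmetric] power_mult[symmetric])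
    moreover have "fps_const (U (j + 1)) = fps_const (U 1) * fps_const (U j)"
      by (simp add: U(2) mult.commute)
    ultimately show ?thesis
      unfolding f_def by (metis (no_types, lifting) mult.assoc mult.left_commute)
  qed
  have down: "?b * ?q ^ N * f j = ?q ^ nat (int N + j) * f (j - 1)" if "- int N \<le> j" for N :: nat and j
  proof -
    have "int (\<beta> + s * N + triwt \<alpha> \<beta> j) = int (s * nat (int N + j) + triwt \<alpha> \<beta> (j - 1))"
      using that tri_Suc[of "j - 1"] by (simp add: int_triwt tri_Suc s) (simp add: algebra_simps)
    then have "\<beta> + s * N + triwt \<alpha> \<beta> j = s * nat (int N + j) + triwt \<alpha> \<beta> (j - 1)"
      by (rule of_nat_eq_iff[THEN iffD1])
    then have "fps_X ^ \<beta> * ?q ^ N * fps_X ^ triwt \<alpha> \<beta> j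
        = ?q ^ nat (int N + j) * fps_X ^ triwt \<alpha> \<beta> (j - 1)"
      by (simp add: power_add[symmetric] power_mult[symmetric])
    moreover have "fps_const (U (j - 1)) = fps_const (U (- 1)) * fps_const (U j)"
      using U(2)[of "-1" j] by (simp add: mult.commute)
    ultimately show ?thesis
      unfolding f_def by (metis (no_types, lifting) mult.assoc mult.left_commute)
  qed
  have f0: "f 0 = 1"
    by (simp add: f_def U triwt_def)
  have finite_form: "(\<Prod>k<N. 1 + ?a * ?q ^ k) * (\<Prod>k<N. 1 + ?b * ?q ^ k)
      = (\<Sum>i\<le>N + N. qbin ?q (N + N) i * f (int i - int N))" for N
    using qfac_nz f0 up down by (rule finite_triple_product)
  \<comment> \<open>The product equals \<open>qfac (2 N) * qfac N\<close> over
    \<open>qfac i * qfac (2 N - i)\<close>, and all four q-factorials agree modulo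
    \<open>T^(n+1)\<close> because their indices are at least \<open>n\<close>.\<close>
  have central: "fps_cong n (qbin ?q (N + N) i * qfac ?q N) 1"
    if "n \<le> i" "n + i \<le> N + N" "n \<le> N" for n N i
  proof (rule fps_cong_cancel)
    have stable: "fps_cong n (qfac ?q m) (qfac ?q n)" if "n \<le> m" for m
      using that
    proof (induction rule: dec_induct)
      case (step m)
      have "1 * Suc m \<le> s * Suc m"
        using s(2) by (intro mult_le_mono1) simp
      then have "n < s * Suc m"
        by (rule less_le_trans[rotated]) (use step in simp)
      then have "fps_cong n (1 - 1 * fps_X ^ (s * Suc m)) (1 :: 'a fps)"
        by (rule fps_cong_one_plus_X_power)
      then have "fps_cong n (qfac ?q m * (1 - ?q ^ Suc m)) (qfac ?q n * 1)"
        using step by (intro fps_cong_mult) (simp_all only: power_mult mult_1_left)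
      then show ?case by (simp only: qfac_Suc mult_1_right)
    qed simp
    have st: "fps_cong n (qfac ?q x) (qfac ?q y)" if "n \<le> x" "n \<le> y" for x y
      using stable[OF that(1)] stable[OF that(2)] by (meson fps_cong_sym fps_cong_trans)
    have "qbin ?q (N + N) i * qfac ?q N * (qfac ?q i * qfac ?q (N + N - i)) = qfac ?q (N + N) * qfac ?q N"
      using that by (subst qbin_qfac[of i "N + N", symmetric]) (auto simp: mult_ac)
    also have "fps_cong n \<dots> (qfac ?q i * qfac ?q (N + N - i))"
      using that by (intro fps_cong_mult st) auto
    finally show "fps_cong n (qbin ?q (N + N) i * qfac ?q N * (qfac ?q i * qfac ?q (N + N - i)))
        (1 * (qfac ?q i * qfac ?q (N + N - i)))" by simp
    show "fps_nth (qfac ?q i * qfac ?q (N + N - i)) 0 = 1"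
      by (simp add: qfac_nth_0)
  qed
  show ?thesis
    unfolding fps_tendsto_iff_cong eventually_sequentially
  proof (intro allI exI impI)
    \<comment> \<open>Weight at most \<open>n\<close> forces
      \<open>\<bar>j\<bar> \<le> n + 2\<close>; for \<open>N \<ge> 2 * n + 2\<close> the index
      \<open>i = j + N\<close> then lies between \<open>n\<close> and \<open>2 * N - n\<close>,
      where \<open>central\<close> applies.\<close>
    fix n N :: nat assume N: "2 * n + 2 \<le> N"
    have "0 < \<alpha> + \<beta>" using s by simp
    have prods: "(\<Prod>k<N. 1 + fps_const (U 1) * fps_X ^ (\<alpha> + s * k)) = (\<Prod>k<N. 1 + ?a * ?q ^ k)"
      "(\<Prod>k<N. 1 + fps_const (U (- 1)) * fps_X ^ (\<beta> + s * k)) = (\<Prod>k<N. 1 + ?b * ?q ^ k)"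
      "(\<Prod>k<N. 1 - fps_X ^ (s * Suc k)) = qfac ?q N"
      by (simp_all only: power_add power_mult mult.assoc qfac_def)
    have "(\<Prod>k<N. 1 + ?a * ?q ^ k) * (\<Prod>k<N. 1 + ?b * ?q ^ k) * qfac ?q N
        = (\<Sum>i\<le>N + N. qbin ?q (N + N) i * qfac ?q N * f (int i - int N))"
      unfolding finite_form by (simp add: sum_distrib_left sum_distrib_right mult_ac)
    also have "fps_cong n \<dots>
        (\<Sum>i\<le>N + N. if triwt \<alpha> \<beta> (int i - int N) \<le> n then f (int i - int N) else 0)"
    proof (rule fps_cong_sum)
      fix i assume "i \<in> {..N + N}"
      show "fps_cong n (qbin ?q (N + N) i * qfac ?q N * f (int i - int N))
          (if triwt \<alpha> \<beta> (int i - int N) \<le> n then f (int i - int N) else 0)"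
      proof (cases "triwt \<alpha> \<beta> (int i - int N) \<le> n")
        case True
        then have "\<bar>int i - int N\<bar> \<le> int n + 2"
          using abs_le_triwt[OF \<open>0 < \<alpha> + \<beta>\<close>, of "int i - int N"] by linarith
        then have "n \<le> i" "n + i \<le> N + N" "n \<le> N"
          using N by linarith+
        then have "fps_cong n (qbin ?q (N + N) i * qfac ?q N * f (int i - int N)) (1 * f (int i - int N))"
          by (intro fps_cong_mult central) auto
        then show ?thesis using True by simp
      next
        case False
        then have "fps_cong n (f (int i - int N)) 0"
          by (auto simp: fps_cong_def f_def fps_X_power_mult_right_nth)
        then have "fps_cong n (qbin ?q (N + N) i * qfac ?q N * f (int i - int N))
            (qbin ?q (N + N) i * qfac ?q N * 0)"
          by (intro fps_cong_mult) auto
        then show ?thesis using False by simp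
      qed
    qed
    also have "(\<Sum>i\<le>N + N. if triwt \<alpha> \<beta> (int i - int N) \<le> n then f (int i - int N) else 0)
        = (\<Sum>j\<in>{j \<in> UNIV. triwt \<alpha> \<beta> j \<le> n}. f j)"
    proof -
      have "bij_betw (\<lambda>i. int i - int N) {i \<in> {..N + N}. triwt \<alpha> \<beta> (int i - int N) \<le> n}
          {j \<in> UNIV. triwt \<alpha> \<beta> j \<le> n}"
      proof (rule bij_betwI')
        fix j assume "j \<in> {j \<in> UNIV. triwt \<alpha> \<beta> j \<le> n}"
        then have "\<bar>j\<bar> \<le> int n + 2" "triwt \<alpha> \<beta> j \<le> n"
          using abs_le_triwt[OF \<open>0 < \<alpha> + \<beta>\<close>, of j] by auto
        then show "\<exists>i\<in>{i \<in> {..N + N}. triwt \<alpha> \<beta> (int i - int N) \<le> n}. j = int i - int N"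
          using N by (intro bexI[of _ "nat (j + int N)"]) auto
      qed auto
      then have "(\<Sum>j\<in>{j \<in> UNIV. triwt \<alpha> \<beta> j \<le> n}. f j)
          = (\<Sum>i\<in>{i \<in> {..N + N}. triwt \<alpha> \<beta> (int i - int N) \<le> n}. f (int i - int N))"
        by (rule sum.reindex_bij_betw[symmetric])
      then show ?thesis
        by (simp only: sum.inter_filter[OF finite_atMost])
    qed
    also have "fps_cong n \<dots> (gser UNIV (triwt \<alpha> \<beta>) U)"
      unfolding f_def using graded_triwt[OF \<open>0 < \<alpha> + \<beta>\<close>] by (intro fps_cong_sym[OF fps_cong_gser])
    finally show "fps_cong n ((\<Prod>k<N. 1 + fps_const (U 1) * fps_X ^ (\<alpha> + s * k))
            * (\<Prod>k<N. 1 + fps_const (U (- 1)) * fps_X ^ (\<beta> + s * k))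
            * (\<Prod>k<N. 1 - fps_X ^ (s * Suc k))) (gser UNIV (triwt \<alpha> \<beta>) U)"
      unfolding prods .
  qed
qed

subsection \<open>Alternants and Schur polynomials\<close>

lemma mult_mat_mat:
  "mat n m (\<lambda>(i, k). f i k) * mat m p (\<lambda>(k, j). g k j)
    = mat n p (\<lambda>(i, j). \<Sum>k<m. f i k * g k j :: 'a::comm_semiring_0)"
  by (rule eq_matI) (auto simp: scalar_prod_def atLeast0LessThan intro!: sum.cong)

text \<open>The coefficients of the monic polynomial with roots \<open>a k\<close>, in the form of
  an evaluation identity usable directly as a matrix product.\<close>

lemma prod_linear_expansion:
  fixes a :: "nat \<Rightarrow> 'a::comm_ring_1"
  shows "\<exists>c. c n = 1 \<and> (\<forall>x. (\<Prod>k<n. x - a k) = (\<Sum>k\<le>n. c k * x ^ k))"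
proof (induction n)
  case 0
  show ?case by (intro exI[of _ "\<lambda>_. 1"]) simp
next
  case (Suc n)
  then obtain c where c: "c n = 1" "\<And>x. (\<Prod>k<n. x - a k) = (\<Sum>k\<le>n. c k * x ^ k)"
    by blast
  define d where "d k = (if k = 0 then 0 else c (k - 1)) - (if k \<le> n then a n * c k else 0)" for k
  have "(\<Prod>k<Suc n. x - a k) = (\<Sum>k\<le>Suc n. d k * x ^ k)" for x
  proof -
    have "(\<Sum>k\<le>Suc n. d k * x ^ k)
        = (\<Sum>k\<le>Suc n. (if k = 0 then 0 else c (k - 1)) * x ^ k) - (\<Sum>k\<le>Suc n. if k \<le> n then a n * c k * x ^ k else 0)"
      unfolding sum_subtractf[symmetric] by (intro sum.cong) (auto simp: d_def algebra_simps)
    also have "(\<Sum>k\<le>Suc n. (if k = 0 then 0 else c (k - 1)) * x ^ k) = (\<Sum>k\<le>n. c k * x ^ Suc k)"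
      by (subst sum.atMost_Suc_shift) simp
    also have "(\<Sum>k\<le>Suc n. if k \<le> n then a n * c k * x ^ k else 0) = (\<Sum>k\<le>n. a n * c k * x ^ k)"
      by (simp cong: sum.cong_simp)
    also have "(\<Sum>k\<le>n. c k * x ^ Suc k) - (\<Sum>k\<le>n. a n * c k * x ^ k) = (\<Prod>k<n. x - a k) * (x - a n)"
      unfolding c by (simp add: sum_distrib_left sum_distrib_right algebra_simps sum_subtractf)
    finally show ?thesis by simp
  qed
  then show ?case by (intro exI[of _ d]) (auto simp: d_def c)
qed

abbreviation pairs_below :: "nat \<Rightarrow> (nat \<times> nat) set" where
  "pairs_below n \<equiv> {(i, j). i < j \<and> j < n}"

lemma pairs_below_Suc: "pairs_below (Suc n) = pairs_below n \<union> (\<lambda>i. (i, n)) ` {..<n}"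
  by auto

lemma finite_pairs_below [simp]: "finite (pairs_below n)"
  by (rule finite_subset[of _ "{..<n} \<times> {..<n}"]) auto

lemma prod_pairs_below_Suc:
  "(\<Prod>(i, j)\<in>pairs_below (Suc n). f i j) = (\<Prod>(i, j)\<in>pairs_below n. f i j) * (\<Prod>i<n. f i n)"
  unfolding pairs_below_Suc
  by (subst prod.union_disjoint) (auto simp: prod.reindex inj_on_def)

lemma det_vandermonde:
  fixes a :: "nat \<Rightarrow> 'a::idom"
  shows "det (mat n n (\<lambda>(i, j). a i ^ j)) = (\<Prod>(i, j)\<in>pairs_below n. a j - a i)"
proof (induction n)
  case (Suc n)
  obtain c where c: "c n = 1" "\<And>x. (\<Prod>k<n. x - a k) = (\<Sum>k\<le>n. c k * x ^ k)"
    using prod_linear_expansion[of n a] by blast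
  \<comment> \<open>\<open>C\<close> is unitriangular, and multiplying by it replaces the last
    column by the values of the monic polynomial with roots \<open>a 0, ..., a (n - 1)\<close>;
    every entry of that column above the bottom one vanishes.\<close>
  define C where "C = mat (Suc n) (Suc n) (\<lambda>(k, j). if j = n then c k else if k = j then 1 else 0)"
  have "det C = prod_list (diag_mat C)"
    by (rule det_upper_triangular[of _ "Suc n"]) (auto simp: C_def)
  also have "diag_mat C = replicate (Suc n) 1"
    by (rule nth_equalityI) (auto simp: C_def diag_mat_def c nth_append simp del: upt_Suc replicate_Suc)
  finally have "det C = 1" by simp
  have "mat (Suc n) (Suc n) (\<lambda>(i, j). a i ^ j) * C
      = mat (Suc n) (Suc n) (\<lambda>(i, j). if j = n then \<Prod>k<n. a i - a k else a i ^ j)"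
    unfolding C_def mult_mat_mat
    by (rule cong_mat) (auto simp: c lessThan_Suc_atMost mult_ac if_distrib[of "\<lambda>x. _ * x"] cong: if_cong)
  also have "\<dots> = four_block_mat (mat n n (\<lambda>(i, j). a i ^ j)) (0\<^sub>m n 1)
      (mat 1 n (\<lambda>(i, j). a n ^ j)) (mat 1 1 (\<lambda>_. \<Prod>k<n. a n - a k))"
    by (rule eq_matI) (auto simp: less_Suc_eq)
  finally have "det (mat (Suc n) (Suc n) (\<lambda>(i, j). a i ^ j) * C)
      = det (mat n n (\<lambda>(i, j). a i ^ j)) * det (mat 1 1 (\<lambda>_. \<Prod>k<n. a n - a k))"
    by (simp, intro det_four_block_mat_upper_right_zero_col) auto
  also have "det (mat (Suc n) (Suc n) (\<lambda>(i, j). a i ^ j) * C) = det (mat (Suc n) (Suc n) (\<lambda>(i, j). a i ^ j))"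
    using \<open>det C = 1\<close> by (subst det_mult[of _ "Suc n"]) (auto simp: C_def)
  also have "det (mat 1 1 (\<lambda>_. \<Prod>k<n. a n - a k)) = (\<Prod>k<n. a n - a k)"
    by (subst det_single) auto
  finally show ?case
    by (simp only: Suc.IH prod_pairs_below_Suc)
qed simp

text \<open>Both products are Vandermonde determinants whose matrices differ by a row
  permutation.\<close>

lemma signof_prod_pairs_below:
  fixes a :: "nat \<Rightarrow> 'a::idom"
  assumes "\<pi> permutes {0..<n}"
  shows "(\<Prod>(i, j)\<in>pairs_below n. a (\<pi> j) - a (\<pi> i)) = signof \<pi> * (\<Prod>(i, j)\<in>pairs_below n. a j - a i)"
proof -
  let ?V = "mat n n (\<lambda>(i, j). a i ^ j)"
  have "det (mat n n (\<lambda>(i, j). ?V $$ (\<pi> i, j))) = signof \<pi> * det ?V"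
    by (rule det_permute_rows) (use assms in auto)
  moreover have "mat n n (\<lambda>(i, j). ?V $$ (\<pi> i, j)) = mat n n (\<lambda>(i, j). a (\<pi> i) ^ j)"
    using assms by (intro cong_mat) (auto simp: permutes_in_image[of \<pi> "{0..<n}", simplified])
  ultimately show ?thesis
    using det_vandermonde[of n "\<lambda>i. a (\<pi> i)"] by (simp add: det_vandermonde)
qed

text \<open>All \<open>a i\<close> are roots of one monic polynomial of degree \<open>n\<close>, so
  high powers reduce by coefficients that do not depend on \<open>i\<close>.\<close>

lemma power_reduction:
  fixes a :: "nat \<Rightarrow> 'a::comm_ring_1"
  shows "\<exists>c. \<forall>i<n. a i ^ e = (\<Sum>k<n. c k * a i ^ k)"
proof (cases n)
  case (Suc m)
  obtain d where d: "d n = 1" "\<And>x. (\<Prod>k<n. x - a k) = (\<Sum>k\<le>n. d k * x ^ k)"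
    using prod_linear_expansion[of n a] by blast
  have top: "a i ^ n = (\<Sum>k<n. - d k * a i ^ k)" if "i < n" for i
  proof -
    have "(\<Prod>k<n. a i - a k) = 0"
      using that by (intro prod_zero) auto
    then show ?thesis
      unfolding d by (simp add: d lessThan_Suc_atMost[symmetric] sum_negf eq_neg_iff_add_eq_0 add.commute)
  qed
  show ?thesis
  proof (induction e)
    case 0
    show ?case
      by (intro exI[of _ "\<lambda>k. if k = 0 then 1 else 0"]) (auto simp: Suc if_distrib[of "\<lambda>x. x * _"] cong: if_cong)
  next
    case (Suc e)
    then obtain c where c: "\<And>i. i < n \<Longrightarrow> a i ^ e = (\<Sum>k<n. c k * a i ^ k)" by blast
    \<comment> \<open>Multiplication by \<open>a i\<close> shifts the coefficients; the overflow
      \<open>c m * a i ^ n\<close> is replaced through \<open>top\<close>.\<close>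
    define c' where "c' k = (if k = 0 then 0 else c (k - 1)) - c m * d k" for k
    have "a i ^ Suc e = (\<Sum>k<n. c' k * a i ^ k)" if "i < n" for i
    proof -
      have "a i ^ Suc e = (\<Sum>k<n. c k * a i ^ Suc k)"
        using c[OF that] by (simp add: sum_distrib_left mult_ac)
      also have "\<dots> = (\<Sum>k<m. c k * a i ^ Suc k) + c m * a i ^ n"
        by (simp add: \<open>n = Suc m\<close>)
      also have "(\<Sum>k<m. c k * a i ^ Suc k) = (\<Sum>k<n. (if k = 0 then 0 else c (k - 1)) * a i ^ k)"
        unfolding \<open>n = Suc m\<close> by (subst sum.lessThan_Suc_shift) simp
      also have "a i ^ n = (\<Sum>k<n. - d k * a i ^ k)"
        by (rule top[OF that])
      finally show ?thesis
        by (simp add: c'_def sum_distrib_left algebra_simps sum_subtractf sum_negf)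
    qed
    then show ?case by blast
  qed
qed auto

text \<open>By \<open>power_reduction\<close> the matrix of powers factors through the Vandermonde
  matrix, and the quotient is the determinant of the coefficient matrix.\<close>

lemma det_powers_dvd:
  fixes a :: "nat \<Rightarrow> 'a::comm_ring_1"
  shows "\<exists>s. s * det (mat n n (\<lambda>(i, j). a i ^ (n - Suc j))) = det (mat n n (\<lambda>(i, j). a i ^ f j))"
proof -
  obtain c where c: "\<And>e i. i < n \<Longrightarrow> a i ^ e = (\<Sum>k<n. c e k * a i ^ k)"
    using power_reduction[of n a] by metis
  let ?C = "mat n n (\<lambda>(k, j). c (f j) (n - Suc k))"
  let ?V = "mat n n (\<lambda>(i, k). a i ^ (n - Suc k))"
  have "?V * ?C = mat n n (\<lambda>(i, j). a i ^ f j)"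
    unfolding mult_mat_mat
  proof (rule cong_mat)
    fix i j assume "i < n" "j < n"
    have "(\<Sum>k<n. a i ^ (n - Suc k) * c (f j) (n - Suc k)) = (\<Sum>k<n. c (f j) k * a i ^ k)"
      using sum.nat_diff_reindex[of "\<lambda>k. c (f j) k * a i ^ k" n] by (simp add: mult.commute)
    then show "(case (i, j) of (i, j) \<Rightarrow> \<Sum>k<n. a i ^ (n - Suc k) * c (f j) (n - Suc k))
        = (case (i, j) of (i, j) \<Rightarrow> a i ^ f j)"
      using c[OF \<open>i < n\<close>, of "f j"] by simp
  qed auto
  then have "det ?C * det ?V = det (mat n n (\<lambda>(i, j). a i ^ f j))"
    using det_mult[of ?V n ?C] by (simp add: mult.commute)
  then show ?thesis by blast
qed

section \<open>Alternants in Laurent polynomials\<close>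

lemma xpow_0 [simp]: "xpow i 0 = 1"
  by (simp add: xpow_def)

lemma xpow_add: "xpow i (a + b) = xpow i a * xpow i b"
  by (simp add: xpow_def mult_single single_add)

lemma xpow_of_nat: "xpow i (int n) = xpow i 1 ^ n"
  by (induction n) (simp_all add: xpow_add mult.commute)

lemma xpow_sum: "xpow i (\<Sum>a\<in>A. f a) = (\<Prod>a\<in>A. xpow i (f a))"
  by (induction A rule: infinite_finite_induct) (simp_all add: xpow_add)

lemma xpow_minus: "xpow i (- n) * xpow i n = 1"
  by (simp flip: xpow_add)

lemma xpow_1_inject: "xpow i 1 = xpow j 1 \<longleftrightarrow> i = j"
proof
  assume "xpow i 1 = xpow j 1"
  then have "Poly_Mapping.lookup (xpow i 1) (Poly_Mapping.single j 1) = 1"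
    by (simp add: xpow_def)
  then have "Poly_Mapping.single i (1 :: int) = Poly_Mapping.single j 1"
    by (auto simp: xpow_def lookup_single when_def split: if_splits)
  then have "Poly_Mapping.lookup (Poly_Mapping.single i (1 :: int)) j = 1"
    by simp
  then show "i = j"
    by (auto simp: lookup_single when_def split: if_splits)
qed auto

text \<open>Exponents are indexed from 0 and variables from 1.\<close>

definition monomial :: "nat \<Rightarrow> (nat \<Rightarrow> int) \<Rightarrow> laurent" where
  "monomial t e = (\<Prod>i<t. xpow (Suc i) (e i))"

definition alt :: "nat \<Rightarrow> (nat \<Rightarrow> int) \<Rightarrow> laurent" where
  "alt t e = det (mat t t (\<lambda>(i, j). xpow (Suc i) (e j)))"

lemma monomial_add: "monomial t (\<lambda>i. e i + f i) = monomial t e * monomial t f"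
  by (simp add: monomial_def xpow_add prod.distrib)

lemma alt_leibniz: "alt t e = (\<Sum>\<pi> | \<pi> permutes {0..<t}. signof \<pi> * monomial t (\<lambda>i. e (\<pi> i)))"
  unfolding alt_def
  by (subst det_def') (auto simp: monomial_def atLeast0LessThan permutes_in_image[of _ "{..<_}", simplified]
      intro!: sum.cong arg_cong[of _ _ "(*) _"] prod.cong)

lemma alt_shift: "alt t (\<lambda>j. e j + c) = monomial t (\<lambda>_. c) * alt t e"
  by (simp add: alt_leibniz monomial_add sum_distrib_left mult_ac)

lemma alt_permute:
  assumes "\<pi> permutes {0..<t}"
  shows "alt t (\<lambda>j. e (\<pi> j)) = signof \<pi> * alt t e"
proof -
  \<comment> \<open>Exponents index the columns; transposing lets a row permutation act on
    them.\<close>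
  let ?A = "\<lambda>e. mat t t (\<lambda>(j, i). xpow (Suc i) (e j))"
  have T: "alt t e = det (?A e)" for e
    unfolding alt_def by (subst det_transpose[symmetric]) (auto intro!: arg_cong[of _ _ det] eq_matI)
  have "det (mat t t (\<lambda>(j, i). ?A e $$ (\<pi> j, i))) = signof \<pi> * det (?A e)"
    by (rule det_permute_rows) (use assms in auto)
  moreover have "mat t t (\<lambda>(j, i). ?A e $$ (\<pi> j, i)) = ?A (\<lambda>j. e (\<pi> j))"
    using assms by (intro cong_mat) (auto simp: permutes_in_image[of \<pi> "{0..<t}", simplified])
  ultimately show ?thesis by (simp add: T)
qed

lemma alt_int: "alt t int = (\<Prod>(i, j)\<in>pairs_below t. xpow (Suc j) 1 - xpow (Suc i) 1)"
  unfolding alt_def xpow_of_nat by (rule det_vandermonde)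

lemma alt_int_nonzero: "alt t int \<noteq> 0"
  unfolding alt_int by (auto simp: prod_zero_iff xpow_1_inject)

lemma alternant_eq_alt: "alternant t f = alt t (\<lambda>j. int (f (Suc j)))"
  by (simp add: alternant_def alt_def)

text \<open>Turns the increasing exponents of \<open>alt t int\<close> into the decreasing ones of
  the Schur denominator. Being the identity from \<open>t\<close> on makes it a permutation in the
  sense of \<open>permutes\<close>.\<close>

definition rev_perm :: "nat \<Rightarrow> nat \<Rightarrow> nat" where
  "rev_perm t j = (if j < t then t - Suc j else j)"

lemma rev_perm_permutes: "rev_perm t permutes {0..<t}"
proof (rule bij_imp_permutes)
  show "bij_betw (rev_perm t) {0..<t} {0..<t}"
    by (rule bij_betw_byWitness[of _ "rev_perm t"]) (auto simp: rev_perm_def)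
qed (simp add: rev_perm_def)

lemma alternant_vandermonde: "alternant t (\<lambda>j. t - j) = signof (rev_perm t) * alt t int"
proof -
  have "alternant t (\<lambda>j. t - j) = alt t (\<lambda>j. int (rev_perm t j))"
    unfolding alternant_eq_alt alt_def
    by (intro arg_cong[of _ _ det] cong_mat) (auto simp: rev_perm_def)
  then show ?thesis by (simp add: alt_permute rev_perm_permutes)
qed

lemma signof_mult_signof [simp]: "signof \<pi> * signof \<pi> = (1 :: 'a::comm_ring_1)"
  by (simp add: sign_def)

lemma alternant_vandermonde_nonzero: "alternant t (\<lambda>j. t - j) \<noteq> 0"
proof
  assume "alternant t (\<lambda>j. t - j) = 0"
  then have "signof (rev_perm t) * (signof (rev_perm t) * alt t int) = 0"
    by (simp add: alternant_vandermonde)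
  then show False
    by (simp add: mult.assoc[symmetric] alt_int_nonzero del: mult_eq_0_iff)
qed

text \<open>Existence of the quotient comes from \<open>det_powers_dvd\<close>, uniqueness from
  cancelling a nonzero element of a domain; together they justify the definite description.\<close>

lemma schur_mult_vandermonde:
  "schur t \<mu> * alternant t (\<lambda>j. t - j) = alternant t (\<lambda>j. \<mu> j + t - j)"
proof -
  have "\<exists>s. s * alternant t (\<lambda>j. t - j) = alternant t (\<lambda>j. \<mu> j + t - j)"
    unfolding alternant_def xpow_of_nat
    using det_powers_dvd[of t "\<lambda>i. xpow (i + 1) 1" "\<lambda>j. \<mu> (j + 1) + t - (j + 1)"] by simp
  then have "\<exists>!s. s * alternant t (\<lambda>j. t - j) = alternant t (\<lambda>j. \<mu> j + t - j)"
    using alternant_vandermonde_nonzero by (metis mult_right_cancel)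
  then show ?thesis
    unfolding schur_def by (rule theI')
qed

subsection \<open>The lattice sum\<close>

definition psgn :: "int \<Rightarrow> 'a::comm_ring_1" where
  "psgn n = (if even n then 1 else -1)"

lemma psgn_0 [simp]: "psgn 0 = 1"
  by (simp add: psgn_def)

lemma psgn_add: "psgn (i + j) = psgn i * psgn j"
  by (simp add: psgn_def)

lemma psgn_even [simp]: "even i \<Longrightarrow> psgn i = 1"
  by (simp add: psgn_def)

lemma psgn_sum: "psgn (\<Sum>a\<in>A. f a) = (\<Prod>a\<in>A. psgn (f a))"
  by (induction A rule: infinite_finite_induct) (simp_all add: psgn_add)

lemma of_int_psgn [simp]: "of_int (psgn n) = psgn n"
  by (simp add: psgn_def)

lemma offdiag_eq: "(SIGMA p:{..<t}. {..<t} - {p}) = pairs_below t \<union> prod.swap ` pairs_below t"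
  by (auto simp: image_iff)

text \<open>Theta factors are indexed by pairs \<open>i < j\<close>, whereas exponents of a single
  variable collect all \<open>q \<noteq> p\<close>; this converts one kind of sum into the
  other.\<close>

lemma sum_pairs_below_symmetric:
  fixes g :: "nat \<Rightarrow> nat \<Rightarrow> 'a::comm_monoid_add"
  shows "(\<Sum>(i, j)\<in>pairs_below t. g i j + g j i) = (\<Sum>p<t. \<Sum>q\<in>{..<t} - {p}. g p q)"
proof -
  have "(\<Sum>p<t. \<Sum>q\<in>{..<t} - {p}. g p q) = (\<Sum>(p, q)\<in>pairs_below t \<union> prod.swap ` pairs_below t. g p q)"
    by (simp add: sum.Sigma offdiag_eq)
  also have "\<dots> = (\<Sum>(i, j)\<in>pairs_below t. g i j) + (\<Sum>(i, j)\<in>prod.swap ` pairs_below t. g i j)"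
    by (rule sum.union_disjoint) auto
  also have "(\<Sum>(i, j)\<in>prod.swap ` pairs_below t. g i j) = (\<Sum>(i, j)\<in>pairs_below t. g j i)"
    by (subst sum.reindex) (auto simp: case_prod_unfold)
  finally show ?thesis
    by (simp add: sum.distrib case_prod_unfold)
qed

lemma prod_pairs_below_symmetric:
  fixes g :: "nat \<Rightarrow> nat \<Rightarrow> 'a::comm_monoid_mult"
  shows "(\<Prod>(i, j)\<in>pairs_below t. g i j * g j i) = (\<Prod>p<t. \<Prod>q\<in>{..<t} - {p}. g p q)"
proof -
  have "(\<Prod>p<t. \<Prod>q\<in>{..<t} - {p}. g p q) = (\<Prod>(p, q)\<in>pairs_below t \<union> prod.swap ` pairs_below t. g p q)"
    by (simp add: prod.Sigma offdiag_eq)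
  also have "\<dots> = (\<Prod>(i, j)\<in>pairs_below t. g i j) * (\<Prod>(i, j)\<in>prod.swap ` pairs_below t. g i j)"
    by (rule prod.union_disjoint) auto
  also have "(\<Prod>(i, j)\<in>prod.swap ` pairs_below t. g i j) = (\<Prod>(i, j)\<in>pairs_below t. g j i)"
    by (subst prod.reindex) (auto simp: case_prod_unfold)
  finally show ?thesis
    by (simp add: prod.distrib case_prod_unfold)
qed

text \<open>
  The exponents chosen in the theta factors form a family \<open>k\<close> with \<open>k i j + k j i = 1\<close> for
  \<open>i \<noteq> j\<close>; it is stored through its values \<open>\<kappa> (i, j) = k j i\<close> for \<open>i < j\<close>.
\<close>

definition skew :: "(nat \<times> nat \<Rightarrow> int) \<Rightarrow> nat \<Rightarrow> nat \<Rightarrow> int" where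
  "skew \<kappa> i j = (if i < j then 1 - \<kappa> (i, j) else \<kappa> (j, i))"

text \<open>The exponent of the variable with index \<open>p\<close> in the expanded theta product.
  Each pair distributes \<open>skew \<kappa> p q + skew \<kappa> q p = 1\<close> point, as in the
  score sequence of a tournament.\<close>

definition score :: "nat \<Rightarrow> (nat \<times> nat \<Rightarrow> int) \<Rightarrow> nat \<Rightarrow> int" where
  "score t \<kappa> p = (\<Sum>q\<in>{..<t} - {p}. skew \<kappa> q p)"

definition skew_weight :: "nat \<Rightarrow> (nat \<times> nat \<Rightarrow> int) \<Rightarrow> int" where
  "skew_weight t \<kappa> = (\<Sum>e\<in>pairs_below t. tri (\<kappa> e))"

definition skew_sign :: "nat \<Rightarrow> (nat \<times> nat \<Rightarrow> int) \<Rightarrow> int" where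
  "skew_sign t \<kappa> = psgn (\<Sum>e\<in>pairs_below t. \<kappa> e)"

definition skew_families :: "nat \<Rightarrow> (nat \<times> nat \<Rightarrow> int) set" where
  "skew_families t = (pairs_below t \<rightarrow>\<^sub>E UNIV)"

text \<open>The coefficient of \<open>x^m T^n\<close> in the product of all theta factors. The
  weight \<open>n\<close> is an integer so that it can be shifted without truncation.\<close>

definition acoef :: "nat \<Rightarrow> (nat \<Rightarrow> int) \<Rightarrow> int \<Rightarrow> int" where
  "acoef t m n = (\<Sum>\<kappa> | \<kappa> \<in> skew_families t \<and> (\<forall>p<t. score t \<kappa> p = m p) \<and> skew_weight t \<kappa> = n. skew_sign t \<kappa>)"

lemma skew_swap: "i \<noteq> j \<Longrightarrow> skew \<kappa> j i = 1 - skew \<kappa> i j"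
  by (auto simp: skew_def)

lemma tri_reflect: "tri (1 - j) = tri j"
  by (simp add: tri_def algebra_simps)

lemma tri_skew: "tri (skew \<kappa> i j) = tri (\<kappa> (min i j, max i j))"
  by (auto simp: skew_def tri_reflect min_def max_def)

lemma acoef_cong: "(\<And>p. p < t \<Longrightarrow> m p = m' p) \<Longrightarrow> acoef t m n = acoef t m' n"
  unfolding acoef_def by (intro sum.cong) auto

text \<open>Each pair contributes one in total; the theta product is homogeneous in the
  variables.\<close>

lemma sum_score: "(\<Sum>p<t. score t \<kappa> p) = int (card (pairs_below t))"
proof -
  have "(\<Sum>p<t. score t \<kappa> p) = (\<Sum>(i, j)\<in>pairs_below t. skew \<kappa> j i + skew \<kappa> i j)"
    unfolding score_def by (rule sum_pairs_below_symmetric[symmetric])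
  also have "\<dots> = (\<Sum>(i, j)\<in>pairs_below t. 1)"
    by (intro sum.cong) (auto simp: skew_def)
  finally show ?thesis by simp
qed

lemma acoef_nonzeroD:
  assumes "acoef t m n \<noteq> 0"
  shows "(\<Sum>p<t. m p) = int (card (pairs_below t))" "0 \<le> n"
    "\<exists>\<kappa>\<in>skew_families t. (\<forall>p<t. score t \<kappa> p = m p) \<and> skew_weight t \<kappa> = n"
proof -
  show *: "\<exists>\<kappa>\<in>skew_families t. (\<forall>p<t. score t \<kappa> p = m p) \<and> skew_weight t \<kappa> = n"
  proof (rule ccontr)
    assume "\<not> ?thesis"
    then have "{\<kappa>. \<kappa> \<in> skew_families t \<and> (\<forall>p<t. score t \<kappa> p = m p) \<and> skew_weight t \<kappa> = n} = {}"
      by blast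
    then show False using assms by (simp only: acoef_def sum.empty)
  qed
  then obtain \<kappa> where \<kappa>: "\<And>p. p < t \<Longrightarrow> score t \<kappa> p = m p" "skew_weight t \<kappa> = n"
    by blast
  have "(\<Sum>p<t. m p) = (\<Sum>p<t. score t \<kappa> p)"
    by (intro sum.cong) (simp_all add: \<kappa>(1))
  then show "(\<Sum>p<t. m p) = int (card (pairs_below t))"
    by (simp only: sum_score)
  show "0 \<le> n"
    unfolding \<kappa>(2)[symmetric] skew_weight_def by (intro sum_nonneg tri_nonneg)
qed

lemma sum_others:
  fixes \<nu> :: "nat \<Rightarrow> int"
  assumes "p < t"
  shows "(\<Sum>q\<in>{..<t} - {p}. \<nu> q) = (\<Sum>q<t. \<nu> q) - \<nu> p"
  using assms by (simp add: sum_diff1)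

text \<open>Every index lies in \<open>t - 1\<close> pairs. Signs are insensitive to lattice
  translations for this reason, both for theta families and for short hooks.\<close>

lemma sum_pairs_below_add:
  fixes \<nu> :: "nat \<Rightarrow> int"
  assumes "(\<Sum>p<t. \<nu> p) = 0"
  shows "(\<Sum>(i, j)\<in>pairs_below t. \<nu> i + \<nu> j) = 0"
proof -
  have "(\<Sum>(i, j)\<in>pairs_below t. \<nu> i + \<nu> j) = (\<Sum>p<t. \<Sum>q\<in>{..<t} - {p}. \<nu> p)"
    by (rule sum_pairs_below_symmetric)
  also have "\<dots> = (\<Sum>p<t. (int t - 1) * \<nu> p)"
  proof (rule sum.cong[OF refl])
    fix p assume "p \<in> {..<t}"
    then have "int (card ({..<t} - {p})) = int t - 1"
      by (simp add: of_nat_diff)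
    then show "(\<Sum>q\<in>{..<t} - {p}. \<nu> p) = (int t - 1) * \<nu> p"
      by (simp only: sum_constant)
  qed
  finally show ?thesis
    by (simp only: sum_distrib_left[symmetric] assms mult_zero_right)
qed

text \<open>Adding \<open>\<nu> p - \<nu> q\<close> to \<open>skew \<kappa> q p\<close> keeps the
  two values of a pair complementary, and moves the score at \<open>p\<close> by
  \<open>t * \<nu> p\<close> because the \<open>\<nu> q\<close> sum to 0. The weight condition is
  doubled to avoid halving triangular numbers.\<close>

lemma acoef_translate:
  assumes \<nu>: "(\<Sum>p<t. \<nu> p) = 0"
    and n': "2 * (n' - n) = 2 * (\<Sum>p<t. m p * \<nu> p) + int t * (\<Sum>p<t. (\<nu> p)\<^sup>2)"
  shows "acoef t (\<lambda>p. m p + int t * \<nu> p) n' = acoef t m n"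
proof -
  \<comment> \<open>The values \<open>1\<close> and \<open>-1\<close> of \<open>s\<close> give the
    two directions of the bijection; \<open>restrict\<close> keeps the families extensional.\<close>
  define sh where "sh s \<kappa> = restrict (\<lambda>(i, j). \<kappa> (i, j) + s * (\<nu> i - \<nu> j)) (pairs_below t)"
    for s :: int and \<kappa> :: "nat \<times> nat \<Rightarrow> int"
  have sum0: "(\<Sum>(i, j)\<in>pairs_below t. \<nu> i + \<nu> j) = 0"
    by (rule sum_pairs_below_add[OF \<nu>])
  have sh_fam: "sh s \<kappa> \<in> skew_families t" for s \<kappa>
    by (auto simp: sh_def skew_families_def)
  have sh_inv: "sh (- s) (sh s \<kappa>) = \<kappa>" if "\<kappa> \<in> skew_families t" for s \<kappa>
  proof
    fix e
    show "sh (- s) (sh s \<kappa>) e = \<kappa> e"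
    proof (cases "e \<in> pairs_below t")
      case True
      then show ?thesis by (cases e) (simp add: sh_def)
    next
      case False
      have "sh (- s) (sh s \<kappa>) e = undefined" "\<kappa> e = undefined"
        using that PiE_arb[OF sh_fam[unfolded skew_families_def] False] PiE_arb[OF _ False, of \<kappa> "\<lambda>_. UNIV"]
        by (auto simp only: skew_families_def)
      then show ?thesis by simp
    qed
  qed
  have skew_sh: "skew (sh s \<kappa>) q p = skew \<kappa> q p + s * (\<nu> p - \<nu> q)" if "p < t" "q < t" "q \<noteq> p" for s \<kappa> p q
    using that by (auto simp: skew_def sh_def algebra_simps)
  have score_sh: "score t (sh s \<kappa>) p = score t \<kappa> p + int t * (s * \<nu> p)" if "p < t" for s \<kappa> p
  proof -
    have "score t (sh s \<kappa>) p = (\<Sum>q\<in>{..<t} - {p}. skew \<kappa> q p + s * (\<nu> p - \<nu> q))"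
      unfolding score_def using that by (intro sum.cong) (auto simp: skew_sh)
    also have "\<dots> = score t \<kappa> p + s * (\<Sum>q\<in>{..<t} - {p}. \<nu> p - \<nu> q)"
      unfolding score_def by (simp only: sum.distrib sum_distrib_left)
    also have "(\<Sum>q\<in>{..<t} - {p}. \<nu> p - \<nu> q) = int t * \<nu> p"
      using that by (simp add: sum_subtractf sum_others \<nu> of_nat_diff algebra_simps)
    finally show ?thesis by (simp only: mult.left_commute)
  qed
  have weight_sh: "2 * (skew_weight t (sh 1 \<kappa>) - skew_weight t \<kappa>)
      = 2 * (\<Sum>p<t. score t \<kappa> p * \<nu> p) + int t * (\<Sum>p<t. (\<nu> p)\<^sup>2)" for \<kappa>
  proof -
    have "2 * (skew_weight t (sh 1 \<kappa>) - skew_weight t \<kappa>)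
        = (\<Sum>(i, j)\<in>pairs_below t. 2 * tri (\<kappa> (i, j) + (\<nu> i - \<nu> j)) - 2 * tri (\<kappa> (i, j)))"
      unfolding skew_weight_def sum_subtractf[symmetric] sum_distrib_left
      by (intro sum.cong) (auto simp: sh_def)
    \<comment> \<open>Written symmetrically in \<open>i\<close> and \<open>j\<close>, so that the
      pair sums become sums over single indices; the final \<open>\<nu> i + \<nu> j\<close> sums to
      0.\<close>
    also have "\<dots> = (\<Sum>(i, j)\<in>pairs_below t.
          2 * (skew \<kappa> j i * \<nu> i + skew \<kappa> i j * \<nu> j)
          + (((\<nu> i)\<^sup>2 - \<nu> i * \<nu> j) + ((\<nu> j)\<^sup>2 - \<nu> j * \<nu> i)) - (\<nu> i + \<nu> j))"
    proof (intro sum.cong refl, clarify)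
      fix i j :: nat assume "i < j"
      then have "skew \<kappa> j i = \<kappa> (i, j)" "skew \<kappa> i j = 1 - \<kappa> (i, j)"
        by (auto simp: skew_def)
      then show "2 * tri (\<kappa> (i, j) + (\<nu> i - \<nu> j)) - 2 * tri (\<kappa> (i, j))
          = 2 * (skew \<kappa> j i * \<nu> i + skew \<kappa> i j * \<nu> j)
          + (((\<nu> i)\<^sup>2 - \<nu> i * \<nu> j) + ((\<nu> j)\<^sup>2 - \<nu> j * \<nu> i)) - (\<nu> i + \<nu> j)"
        unfolding two_tri by (simp only:) (simp add: power2_eq_square algebra_simps)
    qed
    also have "\<dots> = 2 * (\<Sum>(i, j)\<in>pairs_below t. skew \<kappa> j i * \<nu> i + skew \<kappa> i j * \<nu> j)
          + (\<Sum>(i, j)\<in>pairs_below t. ((\<nu> i)\<^sup>2 - \<nu> i * \<nu> j) + ((\<nu> j)\<^sup>2 - \<nu> j * \<nu> i))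
          - (\<Sum>(i, j)\<in>pairs_below t. \<nu> i + \<nu> j)"
      by (simp only: sum.distrib sum_subtractf case_prod_unfold sum_distrib_left distrib_left)
    also have "(\<Sum>(i, j)\<in>pairs_below t. skew \<kappa> j i * \<nu> i + skew \<kappa> i j * \<nu> j)
        = (\<Sum>p<t. \<Sum>q\<in>{..<t} - {p}. skew \<kappa> q p * \<nu> p)"
      by (rule sum_pairs_below_symmetric)
    also have "\<dots> = (\<Sum>p<t. score t \<kappa> p * \<nu> p)"
      by (simp add: score_def sum_distrib_right)
    also have "(\<Sum>(i, j)\<in>pairs_below t. ((\<nu> i)\<^sup>2 - \<nu> i * \<nu> j) + ((\<nu> j)\<^sup>2 - \<nu> j * \<nu> i))
        = (\<Sum>p<t. \<Sum>q\<in>{..<t} - {p}. (\<nu> p)\<^sup>2 - \<nu> p * \<nu> q)"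
      by (rule sum_pairs_below_symmetric)
    also have "\<dots> = (\<Sum>p<t. int t * (\<nu> p)\<^sup>2)"
    proof (intro sum.cong refl)
      fix p assume "p \<in> {..<t}"
      then have "(\<Sum>q\<in>{..<t} - {p}. (\<nu> p)\<^sup>2 - \<nu> p * \<nu> q)
          = (int t - 1) * (\<nu> p)\<^sup>2 - \<nu> p * (\<Sum>q\<in>{..<t} - {p}. \<nu> q)"
        by (simp add: sum_subtractf sum_distrib_left of_nat_diff)
      with \<open>p \<in> {..<t}\<close> show "(\<Sum>q\<in>{..<t} - {p}. (\<nu> p)\<^sup>2 - \<nu> p * \<nu> q) = int t * (\<nu> p)\<^sup>2"
        by (simp add: sum_others \<nu> power2_eq_square algebra_simps)
    qed
    finally show ?thesis by (simp add: sum0 sum_distrib_left)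
  qed
  \<comment> \<open>The shifts \<open>\<nu> i - \<nu> j\<close> have the parity of
    \<open>\<nu> i + \<nu> j\<close>, which add up to 0.\<close>
  have sign_sh: "skew_sign t (sh 1 \<kappa>) = skew_sign t \<kappa>" for \<kappa>
  proof -
    have "(\<Sum>e\<in>pairs_below t. sh 1 \<kappa> e)
        = (\<Sum>(i, j)\<in>pairs_below t. \<kappa> (i, j) + ((\<nu> i + \<nu> j) - 2 * \<nu> j))"
      by (intro sum.cong) (auto simp: sh_def)
    also have "\<dots> = (\<Sum>e\<in>pairs_below t. \<kappa> e)
        + ((\<Sum>(i, j)\<in>pairs_below t. \<nu> i + \<nu> j) - 2 * (\<Sum>(i, j)\<in>pairs_below t. \<nu> j))"
      by (simp only: sum.distrib sum_subtractf case_prod_unfold sum_distrib_left prod.collapse)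
    finally have "(\<Sum>e\<in>pairs_below t. sh 1 \<kappa> e)
        = (\<Sum>e\<in>pairs_below t. \<kappa> e) + 2 * (- (\<Sum>(i, j)\<in>pairs_below t. \<nu> j))"
      unfolding sum0 by simp
    then show ?thesis
      by (simp only: skew_sign_def psgn_add) (simp add: psgn_def)
  qed
  show ?thesis
    unfolding acoef_def
  proof (rule sum.reindex_bij_witness[of _ "sh 1" "sh (- 1)"])
    fix \<kappa> assume "\<kappa> \<in> {\<kappa>. \<kappa> \<in> skew_families t \<and> (\<forall>p<t. score t \<kappa> p = m p + int t * \<nu> p) \<and> skew_weight t \<kappa> = n'}"
    then have \<kappa>: "\<kappa> \<in> skew_families t" "\<And>p. p < t \<Longrightarrow> score t \<kappa> p = m p + int t * \<nu> p" "skew_weight t \<kappa> = n'"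
      by auto
    show inv: "sh 1 (sh (- 1) \<kappa>) = \<kappa>"
      using sh_inv[OF \<kappa>(1), of "-1"] by simp
    have "score t (sh (- 1) \<kappa>) p = m p" if "p < t" for p
      using that \<kappa> by (simp add: score_sh)
    moreover from this have "(\<Sum>p<t. score t (sh (- 1) \<kappa>) p * \<nu> p) = (\<Sum>p<t. m p * \<nu> p)"
      by (intro sum.cong) auto
    then have "2 * (n' - skew_weight t (sh (- 1) \<kappa>)) = 2 * (n' - n)"
      unfolding n' using weight_sh[of "sh (- 1) \<kappa>"] by (simp only: inv \<kappa>(3))
    then have "skew_weight t (sh (- 1) \<kappa>) = n"
      by simp
    ultimately show "sh (- 1) \<kappa> \<in> {\<kappa>. \<kappa> \<in> skew_families t \<and> (\<forall>p<t. score t \<kappa> p = m p) \<and> skew_weight t \<kappa> = n}"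
      by (simp add: sh_fam)
    show "skew_sign t (sh (- 1) \<kappa>) = skew_sign t \<kappa>"
      using sign_sh[of "sh (- 1) \<kappa>"] inv by simp
  next
    fix \<kappa> assume "\<kappa> \<in> {\<kappa>. \<kappa> \<in> skew_families t \<and> (\<forall>p<t. score t \<kappa> p = m p) \<and> skew_weight t \<kappa> = n}"
    then have \<kappa>: "\<kappa> \<in> skew_families t" "\<And>p. p < t \<Longrightarrow> score t \<kappa> p = m p" "skew_weight t \<kappa> = n"
      by auto
    show "sh (- 1) (sh 1 \<kappa>) = \<kappa>"
      by (rule sh_inv[OF \<kappa>(1)])
    have "(\<Sum>p<t. score t \<kappa> p * \<nu> p) = (\<Sum>p<t. m p * \<nu> p)"
      by (intro sum.cong) (auto simp: \<kappa>(2))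
    then have "2 * (skew_weight t (sh 1 \<kappa>) - n) = 2 * (n' - n)"
      unfolding n' using weight_sh[of \<kappa>] by (simp only: \<kappa>(3))
    then have "skew_weight t (sh 1 \<kappa>) = n'"
      by simp
    then show "sh 1 \<kappa> \<in> {\<kappa>. \<kappa> \<in> skew_families t \<and> (\<forall>p<t. score t \<kappa> p = m p + int t * \<nu> p) \<and> skew_weight t \<kappa> = n'}"
      using \<kappa> by (simp add: sh_fam score_sh)
  qed
qed

lemma sgn_prod: "sgn (\<Prod>a\<in>A. f a) = (\<Prod>a\<in>A. sgn (f a :: 'a::linordered_idom))"
  by (induction A rule: infinite_finite_induct) (simp_all add: sgn_mult)

text \<open>Apply \<open>sgn\<close> to the permuted Vandermonde product of
  \<open>0, ..., t - 1\<close>; the unpermuted one is positive.\<close>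

lemma sign_eq_prod_sgn:
  assumes "\<pi> permutes {0..<t}"
  shows "sign \<pi> = (\<Prod>(i, j)\<in>pairs_below t. sgn (int (\<pi> j) - int (\<pi> i)))"
proof -
  let ?P = "\<Prod>(i, j)\<in>pairs_below t. int j - int i"
  have "(\<Prod>(i, j)\<in>pairs_below t. sgn (int (\<pi> j) - int (\<pi> i)))
      = sgn (\<Prod>(i, j)\<in>pairs_below t. int (\<pi> j) - int (\<pi> i))"
    unfolding sgn_prod by (rule prod.cong) auto
  also have "(\<Prod>(i, j)\<in>pairs_below t. int (\<pi> j) - int (\<pi> i)) = sign \<pi> * ?P"
    using signof_prod_pairs_below[OF assms, of int] by (simp only: of_int_eq_id id_apply)
  also have "sgn (sign \<pi> * ?P) = sgn (sign \<pi>)"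
  proof -
    have "0 < ?P" by (rule prod_pos) auto
    then show ?thesis by (simp only: sgn_mult sgn_1_pos[THEN iffD2] sgn_pos mult_1_right)
  qed
  also have "\<dots> = sign \<pi>" by (simp add: sign_def)
  finally show ?thesis by (rule sym)
qed

text \<open>The action on unordered pairs, each stored in increasing order.\<close>

lemma bij_betw_sorted_image:
  assumes "\<pi> permutes {0..<t}"
  shows "bij_betw (\<lambda>(i, j). (min (\<pi> i) (\<pi> j), max (\<pi> i) (\<pi> j))) (pairs_below t) (pairs_below t)"
proof -
  have lt: "\<pi> i < t \<longleftrightarrow> i < t" for i
    using permutes_in_image[OF assms, of i] by simp
  have inj: "\<pi> i = \<pi> j \<longleftrightarrow> i = j" for i j
    using permutes_inj[OF assms] by (auto simp: inj_def)
  have "inj_on (\<lambda>(i, j). (min (\<pi> i) (\<pi> j), max (\<pi> i) (\<pi> j))) (pairs_below t)"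
    by (auto simp: inj_on_def min_def max_def inj split: if_splits)
  moreover have "(\<lambda>(i, j). (min (\<pi> i) (\<pi> j), max (\<pi> i) (\<pi> j))) ` pairs_below t \<subseteq> pairs_below t"
  proof (rule image_subsetI)
    fix e assume "e \<in> pairs_below t"
    then obtain i j where e: "e = (i, j)" "i < j" "j < t"
      by auto
    then have "\<pi> i < t" "\<pi> j < t" "\<pi> i \<noteq> \<pi> j"
      by (auto simp: lt inj)
    then show "(\<lambda>(i, j). (min (\<pi> i) (\<pi> j), max (\<pi> i) (\<pi> j))) e \<in> pairs_below t"
      unfolding e(1) by (auto simp: min_def max_def)
  qed
  ultimately show ?thesis
    by (simp add: bij_betw_def endo_inj_surj)
qed

text \<open>Relabelling by \<open>\<pi>\<close> replaces \<open>\<kappa>\<close> by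
  \<open>1 - \<kappa>\<close> exactly on the pairs whose order is reversed. This leaves
  \<open>tri\<close> unchanged and flips the parity, so the signs multiply to
  \<open>sign \<pi>\<close>.\<close>

lemma acoef_permute:
  assumes "\<pi> permutes {0..<t}"
  shows "acoef t (\<lambda>p. m (\<pi> p)) n = sign \<pi> * acoef t m n"
proof -
  define act where "act \<pi> \<kappa> = restrict (\<lambda>(i, j). skew \<kappa> (\<pi> j) (\<pi> i)) (pairs_below t)"
    for \<pi> :: "nat \<Rightarrow> nat" and \<kappa>
  have act_fam: "act \<pi> \<kappa> \<in> skew_families t" for \<pi> \<kappa>
    by (auto simp: act_def skew_families_def)
  have skew_act: "skew (act \<pi> \<kappa>) i j = skew \<kappa> (\<pi> i) (\<pi> j)"
    if "\<pi> permutes {0..<t}" "i < t" "j < t" "i \<noteq> j" for \<pi> \<kappa> i j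
  proof -
    have "\<pi> i \<noteq> \<pi> j"
      using permutes_inj[OF that(1)] that(4) by (simp add: inj_eq)
    then have "skew \<kappa> (\<pi> j) (\<pi> i) = 1 - skew \<kappa> (\<pi> i) (\<pi> j)"
      by (rule skew_swap)
    then show ?thesis
      unfolding skew_def[of "act \<pi> \<kappa>"] using that by (cases "i < j") (simp_all add: act_def)
  qed
  have act_inv: "act \<rho> (act \<pi> \<kappa>) = \<kappa>"
    if "\<pi> permutes {0..<t}" "\<rho> permutes {0..<t}" "\<And>i. \<pi> (\<rho> i) = i" "\<kappa> \<in> skew_families t" for \<pi> \<rho> \<kappa>
  proof
    fix e
    show "act \<rho> (act \<pi> \<kappa>) e = \<kappa> e"
    proof (cases "e \<in> pairs_below t")
      case True
      then obtain i j where e: "e = (i, j)" "i < j" "j < t" by auto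
      then have "\<rho> i < t" "\<rho> j < t" "\<rho> i \<noteq> \<rho> j"
        using permutes_in_image[OF that(2)] permutes_inj[OF that(2)] by (auto simp: inj_eq)
      then have "act \<rho> (act \<pi> \<kappa>) e = skew \<kappa> (\<pi> (\<rho> j)) (\<pi> (\<rho> i))"
        using e skew_act[OF that(1)] by (simp add: act_def[of \<rho>])
      then show ?thesis using e by (simp add: that(3) skew_def)
    next
      case False
      have "act \<rho> (act \<pi> \<kappa>) e = undefined" "\<kappa> e = undefined"
        using that(4) PiE_arb[OF act_fam[unfolded skew_families_def] False] PiE_arb[OF _ False, of \<kappa> "\<lambda>_. UNIV"]
        by (auto simp only: skew_families_def)
      then show ?thesis by simp
    qed
  qed
  have score_act: "score t (act \<pi> \<kappa>) p = score t \<kappa> (\<pi> p)" if "\<pi> permutes {0..<t}" "p < t" for \<pi> \<kappa> p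
  proof -
    have "score t (act \<pi> \<kappa>) p = (\<Sum>q\<in>{..<t} - {p}. skew \<kappa> (\<pi> q) (\<pi> p))"
      unfolding score_def using that by (intro sum.cong) (auto simp: skew_act)
    also have "\<dots> = (\<Sum>q\<in>\<pi> ` ({..<t} - {p}). skew \<kappa> q (\<pi> p))"
      by (subst sum.reindex[OF inj_on_subset[OF permutes_inj[OF that(1)] subset_UNIV]]) simp
    also have "\<pi> ` ({..<t} - {p}) = {..<t} - {\<pi> p}"
      by (simp only: image_set_diff[OF permutes_inj[OF that(1)]] image_insert image_empty
          permutes_image[OF that(1), unfolded atLeast0LessThan])
    finally show ?thesis by (simp add: score_def)
  qed
  have weight_act: "skew_weight t (act \<pi> \<kappa>) = skew_weight t \<kappa>" if "\<pi> permutes {0..<t}" for \<pi> \<kappa>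
  proof -
    have "skew_weight t (act \<pi> \<kappa>)
        = (\<Sum>e\<in>pairs_below t. tri (\<kappa> ((\<lambda>(i, j). (min (\<pi> i) (\<pi> j), max (\<pi> i) (\<pi> j))) e)))"
      unfolding skew_weight_def
      by (intro sum.cong) (auto simp: act_def tri_skew min.commute max.commute)
    also have "\<dots> = skew_weight t \<kappa>"
      unfolding skew_weight_def by (rule sum.reindex_bij_betw[OF bij_betw_sorted_image[OF that]])
    finally show ?thesis .
  qed
  have sign_act: "skew_sign t (act \<pi> \<kappa>) = sign \<pi> * skew_sign t \<kappa>" if "\<pi> permutes {0..<t}" for \<pi> \<kappa>
  proof -
    have "skew_sign t (act \<pi> \<kappa>) = (\<Prod>e\<in>pairs_below t. (case e of (i, j) \<Rightarrow> sgn (int (\<pi> j) - int (\<pi> i)))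
        * psgn (\<kappa> ((\<lambda>(i, j). (min (\<pi> i) (\<pi> j), max (\<pi> i) (\<pi> j))) e)))"
      unfolding skew_sign_def psgn_sum
    proof (intro prod.cong refl)
      fix e assume "e \<in> pairs_below t"
      then obtain i j where e: "e = (i, j)" "i < j" "j < t" by auto
      then have "\<pi> i < \<pi> j \<or> \<pi> j < \<pi> i"
        using permutes_inj[OF that] by (metis inj_eq less_irrefl nat_neq_iff)
      then show "psgn (act \<pi> \<kappa> e) = (case e of (i, j) \<Rightarrow> sgn (int (\<pi> j) - int (\<pi> i)))
        * psgn (\<kappa> ((\<lambda>(i, j). (min (\<pi> i) (\<pi> j), max (\<pi> i) (\<pi> j))) e))"
        using e by (auto simp: act_def skew_def psgn_def)
    qed
    also have "\<dots> = sign \<pi> * (\<Prod>e\<in>pairs_below t.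
        psgn (\<kappa> ((\<lambda>(i, j). (min (\<pi> i) (\<pi> j), max (\<pi> i) (\<pi> j))) e)))"
      by (simp add: prod.distrib sign_eq_prod_sgn[OF that])
    also have "(\<Prod>e\<in>pairs_below t. psgn (\<kappa> ((\<lambda>(i, j). (min (\<pi> i) (\<pi> j), max (\<pi> i) (\<pi> j))) e)))
        = skew_sign t \<kappa>"
      unfolding skew_sign_def psgn_sum by (rule prod.reindex_bij_betw[OF bij_betw_sorted_image[OF that]])
    finally show ?thesis .
  qed
  let ?\<rho> = "Hilbert_Choice.inv \<pi>"
  have \<rho>: "?\<rho> permutes {0..<t}" and inv1: "\<pi> (?\<rho> i) = i" and inv2: "?\<rho> (\<pi> i) = i" for i
    using assms by (auto simp: permutes_inv permutes_inverses)
  show ?thesis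
    unfolding acoef_def sum_distrib_left
  proof (rule sum.reindex_bij_witness[of _ "act \<pi>" "act ?\<rho>"])
    fix \<kappa> assume "\<kappa> \<in> {\<kappa>. \<kappa> \<in> skew_families t \<and> (\<forall>p<t. score t \<kappa> p = m (\<pi> p)) \<and> skew_weight t \<kappa> = n}"
    then have \<kappa>: "\<kappa> \<in> skew_families t" "\<And>p. p < t \<Longrightarrow> score t \<kappa> p = m (\<pi> p)" "skew_weight t \<kappa> = n"
      by auto
    show inv: "act \<pi> (act ?\<rho> \<kappa>) = \<kappa>"
      by (rule act_inv[OF \<rho> assms inv2 \<kappa>(1)])
    have "score t (act ?\<rho> \<kappa>) p = m p" if "p < t" for p
      using that \<kappa>(2)[of "?\<rho> p"] permutes_in_image[OF \<rho>, of p] by (simp add: score_act[OF \<rho>] inv1)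
    then show "act ?\<rho> \<kappa> \<in> {\<kappa>. \<kappa> \<in> skew_families t \<and> (\<forall>p<t. score t \<kappa> p = m p) \<and> skew_weight t \<kappa> = n}"
      using \<kappa> by (simp add: act_fam weight_act[OF \<rho>])
    show "sign \<pi> * skew_sign t (act ?\<rho> \<kappa>) = skew_sign t \<kappa>"
      using sign_act[OF assms, of "act ?\<rho> \<kappa>"] inv by simp
  next
    fix \<kappa> assume "\<kappa> \<in> {\<kappa>. \<kappa> \<in> skew_families t \<and> (\<forall>p<t. score t \<kappa> p = m p) \<and> skew_weight t \<kappa> = n}"
    then have \<kappa>: "\<kappa> \<in> skew_families t" "\<And>p. p < t \<Longrightarrow> score t \<kappa> p = m p" "skew_weight t \<kappa> = n"
      by auto
    show "act ?\<rho> (act \<pi> \<kappa>) = \<kappa>"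
      by (rule act_inv[OF assms \<rho> inv1 \<kappa>(1)])
    show "act \<pi> \<kappa> \<in> {\<kappa>. \<kappa> \<in> skew_families t \<and> (\<forall>p<t. score t \<kappa> p = m (\<pi> p)) \<and> skew_weight t \<kappa> = n}"
      using \<kappa> permutes_in_image[OF assms] by (simp add: act_fam weight_act[OF assms] score_act[OF assms])
  qed
qed

text \<open>Exchanging the entries at \<open>p\<close> and \<open>q\<close> is a transposition, of
  sign \<open>-1\<close>, and also a translation by multiples of \<open>t\<close> whose weight
  change \<open>- 2 t r\<^sup>2 + 2 t r\<^sup>2\<close> is 0; so the coefficient equals its
  negative.\<close>

lemma acoef_congruent:
  assumes "p < t" "q < t" "p \<noteq> q" "int t dvd m p - m q"
  shows "acoef t m n = 0"
proof -
  obtain r where r: "m p - m q = int t * r"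
    using assms(4) by (auto elim: dvdE)
  let ?\<tau> = "Transposition.transpose p q"
  have \<tau>: "?\<tau> permutes {0..<t}"
    using assms by (intro permutes_swap_id) auto
  define \<nu> where "\<nu> x = (if x = p then - r else if x = q then r else 0)" for x
  have split: "(\<Sum>x<t. f x) = f p + f q" if "\<And>x. x \<noteq> p \<Longrightarrow> x \<noteq> q \<Longrightarrow> f x = 0" for f :: "nat \<Rightarrow> int"
  proof -
    have "(\<Sum>x<t. f x) = (\<Sum>x\<in>{p, q}. f x)"
      using assms that by (intro sum.mono_neutral_right) auto
    then show ?thesis using assms by simp
  qed
  have "(\<Sum>x<t. \<nu> x) = 0"
    by (subst split) (use assms in \<open>auto simp: \<nu>_def\<close>)
  moreover have "2 * (n - n) = 2 * (\<Sum>x<t. m x * \<nu> x) + int t * (\<Sum>x<t. (\<nu> x)\<^sup>2)"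
  proof -
    have "(\<Sum>x<t. m x * \<nu> x) = - (m p - m q) * r" "(\<Sum>x<t. (\<nu> x)\<^sup>2) = 2 * r\<^sup>2"
      using assms by (subst split; simp add: \<nu>_def algebra_simps)+
    then show ?thesis by (simp add: r power2_eq_square)
  qed
  ultimately have "acoef t (\<lambda>x. m x + int t * \<nu> x) n = acoef t m n"
    by (rule acoef_translate)
  moreover have "acoef t (\<lambda>x. m x + int t * \<nu> x) n = acoef t (\<lambda>x. m (?\<tau> x)) n"
    using r by (intro acoef_cong) (auto simp: \<nu>_def Transposition.transpose_def)
  moreover have "acoef t (\<lambda>x. m (?\<tau> x)) n = - acoef t m n"
    using assms by (simp add: acoef_permute[OF \<tau>] sign_swap_id)
  ultimately show ?thesis by simp
qed

section \<open>The root lattice of type A and its quadratic form\<close>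

definition charge0 :: "nat \<Rightarrow> (nat \<Rightarrow> int) set" where
  "charge0 t = {\<nu> \<in> {..<t} \<rightarrow>\<^sub>E UNIV. (\<Sum>p<t. \<nu> p) = 0}"

text \<open>On \<open>charge0 t\<close> this is \<open>\<Sum> p * \<nu> p\<close> plus
  \<open>t / 2\<close> times the sum of squares, the size of the core with charges
  \<open>\<nu>\<close>. The form with \<open>triwt\<close> is natural-valued for all
  \<open>\<nu>\<close> and matches the product of \<open>t\<close> theta series with parameters
  \<open>p\<close> and \<open>t - p\<close>.\<close>

definition qform :: "nat \<Rightarrow> (nat \<Rightarrow> int) \<Rightarrow> nat" where
  "qform t \<nu> = (\<Sum>p<t. triwt p (t - p) (\<nu> p))"

lemma graded_subset: "graded J w \<Longrightarrow> I \<subseteq> J \<Longrightarrow> graded I w"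
  unfolding graded_def by (auto intro: finite_subset[of "{i \<in> I. w i \<le> n}" "{i \<in> J. w i \<le> n}" for n])

lemma graded_qform: "graded ({..<t} \<rightarrow>\<^sub>E UNIV) (qform t)"
  unfolding qform_def[abs_def] by (rule gser_prod(1)) (auto intro: graded_triwt)

lemma graded_charge0: "graded (charge0 t) (qform t)"
  by (rule graded_subset[OF graded_qform]) (auto simp: charge0_def)

lemma int_qform: "int (qform t \<nu>) = (\<Sum>p<t. int t * tri (\<nu> p) + int p * \<nu> p)"
proof -
  have "int (triwt p (t - p) j) = int t * tri j + int p * j" if "p < t" for p j
    unfolding int_triwt tri_Suc using that by (simp add: of_nat_diff algebra_simps)
  then show ?thesis
    unfolding qform_def of_nat_sum by (intro sum.cong) auto
qed

lemma two_qform: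
  assumes "\<nu> \<in> charge0 t"
  shows "2 * int (qform t \<nu>) = 2 * (\<Sum>p<t. int p * \<nu> p) + int t * (\<Sum>p<t. (\<nu> p)\<^sup>2)"
proof -
  have "2 * int (qform t \<nu>) = (\<Sum>p<t. 2 * (int p * \<nu> p) + int t * (\<nu> p)\<^sup>2 - int t * \<nu> p)"
    unfolding int_qform sum_distrib_left distrib_left mult.left_commute[of 2 "int t"] two_tri
    by (intro sum.cong) (auto simp: power2_eq_square algebra_simps)
  also have "\<dots> = 2 * (\<Sum>p<t. int p * \<nu> p) + int t * (\<Sum>p<t. (\<nu> p)\<^sup>2) - int t * (\<Sum>p<t. \<nu> p)"
    by (simp only: sum.distrib sum_subtractf sum_distrib_left)
  finally show ?thesis
    using assms by (simp add: charge0_def)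
qed

lemma gser_mult_nth:
  assumes "graded I w"
  shows "fps_nth (A * gser I w u) n = (\<Sum>i | i \<in> I \<and> w i \<le> n. fps_nth A (n - w i) * u i)"
proof -
  let ?B = "{i \<in> I. w i \<le> n}"
  have "fps_nth (A * gser I w u) n = (\<Sum>k\<in>{0..n}. \<Sum>i | i \<in> I \<and> w i = k. fps_nth A (n - k) * u i)"
    unfolding mult.commute[of A] fps_mult_nth gser_def fps_nth_Abs_fps sum_distrib_right
    by (simp only: mult.commute)
  also have "\<dots> = (\<Sum>k\<in>{0..n}. \<Sum>i | i \<in> ?B \<and> w i = k. fps_nth A (n - w i) * u i)"
    by (intro sum.cong) auto
  also have "\<dots> = (\<Sum>i\<in>?B. fps_nth A (n - w i) * u i)"
    using assms by (intro sum.group) (auto simp: graded_def)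
  finally show ?thesis .
qed

lemma card_pairs_below: "int (card (pairs_below t)) = (\<Sum>p<t. int p)"
proof (induction t)
  case (Suc t)
  have "card (pairs_below (Suc t)) = card (pairs_below t) + card ((\<lambda>i. (i, t)) ` {..<t})"
    unfolding pairs_below_Suc by (rule card_Un_disjoint) auto
  also have "card ((\<lambda>i. (i, t)) ` {..<t}) = t"
    by (subst card_image) (auto simp: inj_on_def)
  finally show ?case using Suc by simp
qed simp

lemma monomial_cong: "(\<And>p. p < t \<Longrightarrow> m p = m' p) \<Longrightarrow> monomial t m = monomial t m'"
  unfolding monomial_def by (intro prod.cong) auto

text \<open>The bilateral series
  \<open>\<Sum> (-1)^n x\<^sub>i^n x\<^sub>j^(1-n) T^(n (n-1)/2)\<close>, with variables numbered
  from 0. Being of degree 1, it includes the Vandermonde factor of its pair, its terms at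
  \<open>n = 0\<close> and \<open>n = 1\<close>.\<close>

definition theta_factor :: "nat \<Rightarrow> nat \<Rightarrow> laurent fps" where
  "theta_factor i j = gser UNIV (triwt 0 1) (\<lambda>n. psgn n * (xpow (Suc i) n * xpow (Suc j) (1 - n)))"

lemma prod_theta_factor_gser:
  "(\<Prod>(i, j)\<in>pairs_below t. theta_factor i j)
    = gser (skew_families t) (\<lambda>\<kappa>. nat (skew_weight t \<kappa>)) (\<lambda>\<kappa>. of_int (skew_sign t \<kappa>) * monomial t (score t \<kappa>))"
  "graded (skew_families t) (\<lambda>\<kappa>. nat (skew_weight t \<kappa>))"
proof -
  let ?u = "\<lambda>e n. psgn n * (xpow (Suc (fst e)) n * xpow (Suc (snd e)) (1 - n))"
  have w: "(\<Sum>e\<in>pairs_below t. triwt 0 1 (\<kappa> e)) = nat (skew_weight t \<kappa>)" for \<kappa>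
  proof -
    have "int (\<Sum>e\<in>pairs_below t. triwt 0 1 (\<kappa> e)) = skew_weight t \<kappa>"
      by (simp add: skew_weight_def int_triwt)
    then show ?thesis by linarith
  qed
  have u: "(\<Prod>e\<in>pairs_below t. ?u e (\<kappa> e)) = of_int (skew_sign t \<kappa>) * monomial t (score t \<kappa>)" for \<kappa>
  proof -
    have "(\<Prod>e\<in>pairs_below t. xpow (Suc (fst e)) (\<kappa> e) * xpow (Suc (snd e)) (1 - \<kappa> e))
        = (\<Prod>(i, j)\<in>pairs_below t. xpow (Suc i) (skew \<kappa> j i) * xpow (Suc j) (skew \<kappa> i j))"
      by (intro prod.cong) (auto simp: skew_def)
    also have "\<dots> = (\<Prod>p<t. \<Prod>q\<in>{..<t} - {p}. xpow (Suc p) (skew \<kappa> q p))"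
      by (rule prod_pairs_below_symmetric)
    also have "\<dots> = monomial t (score t \<kappa>)"
      by (simp only: monomial_def score_def xpow_sum)
    finally have *: "(\<Prod>e\<in>pairs_below t. ?u e (\<kappa> e)) = (\<Prod>e\<in>pairs_below t. psgn (\<kappa> e)) * monomial t (score t \<kappa>)"
      by (simp only: prod.distrib)
    show ?thesis
      unfolding * skew_sign_def of_int_psgn unfolding psgn_sum ..
  qed
  have "(\<Prod>(i, j)\<in>pairs_below t. theta_factor i j) = (\<Prod>e\<in>pairs_below t. gser UNIV (triwt 0 1) (?u e))"
    by (intro prod.cong) (auto simp: theta_factor_def)
  also have "\<dots> = gser (skew_families t) (\<lambda>\<kappa>. nat (skew_weight t \<kappa>)) (\<lambda>\<kappa>. of_int (skew_sign t \<kappa>) * monomial t (score t \<kappa>))"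
    using gser_prod(2)[of "pairs_below t" "\<lambda>_. UNIV" "\<lambda>_. triwt 0 1" ?u]
    by (simp only: skew_families_def w u finite_pairs_below graded_triwt zero_less_one add_0)
  finally show "(\<Prod>(i, j)\<in>pairs_below t. theta_factor i j)
    = gser (skew_families t) (\<lambda>\<kappa>. nat (skew_weight t \<kappa>)) (\<lambda>\<kappa>. of_int (skew_sign t \<kappa>) * monomial t (score t \<kappa>))" .
  show "graded (skew_families t) (\<lambda>\<kappa>. nat (skew_weight t \<kappa>))"
    using gser_prod(1)[of "pairs_below t" "\<lambda>_. UNIV" "\<lambda>_. triwt 0 1"]
    by (simp only: skew_families_def w finite_pairs_below graded_triwt zero_less_one add_0)
qed

text \<open>From the base point \<open>m p = p\<close>, translation by \<open>\<nu>\<close> costs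
  exactly \<open>qform t \<nu>\<close> in weight; permuting afterwards costs a sign.\<close>

lemma acoef_lattice_point:
  assumes "\<pi> permutes {0..<t}" "\<nu> \<in> charge0 t"
  shows "acoef t (\<lambda>i. int (\<pi> i) + int t * \<nu> (\<pi> i)) n = sign \<pi> * acoef t int (n - int (qform t \<nu>))"
proof -
  have "acoef t (\<lambda>i. int i + int t * \<nu> i) n = acoef t int (n - int (qform t \<nu>))"
    using assms(2) two_qform[OF assms(2)] by (intro acoef_translate) (auto simp: charge0_def)
  then show ?thesis
    using acoef_permute[OF assms(1), of "\<lambda>i. int i + int t * \<nu> i" n] by simp
qed

text \<open>By \<open>acoef_congruent\<close> the residues of \<open>m\<close> modulo
  \<open>t\<close> are distinct, so they form \<open>\<pi>\<close>, and the quotients form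
  \<open>\<nu>\<close>. Homogeneity fixes the sum of \<open>m\<close> and forces the sum of
  \<open>\<nu>\<close> to be 0.\<close>

lemma lattice_point_exists:
  assumes "0 < t" "acoef t m n \<noteq> 0"
  obtains \<pi> \<nu> where "\<pi> permutes {0..<t}" "\<nu> \<in> charge0 t"
    "\<And>p. p < t \<Longrightarrow> m p = int (\<pi> p) + int t * \<nu> (\<pi> p)" "int (qform t \<nu>) \<le> n"
proof -
  define \<pi> where "\<pi> p = (if p < t then nat (m p mod int t) else p)" for p
  have int_\<pi>: "int (\<pi> p) = m p mod int t" if "p < t" for p
    using that by (simp add: \<pi>_def)
  have "inj_on \<pi> {0..<t}"
  proof (rule inj_onI, rule ccontr)
    fix p q assume pq: "p \<in> {0..<t}" "q \<in> {0..<t}" "\<pi> p = \<pi> q" "p \<noteq> q"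
    then have "m p mod int t = m q mod int t"
      using int_\<pi>[of p] int_\<pi>[of q] by simp
    then have "int t dvd m p - m q"
      by (simp only: mod_eq_dvd_iff)
    with pq have "acoef t m n = 0"
      by (intro acoef_congruent[of p t q]) auto
    with assms(2) show False by simp
  qed
  moreover have "\<pi> ` {0..<t} \<subseteq> {0..<t}"
  proof (rule image_subsetI)
    fix p assume "p \<in> {0..<t}"
    then have "int (\<pi> p) < int t"
      using int_\<pi>[of p] assms(1) by simp
    then show "\<pi> p \<in> {0..<t}" by simp
  qed
  ultimately have bij: "bij_betw \<pi> {0..<t} {0..<t}"
    by (simp add: bij_betw_def endo_inj_surj)
  then have \<pi>: "\<pi> permutes {0..<t}"
    by (rule bij_imp_permutes) (simp add: \<pi>_def)
  define \<nu> where "\<nu> = restrict (\<lambda>q. m (Hilbert_Choice.inv \<pi> q) div int t) {..<t}"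
  have \<nu>_\<pi>: "\<nu> (\<pi> p) = m p div int t" if "p < t" for p
    using that permutes_in_image[OF \<pi>, of p] permutes_inverses(2)[OF \<pi>, of p] by (simp add: \<nu>_def)
  have m: "m p = int (\<pi> p) + int t * \<nu> (\<pi> p)" if "p < t" for p
    using that by (simp add: int_\<pi> \<nu>_\<pi>)
  have "(\<Sum>p<t. m p) = (\<Sum>p<t. int (\<pi> p) + int t * \<nu> (\<pi> p))"
    by (intro sum.cong) (simp_all add: m)
  also have "\<dots> = (\<Sum>p<t. int p + int t * \<nu> p)"
    using sum.reindex_bij_betw[OF bij, of "\<lambda>p. int p + int t * \<nu> p"] by (simp only: atLeast0LessThan)
  also have "\<dots> = int (card (pairs_below t)) + int t * (\<Sum>p<t. \<nu> p)"
    by (simp only: sum.distrib card_pairs_below sum_distrib_left)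
  finally have "int t * (\<Sum>p<t. \<nu> p) = 0"
    using acoef_nonzeroD(1)[OF assms(2)] by simp
  then have \<nu>: "\<nu> \<in> charge0 t"
    using assms(1) by (simp add: charge0_def) (simp add: \<nu>_def)
  have "acoef t m n = sign \<pi> * acoef t int (n - int (qform t \<nu>))"
    unfolding acoef_lattice_point[OF \<pi> \<nu>, symmetric] by (rule acoef_cong) (rule m)
  with assms(2) have "acoef t int (n - int (qform t \<nu>)) \<noteq> 0" by auto
  from acoef_nonzeroD(2)[OF this] have "int (qform t \<nu>) \<le> n" by simp
  with \<pi> \<nu> m show ?thesis by (rule that)
qed

text \<open>Collecting the expansion by exponent vector \<open>m\<close> and writing
  \<open>m\<close> as a lattice point, the sum over \<open>\<pi>\<close> is the Leibniz formula of
  an alternant; the coefficients at the base point split off as a series in \<open>T\<close>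
  alone.\<close>

theorem theta_product:
  assumes "0 < t"
  shows "(\<Prod>(i, j)\<in>pairs_below t. theta_factor i j)
    = Abs_fps (\<lambda>n. of_int (acoef t int (int n)))
      * gser (charge0 t) (qform t) (\<lambda>\<nu>. alt t (\<lambda>j. int j + int t * \<nu> j))"
proof (rule fps_ext)
  fix n
  let ?K = "{\<kappa> \<in> skew_families t. nat (skew_weight t \<kappa>) = n}"
  let ?B = "{\<nu> \<in> charge0 t. qform t \<nu> \<le> n}"
  let ?P = "{\<pi>. \<pi> permutes {0..<t}}"
  let ?c = "\<lambda>m. of_int (acoef t m (int n)) * monomial t m :: laurent"
  define f where "f \<kappa> = restrict (score t \<kappa>) {..<t}" for \<kappa>
  define h where "h = (\<lambda>(\<nu>, \<pi>). restrict (\<lambda>i. int (\<pi> i) + int t * \<nu> (\<pi> i)) {..<t})"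
  have fin: "finite ?K" "finite ?B" "finite ?P"
    using graded_finite_eq[OF prod_theta_factor_gser(2)] graded_charge0[of t]
    by (auto simp: graded_def finite_permutations)
  have weight_nonneg: "0 \<le> skew_weight t \<kappa>" for \<kappa>
    unfolding skew_weight_def by (intro sum_nonneg tri_nonneg)
  have "fps_nth (\<Prod>(i, j)\<in>pairs_below t. theta_factor i j) n
      = (\<Sum>\<kappa>\<in>?K. of_int (skew_sign t \<kappa>) * monomial t (score t \<kappa>))"
    by (simp only: prod_theta_factor_gser(1) gser_def fps_nth_Abs_fps)
  also have "\<dots> = (\<Sum>m\<in>f ` ?K. \<Sum>\<kappa> | \<kappa> \<in> ?K \<and> f \<kappa> = m. of_int (skew_sign t \<kappa>) * monomial t (score t \<kappa>))"
    by (rule sum.image_gen[OF fin(1)])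
  also have "\<dots> = (\<Sum>m\<in>f ` ?K. ?c m)"
  proof (rule sum.cong[OF refl])
    fix m assume "m \<in> f ` ?K"
    then have ext: "m \<in> extensional {..<t}" by (auto simp: f_def)
    have f_eq: "f \<kappa> = m \<longleftrightarrow> (\<forall>p<t. score t \<kappa> p = m p)" for \<kappa>
      using ext by (auto simp: f_def extensional_def fun_eq_iff restrict_def)
    have A: "(\<Sum>\<kappa> | \<kappa> \<in> ?K \<and> f \<kappa> = m. of_int (skew_sign t \<kappa>) * monomial t (score t \<kappa>))
        = (\<Sum>\<kappa> | \<kappa> \<in> ?K \<and> f \<kappa> = m. of_int (skew_sign t \<kappa>)) * monomial t m"
      unfolding sum_distrib_right
      by (intro sum.cong refl arg_cong[of _ _ "(*) _"] monomial_cong) (simp add: f_eq)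
    have "{\<kappa>. \<kappa> \<in> ?K \<and> f \<kappa> = m}
        = {\<kappa>. \<kappa> \<in> skew_families t \<and> (\<forall>p<t. score t \<kappa> p = m p) \<and> skew_weight t \<kappa> = int n}"
      using weight_nonneg by (auto simp: f_eq)
    then have "of_int (acoef t m (int n)) = (\<Sum>\<kappa> | \<kappa> \<in> ?K \<and> f \<kappa> = m. of_int (skew_sign t \<kappa>) :: laurent)"
      by (simp only: acoef_def of_int_sum)
    then show "(\<Sum>\<kappa> | \<kappa> \<in> ?K \<and> f \<kappa> = m. of_int (skew_sign t \<kappa>) * monomial t (score t \<kappa>)) = ?c m"
      by (simp only: A)
  qed
  \<comment> \<open>Neither index set need contain the other; both are compared with their union,
    since coefficients outside either one vanish.\<close>
  also have "\<dots> = (\<Sum>m\<in>f ` ?K \<union> h ` (?B \<times> ?P). ?c m)"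
  proof (rule sum.mono_neutral_left)
    show "\<forall>m\<in>f ` ?K \<union> h ` (?B \<times> ?P) - f ` ?K. ?c m = 0"
    proof
      fix m assume m: "m \<in> f ` ?K \<union> h ` (?B \<times> ?P) - f ` ?K"
      then have ext: "m \<in> extensional {..<t}" by (auto simp: h_def)
      have "acoef t m (int n) = 0"
      proof (rule ccontr)
        assume "acoef t m (int n) \<noteq> 0"
        from acoef_nonzeroD(3)[OF this] obtain \<kappa> where
          \<kappa>: "\<kappa> \<in> skew_families t" "\<And>p. p < t \<Longrightarrow> score t \<kappa> p = m p" "skew_weight t \<kappa> = int n"
          by blast
        have "f \<kappa> = m"
          unfolding f_def by (rule extensionalityI[OF restrict_extensional ext]) (simp add: \<kappa>(2))
        with \<kappa> m show False by auto
      qed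
      then show "?c m = 0" by simp
    qed
  qed (use fin in auto)
  also have "\<dots> = (\<Sum>m\<in>h ` (?B \<times> ?P). ?c m)"
  proof (rule sum.mono_neutral_right)
    show "\<forall>m\<in>f ` ?K \<union> h ` (?B \<times> ?P) - h ` (?B \<times> ?P). ?c m = 0"
    proof
      fix m assume m: "m \<in> f ` ?K \<union> h ` (?B \<times> ?P) - h ` (?B \<times> ?P)"
      then have ext: "m \<in> extensional {..<t}" by (auto simp: f_def)
      have "acoef t m (int n) = 0"
      proof (rule ccontr)
        assume "acoef t m (int n) \<noteq> 0"
        from lattice_point_exists[OF assms this] obtain \<pi> \<nu> where
          *: "\<pi> permutes {0..<t}" "\<nu> \<in> charge0 t"
            "\<And>p. p < t \<Longrightarrow> m p = int (\<pi> p) + int t * \<nu> (\<pi> p)" "int (qform t \<nu>) \<le> int n"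
          by blast
        have "h (\<nu>, \<pi>) = m"
          unfolding h_def split by (rule extensionalityI[OF restrict_extensional ext]) (simp add: *(3))
        moreover have "(\<nu>, \<pi>) \<in> ?B \<times> ?P"
          using * by simp
        ultimately have "m \<in> h ` (?B \<times> ?P)" by blast
        with m show False by simp
      qed
      then show "?c m = 0" by simp
    qed
  qed (use fin in auto)
  also have "\<dots> = (\<Sum>z\<in>?B \<times> ?P. ?c (h z))"
  proof (subst sum.reindex)
    show "inj_on h (?B \<times> ?P)"
    proof (rule inj_onI, clarify)
      fix \<nu> \<pi> \<nu>' \<pi>'
      assume *: "\<nu> \<in> charge0 t" "\<nu>' \<in> charge0 t" "\<pi> permutes {0..<t}" "\<pi>' permutes {0..<t}"
        and "h (\<nu>, \<pi>) = h (\<nu>', \<pi>')"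
      then have eq: "int (\<pi> i) + int t * \<nu> (\<pi> i) = int (\<pi>' i) + int t * \<nu>' (\<pi>' i)" if "i < t" for i
        using that by (auto simp: h_def fun_eq_iff restrict_def dest: spec[of _ i])
      have \<pi>_eq: "\<pi> i = \<pi>' i" for i
      proof (cases "i < t")
        case True
        then have "\<pi> i < t" "\<pi>' i < t"
          using permutes_in_image[OF *(3), of i] permutes_in_image[OF *(4), of i] by auto
        with arg_cong[OF eq[OF True], of "\<lambda>x. x mod int t"] show ?thesis
          by simp
      next
        case False
        then show ?thesis
          using permutes_not_in[OF *(3), of i] permutes_not_in[OF *(4), of i] by simp
      qed
      have "\<nu> q = \<nu>' q" if "q < t" for q
      proof -
        have "q \<in> \<pi> ` {0..<t}"
          using that permutes_image[OF *(3)] by simp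
        then obtain i where "i < t" "q = \<pi> i" by auto
        then show ?thesis
          using eq[of i] \<pi>_eq[of i] assms by simp
      qed
      then have "\<nu> = \<nu>'"
        using * by (intro PiE_ext[of \<nu> "{..<t}" "\<lambda>_. UNIV"]) (auto simp: charge0_def)
      with \<pi>_eq show "\<nu> = \<nu>' \<and> \<pi> = \<pi>'" by auto
    qed
  qed simp
  also have "\<dots> = (\<Sum>\<nu>\<in>?B. \<Sum>\<pi>\<in>?P. ?c (h (\<nu>, \<pi>)))"
    by (subst sum.cartesian_product) simp
  also have "\<dots> = (\<Sum>\<nu>\<in>?B. of_int (acoef t int (int (n - qform t \<nu>))) * alt t (\<lambda>j. int j + int t * \<nu> j))"
  proof (intro sum.cong refl)
    fix \<nu> assume \<nu>: "\<nu> \<in> ?B"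
    have "?c (h (\<nu>, \<pi>)) = of_int (acoef t int (int (n - qform t \<nu>)))
        * (signof \<pi> * monomial t (\<lambda>i. int (\<pi> i) + int t * \<nu> (\<pi> i)))" if "\<pi> \<in> ?P" for \<pi>
    proof -
      have "acoef t (h (\<nu>, \<pi>)) (int n) = acoef t (\<lambda>i. int (\<pi> i) + int t * \<nu> (\<pi> i)) (int n)"
        by (rule acoef_cong) (simp add: h_def)
      also have "\<dots> = sign \<pi> * acoef t int (int (n - qform t \<nu>))"
        using \<nu> that by (simp add: acoef_lattice_point of_nat_diff)
      finally have "of_int (acoef t (h (\<nu>, \<pi>)) (int n))
          = (signof \<pi> * of_int (acoef t int (int (n - qform t \<nu>))) :: laurent)"
        by simp
      moreover have "monomial t (h (\<nu>, \<pi>)) = monomial t (\<lambda>i. int (\<pi> i) + int t * \<nu> (\<pi> i))"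
        by (rule monomial_cong) (simp add: h_def)
      ultimately show ?thesis by (simp only: mult_ac)
    qed
    then show "(\<Sum>\<pi>\<in>?P. ?c (h (\<nu>, \<pi>)))
        = of_int (acoef t int (int (n - qform t \<nu>))) * alt t (\<lambda>j. int j + int t * \<nu> j)"
      unfolding alt_leibniz sum_distrib_left by (intro sum.cong) auto
  qed
  finally show "fps_nth (\<Prod>(i, j)\<in>pairs_below t. theta_factor i j) n
      = fps_nth (Abs_fps (\<lambda>n. of_int (acoef t int (int n)))
        * gser (charge0 t) (qform t) (\<lambda>\<nu>. alt t (\<lambda>j. int j + int t * \<nu> j))) n"
    unfolding gser_mult_nth[OF graded_charge0] fps_nth_Abs_fps .
qed

subsection \<open>The normalizing factor\<close>

text \<open>The product \<open>(T^s; T^s)\<close>. It is polymorphic because the argument moves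
  between integer, complex and Laurent coefficients.\<close>

definition euler :: "nat \<Rightarrow> 'a::comm_ring_1 fps" where
  "euler s = lim (\<lambda>N. \<Prod>k<N. 1 - fps_X ^ (s * Suc k))"

lemma infprod_tendsto_lim:
  fixes F :: "nat \<Rightarrow> 'a::comm_ring_1 fps"
  assumes "\<And>k. fps_cong k (F k) 1"
  shows "(\<lambda>N. \<Prod>k<N. F k) \<longlonglongrightarrow> lim (\<lambda>N. \<Prod>k<N. F k)"
    and "fps_nth (lim (\<lambda>N. \<Prod>k<N. F k)) 0 = 1"
proof -
  obtain L where L: "(\<lambda>N. \<Prod>k<N. F k) \<longlonglongrightarrow> L" "fps_nth L 0 = 1"
    using fps_tendsto_infprod[OF assms] by blast
  then show "(\<lambda>N. \<Prod>k<N. F k) \<longlonglongrightarrow> lim (\<lambda>N. \<Prod>k<N. F k)" "fps_nth (lim (\<lambda>N. \<Prod>k<N. F k)) 0 = 1"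
    by (simp_all add: limI[OF L(1)])
qed

lemma euler_factor_cong: "0 < s \<Longrightarrow> fps_cong k (1 - fps_X ^ (s * Suc k)) (1 :: 'a::comm_ring_1 fps)"
proof -
  assume "0 < s"
  then have "1 * Suc k \<le> s * Suc k"
    by (intro mult_le_mono1) simp
  then have "k < s * Suc k"
    by (rule less_le_trans[rotated]) simp
  then have "fps_cong k (1 - 1 * fps_X ^ (s * Suc k)) (1 :: 'a fps)"
    by (rule fps_cong_one_plus_X_power)
  then show ?thesis by (simp only: mult_1_left)
qed

lemma euler_tendsto: "0 < s \<Longrightarrow> (\<lambda>N. \<Prod>k<N. 1 - fps_X ^ (s * Suc k)) \<longlonglongrightarrow> euler s"
  and euler_nth_0: "0 < s \<Longrightarrow> fps_nth (euler s) 0 = 1"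
  unfolding euler_def by (rule infprod_tendsto_lim; erule euler_factor_cong)+

lemma euler_nonzero: "0 < s \<Longrightarrow> euler s \<noteq> 0"
  using euler_nth_0[of s] by (metis fps_zero_nth zero_neq_one)

text \<open>\<open>has_prod\<close> asks for a nonzero limit unless some factor vanishes. Here every
  factor and the limit have constant term 1, so \<open>prodinf\<close> is the plain limit of partial
  products.\<close>

lemma qpochhammer_tendsto:
  fixes c :: laurent
  shows "(\<lambda>N. \<Prod>k<N. 1 - fps_const c * fps_X ^ Suc k) \<longlonglongrightarrow> qpochhammer (fps_X * fps_const c)"
proof -
  define F where "F k = 1 - fps_const c * fps_X ^ Suc k" for k
  have "fps_cong k (F k) 1" for k
    unfolding F_def by (rule fps_cong_one_plus_X_power) simp
  then obtain L where L: "(\<lambda>N. \<Prod>k<N. F k) \<longlonglongrightarrow> L" "fps_nth L 0 = 1"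
    using fps_tendsto_infprod by blast
  have F_nonzero: "F k \<noteq> 0" for k
  proof -
    have "fps_nth (F k) 0 = 1" by (simp add: F_def)
    then show ?thesis by auto
  qed
  have F_eq: "(\<lambda>j. 1 - fps_X * fps_const c * fps_X ^ j) = F"
    by (simp add: F_def fun_eq_iff mult_ac)
  have "(\<lambda>n. \<Prod>i\<le>n. F i) \<longlonglongrightarrow> L"
    using LIMSEQ_Suc[OF L(1)] by (simp only: lessThan_Suc_atMost)
  moreover have "L \<noteq> 0" using L(2) by auto
  ultimately have "raw_has_prod F 0 p \<longleftrightarrow> p = L" for p
    unfolding raw_has_prod_def by (auto intro: LIMSEQ_unique)
  then have "F has_prod p \<longleftrightarrow> p = L" for p
    using F_nonzero by (simp add: has_prod_def)
  then have "prodinf F = L"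
    by (simp add: prodinf_def)
  then have "qpochhammer (fps_X * fps_const c) = L"
    unfolding qpochhammer_def F_eq .
  with L(1) show ?thesis by (simp add: F_def)
qed

lemma qpochhammer_X: "qpochhammer fps_X = euler 1"
proof -
  have "(\<lambda>N. \<Prod>k<N. 1 - fps_const (1 :: laurent) * fps_X ^ Suc k) \<longlonglongrightarrow> qpochhammer (fps_X * fps_const 1)"
    by (rule qpochhammer_tendsto)
  moreover have "(\<lambda>N. \<Prod>k<N. 1 - fps_const (1 :: laurent) * fps_X ^ Suc k) \<longlonglongrightarrow> euler 1"
    using euler_tendsto[of 1, where 'a = laurent] by simp
  ultimately show ?thesis
    using LIMSEQ_unique by force
qed

section \<open>Coefficientwise homomorphisms and constant terms\<close>

definition fps_map :: "('a \<Rightarrow> 'b) \<Rightarrow> 'a fps \<Rightarrow> 'b fps" where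
  "fps_map f F = Abs_fps (\<lambda>n. f (fps_nth F n))"

lemma fps_map_nth [simp]: "fps_nth (fps_map f F) n = f (fps_nth F n)"
  by (simp add: fps_map_def)

lemma fps_map_tendsto:
  fixes F :: "nat \<Rightarrow> 'a::group_add fps" and f :: "'a \<Rightarrow> 'b::group_add"
  assumes "F \<longlonglongrightarrow> L"
  shows "(\<lambda>N. fps_map f (F N)) \<longlonglongrightarrow> fps_map f L"
  unfolding tendsto_fps_iff
proof
  fix n
  show "\<forall>\<^sub>F N in sequentially. fps_nth (fps_map f (F N)) n = fps_nth (fps_map f L) n"
    using assms[unfolded tendsto_fps_iff, rule_format, of n] by eventually_elim simp
qed

context comm_ring_hom
begin

lemma fps_map_hom: "comm_ring_hom (fps_map hom)"
  by unfold_locales (auto simp: fps_eq_iff hom_distribs fps_mult_nth fps_one_nth)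

lemma fps_map_const [simp]: "fps_map hom (fps_const c) = fps_const (hom c)"
  by (auto simp: fps_eq_iff)

lemma fps_map_X [simp]: "fps_map hom fps_X = fps_X"
  by (auto simp: fps_eq_iff fps_X_def)

lemma fps_map_gser: "fps_map hom (gser I w u) = gser I w (\<lambda>i. hom (u i))"
  by (auto simp: fps_eq_iff gser_def hom_sum)

lemma fps_map_euler:
  assumes "0 < s"
  shows "fps_map hom (euler s) = euler s"
proof -
  interpret F: comm_ring_hom "fps_map hom" by (rule fps_map_hom)
  have "(\<lambda>N. fps_map hom (\<Prod>k<N. 1 - fps_X ^ (s * Suc k))) \<longlonglongrightarrow> fps_map hom (euler s)"
    by (intro fps_map_tendsto euler_tendsto assms)
  then have "(\<lambda>N. \<Prod>k<N. 1 - fps_X ^ (s * Suc k)) \<longlonglongrightarrow> fps_map hom (euler s)"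
    by (simp only: F.hom_prod F.hom_minus F.hom_one F.hom_power fps_map_X)
  then show ?thesis
    using euler_tendsto[OF assms] by (rule LIMSEQ_unique)
qed

end

definition constant_term :: "laurent fps \<Rightarrow> int fps" where
  "constant_term = fps_map (\<lambda>p. Poly_Mapping.lookup p 0)"

lemma constant_term_gser: "constant_term (gser I w u) = gser I w (\<lambda>i. Poly_Mapping.lookup (u i) 0)"
  by (simp add: constant_term_def fps_eq_iff gser_def lookup_sum)

lemma lookup_of_int_mult: "Poly_Mapping.lookup (of_int c * p) m = c * Poly_Mapping.lookup (p :: laurent) m"
proof -
  have "of_int c * p = frag_cmul c p"
    by (induction c rule: int_induct[where k = 0])
      (simp_all add: frag_cmul_distrib distrib_right left_diff_distrib frag_cmul_diff_distrib
        frag_cmul_distrib[of _ "-1", simplified])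
  then show ?thesis by simp
qed

text \<open>The constant term in the variables is not multiplicative, but it is linear over series
  in \<open>T\<close> alone.\<close>

lemma constant_term_mult_of_int:
  "constant_term (F * fps_map of_int G) = constant_term F * G"
  by (simp add: constant_term_def fps_eq_iff fps_mult_nth lookup_sum lookup_of_int_mult
      mult.commute[of _ "of_int _"] mult.commute[of "Poly_Mapping.lookup _ _"])

lemma lookup_xpow_0: "Poly_Mapping.lookup (xpow i n) 0 = (if n = 0 then 1 else 0)"
proof (cases "n = 0")
  case False
  then have "Poly_Mapping.single i n \<noteq> 0"
    by (metis lookup_single_eq lookup_zero)
  with False show ?thesis by (simp add: xpow_def lookup_single when_def)
qed simp

lemma prod_residues:
  fixes f :: "nat \<Rightarrow> 'a::comm_monoid_mult"
  shows "(\<Prod>p<t. \<Prod>k<N. f (p + t * k)) = (\<Prod>m<t * N. f m)"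
proof -
  have "(\<Prod>p<t. \<Prod>k<N. f (p + t * k)) = (\<Prod>k<N. \<Prod>p<t. f (p + t * k))"
    by (rule prod.swap)
  also have "\<dots> = (\<Prod>k<N. prod f {k * t..<k * t + t})"
  proof (rule prod.cong[OF refl])
    fix k
    show "(\<Prod>p<t. f (p + t * k)) = prod f {k * t..<k * t + t}"
      using prod.shift_bounds_nat_ivl[of f 0 "k * t" t]
      by (simp add: atLeast0LessThan add_ac mult.commute)
  qed
  also have "\<dots> = (\<Prod>m<t * N. f m)"
    by (simp add: prod.nat_group mult.commute)
  finally show ?thesis .
qed

text \<open>Through \<open>bij_betw_charges\<close> this is the generating function of
  \<open>t\<close>-cores by size.\<close>

definition core_series :: "nat \<Rightarrow> 'a::comm_ring_1 fps" where
  "core_series t = gser (charge0 t) (qform t) (\<lambda>_. 1)"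

text \<open>
  Grouping the factors of \<open>\<Prod>(1 + x T\<^sup>k) (1 + x\<^sup>-\<^sup>1 T\<^sup>k\<^sup>+\<^sup>1)\<close> by the residue of \<open>k\<close> modulo \<open>t\<close> and
  expanding both sides by the triple product, then comparing coefficients of \<open>x\<^sup>0\<close>.
\<close>

lemma core_series_euler_int:
  assumes "0 < t"
  shows "core_series t * euler 1 = (euler t ^ t :: int fps)"
proof -
  interpret I: comm_ring_hom "fps_map (of_int :: int \<Rightarrow> laurent)"
    by (rule of_int_hom.fps_map_hom)
  \<comment> \<open>One auxiliary variable, whose exponent will record the total charge.\<close>
  let ?U = "xpow 0"
  let ?a = "\<lambda>m. 1 + fps_const (?U 1) * fps_X ^ m" and ?b = "\<lambda>m. 1 + fps_const (?U (- 1)) * fps_X ^ (1 + m)"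
  let ?e = "\<lambda>s N. \<Prod>k<N. 1 - fps_X ^ (s * Suc k) :: laurent fps"
  have jtp: "(\<lambda>N. (\<Prod>k<N. ?a (p + t * k)) * (\<Prod>k<N. 1 + fps_const (?U (- 1)) * fps_X ^ ((t - p) + t * k)) * ?e t N)
      \<longlonglongrightarrow> gser UNIV (triwt p (t - p)) ?U" if "p < t" for p
    using that by (intro jacobi_triple_product) (auto simp: xpow_add)
  have "(\<lambda>N. \<Prod>p<t. (\<Prod>k<N. ?a (p + t * k)) * (\<Prod>k<N. 1 + fps_const (?U (- 1)) * fps_X ^ ((t - p) + t * k)) * ?e t N)
      \<longlonglongrightarrow> (\<Prod>p<t. gser UNIV (triwt p (t - p)) ?U)"
    by (rule fps_tendsto_prod, rule jtp, simp)
  moreover have "(\<Prod>p<t. (\<Prod>k<N. ?a (p + t * k)) * (\<Prod>k<N. 1 + fps_const (?U (- 1)) * fps_X ^ ((t - p) + t * k)) * ?e t N)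
      = (\<Prod>m<t * N. ?a m) * (\<Prod>m<t * N. ?b m) * ?e t N ^ t" for N
  proof -
    \<comment> \<open>Since \<open>t - p = 1 + (t - Suc p)\<close>, reversing the residues brings
      the second product into the shape of the first.\<close>
    have "(\<Prod>p<t. \<Prod>k<N. 1 + fps_const (?U (- 1)) * fps_X ^ ((t - p) + t * k)) = (\<Prod>p<t. \<Prod>k<N. ?b (t - Suc p + t * k))"
      by (intro prod.cong refl) (simp add: Suc_diff_Suc)
    also have "\<dots> = (\<Prod>p<t. \<Prod>k<N. ?b (p + t * k))"
      by (rule prod.nat_diff_reindex)
    finally show ?thesis
      by (simp only: prod.distrib prod_residues[of ?a] prod_residues[of ?b] prod_constant card_lessThan)
  qed
  ultimately have lim1: "(\<lambda>N. (\<Prod>m<t * N. ?a m) * (\<Prod>m<t * N. ?b m) * ?e t N ^ t)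
      \<longlonglongrightarrow> (\<Prod>p<t. gser UNIV (triwt p (t - p)) ?U)"
    by simp
  \<comment> \<open>The undivided product is truncated at multiples of \<open>t\<close>, where all
    residue classes have equally many factors.\<close>
  have sub: "strict_mono (\<lambda>N. t * N)"
    using assms by (auto simp: strict_mono_def)
  have "(\<lambda>N. (\<Prod>m<N. ?a (0 + 1 * m)) * (\<Prod>m<N. 1 + fps_const (?U (- 1)) * fps_X ^ (1 + 1 * m)) * ?e 1 N)
      \<longlonglongrightarrow> gser UNIV (triwt 0 1) ?U"
    by (rule jacobi_triple_product) (auto simp: xpow_add)
  from LIMSEQ_subseq_LIMSEQ[OF this sub]
  have lim2: "(\<lambda>N. (\<Prod>m<t * N. ?a m) * (\<Prod>m<t * N. ?b m) * ?e 1 (t * N)) \<longlonglongrightarrow> gser UNIV (triwt 0 1) ?U"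
    by (simp add: o_def)
  have e1: "(\<lambda>N. ?e 1 (t * N)) \<longlonglongrightarrow> euler 1"
    using LIMSEQ_subseq_LIMSEQ[OF euler_tendsto[of 1] sub] by (simp add: o_def)
  have et: "(\<lambda>N. ?e t N ^ t) \<longlonglongrightarrow> euler t ^ t"
    using fps_tendsto_prod[of "{..<t}" "\<lambda>_. ?e t" "\<lambda>_. euler t"] euler_tendsto[OF assms] by simp
  \<comment> \<open>Each sequence is completed by the Euler factors of the other; they become equal
    and so do their limits.\<close>
  have "(\<lambda>N. ((\<Prod>m<t * N. ?a m) * (\<Prod>m<t * N. ?b m) * ?e t N ^ t) * ?e 1 (t * N))
      \<longlonglongrightarrow> (\<Prod>p<t. gser UNIV (triwt p (t - p)) ?U) * euler 1"
    by (rule fps_tendsto_mult[OF lim1 e1])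
  moreover have "(\<lambda>N. ((\<Prod>m<t * N. ?a m) * (\<Prod>m<t * N. ?b m) * ?e 1 (t * N)) * ?e t N ^ t)
      \<longlonglongrightarrow> gser UNIV (triwt 0 1) ?U * euler t ^ t"
    by (rule fps_tendsto_mult[OF lim2 et])
  ultimately have "(\<Prod>p<t. gser UNIV (triwt p (t - p)) ?U) * euler 1 = gser UNIV (triwt 0 1) ?U * euler t ^ t"
    by (intro LIMSEQ_unique[of "\<lambda>N. ((\<Prod>m<t * N. ?a m) * (\<Prod>m<t * N. ?b m) * ?e t N ^ t) * ?e 1 (t * N)"])
      (simp_all only: mult_ac)
  moreover have "(\<Prod>p<t. gser UNIV (triwt p (t - p)) ?U)
      = gser ({..<t} \<rightarrow>\<^sub>E UNIV) (qform t) (\<lambda>\<nu>. ?U (\<Sum>p<t. \<nu> p))"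
    unfolding qform_def[abs_def] xpow_sum by (rule gser_prod(2)) (auto intro: graded_triwt)
  moreover have "(euler 1 :: laurent fps) = fps_map of_int (euler 1)"
    "(euler t ^ t :: laurent fps) = fps_map of_int (euler t ^ t)"
    using assms by (simp_all add: of_int_hom.fps_map_euler I.hom_power)
  ultimately have "constant_term (gser ({..<t} \<rightarrow>\<^sub>E UNIV) (qform t) (\<lambda>\<nu>. ?U (\<Sum>p<t. \<nu> p)) * fps_map of_int (euler 1))
      = constant_term (gser UNIV (triwt 0 1) ?U * fps_map of_int (euler t ^ t))"
    by simp
  then have "gser ({..<t} \<rightarrow>\<^sub>E UNIV) (qform t) (\<lambda>\<nu>. if (\<Sum>p<t. \<nu> p) = 0 then 1 else 0) * euler 1
      = gser UNIV (triwt 0 1) (\<lambda>n. if n = 0 then 1 else 0) * (euler t ^ t :: int fps)"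
    by (simp only: constant_term_mult_of_int constant_term_gser lookup_xpow_0)
  moreover have "gser ({..<t} \<rightarrow>\<^sub>E UNIV) (qform t) (\<lambda>\<nu>. if (\<Sum>p<t. \<nu> p) = 0 then 1 else 0) = (core_series t :: int fps)"
    unfolding core_series_def gser_def
  proof (intro arg_cong[of _ _ Abs_fps] ext)
    fix n
    have "finite {\<nu> \<in> {..<t} \<rightarrow>\<^sub>E UNIV. qform t \<nu> = n}"
      by (rule graded_finite_eq[OF graded_qform])
    then show "(\<Sum>\<nu>\<in>{\<nu> \<in> {..<t} \<rightarrow>\<^sub>E UNIV. qform t \<nu> = n}. if (\<Sum>p<t. \<nu> p) = 0 then 1 else 0)
        = (\<Sum>\<nu> | \<nu> \<in> charge0 t \<and> qform t \<nu> = n. 1 :: int)"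
      by (intro sum.mono_neutral_cong_right) (auto simp: charge0_def)
  qed
  moreover have "gser UNIV (triwt 0 1) (\<lambda>n. if n = 0 then 1 else 0) = (1 :: int fps)"
  proof (rule fps_ext)
    fix n
    have "finite {j \<in> UNIV. triwt 0 1 j = n}"
      by (intro graded_finite_eq graded_triwt) simp
    then have "(\<Sum>j\<in>{j \<in> UNIV. triwt 0 1 j = n}. if j = 0 then 1 else 0 :: int) = (if triwt 0 1 0 = n then 1 else 0)"
      by (subst sum.delta) auto
    then show "fps_nth (gser UNIV (triwt 0 1) (\<lambda>n. if n = 0 then 1 else 0)) n = fps_nth (1 :: int fps) n"
      by (simp add: gser_def triwt_def)
  qed
  ultimately show ?thesis by simp
qed

lemma gser_const_mult: "gser I w (\<lambda>i. c * u i) = fps_const c * gser I w u"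
  by (simp add: gser_def fps_eq_iff sum_distrib_left)

text \<open>The triple product for \<open>- x\<^sub>i / x\<^sub>j\<close>. Its first product starts
  at exponent 0, and that factor \<open>1 - x\<^sub>i / x\<^sub>j\<close>, times the leading
  \<open>x\<^sub>j\<close>, is the Vandermonde difference.\<close>

lemma theta_factor_eq:
  "theta_factor i j = fps_const (xpow (Suc j) 1 - xpow (Suc i) 1)
    * (qpochhammer (fps_X * fps_const (xpow (Suc i) 1 * xpow (Suc j) (- 1)))
      * qpochhammer (fps_X * fps_const (xpow (Suc i) (- 1) * xpow (Suc j) 1))) * euler 1"
proof -
  define U where "U n = psgn n * (xpow (Suc i) n * xpow (Suc j) (- n))" for n
  define c where "c = xpow (Suc i) 1 * xpow (Suc j) (- 1)"
  define d where "d = xpow (Suc i) (- 1) * xpow (Suc j) 1"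
  have U1: "U 1 = - c" "U (- 1) = - d"
    by (simp_all add: U_def c_def d_def psgn_def)
  have "U 0 = 1" "\<And>a b. U (a + b) = U a * U b"
    by (simp_all add: U_def psgn_add xpow_add mult_ac flip: minus_add_distrib)
      (metis add.commute minus_add_distrib mult.left_commute xpow_add)
  then have "(\<lambda>N. (\<Prod>k<N. 1 + fps_const (U 1) * fps_X ^ (0 + 1 * k))
            * (\<Prod>k<N. 1 + fps_const (U (- 1)) * fps_X ^ (1 + 1 * k))
            * (\<Prod>k<N. 1 - fps_X ^ (1 * Suc k))) \<longlonglongrightarrow> gser UNIV (triwt 0 1) U"
    by (intro jacobi_triple_product) auto
  then have "(\<lambda>N. (\<Prod>k<N. 1 - fps_const c * fps_X ^ k) * (\<Prod>k<N. 1 - fps_const d * fps_X ^ Suc k)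
            * (\<Prod>k<N. 1 - fps_X ^ (1 * Suc k))) \<longlonglongrightarrow> gser UNIV (triwt 0 1) U"
    by (simp add: U1 fps_const_neg[symmetric] del: fps_const_neg)
  \<comment> \<open>With \<open>Suc N\<close> factors the one of exponent 0 can be split
    off.\<close>
  from LIMSEQ_Suc[OF this]
  have lim1: "(\<lambda>N. (\<Prod>k<Suc N. 1 - fps_const c * fps_X ^ k) * (\<Prod>k<Suc N. 1 - fps_const d * fps_X ^ Suc k)
            * (\<Prod>k<Suc N. 1 - fps_X ^ (1 * Suc k))) \<longlonglongrightarrow> gser UNIV (triwt 0 1) U" .
  have "(\<lambda>N. (1 - fps_const c) * (\<Prod>k<N. 1 - fps_const c * fps_X ^ Suc k))
      \<longlonglongrightarrow> (1 - fps_const c) * qpochhammer (fps_X * fps_const c)"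
    by (intro fps_tendsto_mult tendsto_const qpochhammer_tendsto)
  moreover have "(1 - fps_const c) * (\<Prod>k<N. 1 - fps_const c * fps_X ^ Suc k)
      = (\<Prod>k<Suc N. 1 - fps_const c * fps_X ^ k)" for N
    by (simp only: prod.lessThan_Suc_shift power_0 mult_1_right)
  ultimately have limc: "(\<lambda>N. \<Prod>k<Suc N. 1 - fps_const c * fps_X ^ k)
      \<longlonglongrightarrow> (1 - fps_const c) * qpochhammer (fps_X * fps_const c)"
    by simp
  have "(\<lambda>N. (\<Prod>k<Suc N. 1 - fps_const c * fps_X ^ k) * (\<Prod>k<Suc N. 1 - fps_const d * fps_X ^ Suc k)
            * (\<Prod>k<Suc N. 1 - fps_X ^ (1 * Suc k)))
      \<longlonglongrightarrow> (1 - fps_const c) * qpochhammer (fps_X * fps_const c) * qpochhammer (fps_X * fps_const d) * euler 1"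
    by (intro fps_tendsto_mult limc LIMSEQ_Suc[OF qpochhammer_tendsto] LIMSEQ_Suc[OF euler_tendsto]) simp
  with lim1 have U_eq: "gser UNIV (triwt 0 1) U
      = (1 - fps_const c) * qpochhammer (fps_X * fps_const c) * qpochhammer (fps_X * fps_const d) * euler 1"
    by (rule LIMSEQ_unique)
  have "theta_factor i j = gser UNIV (triwt 0 1) (\<lambda>n. xpow (Suc j) 1 * U n)"
    unfolding theta_factor_def
  proof (rule gser_cong)
    fix n
    have "xpow (Suc j) (1 - n) = xpow (Suc j) 1 * xpow (Suc j) (- n)"
      by (simp flip: xpow_add)
    then show "psgn n * (xpow (Suc i) n * xpow (Suc j) (1 - n)) = xpow (Suc j) 1 * U n"
      by (simp add: U_def mult_ac)
  qed simp
  also have "\<dots> = fps_const (xpow (Suc j) 1) * (1 - fps_const c) * (qpochhammer (fps_X * fps_const c)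
      * qpochhammer (fps_X * fps_const d)) * euler 1"
    by (simp only: gser_const_mult U_eq mult.assoc)
  also have "fps_const (xpow (Suc j) 1) * (1 - fps_const c) = fps_const (xpow (Suc j) 1 - xpow (Suc i) 1)"
  proof -
    have "xpow (Suc j) 1 * c = xpow (Suc i) 1 * (xpow (Suc j) (- 1) * xpow (Suc j) 1)"
      by (simp only: c_def mult_ac)
    also have "\<dots> = xpow (Suc i) 1"
      by (simp only: xpow_minus mult_1_right)
    finally show ?thesis
      by (simp add: right_diff_distrib)
  qed
  finally show ?thesis
    by (simp only: c_def d_def)
qed

section \<open>Evaluation at roots of unity\<close>

lemma poly_mapping_eq_sum_single: "p = (\<Sum>k\<in>Poly_Mapping.keys p. Poly_Mapping.single k (Poly_Mapping.lookup p k))"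
proof (rule poly_mapping_eqI)
  fix x
  have "(\<Sum>k\<in>Poly_Mapping.keys p. Poly_Mapping.lookup p k when k = x)
      = (\<Sum>k\<in>Poly_Mapping.keys p. if k = x then Poly_Mapping.lookup p x else 0)"
    by (intro sum.cong) (auto simp: when_def)
  then show "Poly_Mapping.lookup p x = Poly_Mapping.lookup
      (\<Sum>k\<in>Poly_Mapping.keys p. Poly_Mapping.single k (Poly_Mapping.lookup p k)) x"
    by (auto simp: lookup_sum lookup_single in_keys_iff)
qed

text \<open>Cancellation can shrink the support of \<open>p + q\<close>, so all three sums are first
  extended by zeros to the union of the two supports.\<close>

lemma sum_keys_add:
  fixes f :: "'a \<Rightarrow> 'b::comm_monoid_add \<Rightarrow> 'c::comm_monoid_add"
  assumes "\<And>k. f k 0 = 0" "\<And>k a b. f k (a + b) = f k a + f k b"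
  shows "(\<Sum>k\<in>Poly_Mapping.keys (p + q). f k (Poly_Mapping.lookup (p + q) k))
    = (\<Sum>k\<in>Poly_Mapping.keys p. f k (Poly_Mapping.lookup p k))
      + (\<Sum>k\<in>Poly_Mapping.keys q. f k (Poly_Mapping.lookup q k))"
proof -
  let ?U = "Poly_Mapping.keys p \<union> Poly_Mapping.keys q"
  have ext: "(\<Sum>k\<in>Poly_Mapping.keys r. f k (Poly_Mapping.lookup r k)) = (\<Sum>k\<in>?U. f k (Poly_Mapping.lookup r k))"
    if "Poly_Mapping.keys r \<subseteq> ?U" for r
    using that by (intro sum.mono_neutral_left) (auto simp: in_keys_iff assms)
  show ?thesis
    by (subst ext[OF keys_add], subst ext[OF Un_upper1], subst ext[OF Un_upper2])
      (simp only: lookup_add assms(2) sum.distrib)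
qed

text \<open>The exponent of \<open>\<zeta>\<close> after substituting
  \<open>x\<^sub>i = \<zeta>\<^sup>i\<close> in the monomial with exponent vector
  \<open>m\<close>.\<close>

definition exponent_sum :: "(nat \<Rightarrow>\<^sub>0 int) \<Rightarrow> int" where
  "exponent_sum m = (\<Sum>i\<in>Poly_Mapping.keys m. int i * Poly_Mapping.lookup m i)"

text \<open>Evaluation at \<open>x\<^sub>i = \<zeta>\<^sup>i\<close> for the primitive root of unity \<open>\<zeta> = cis (2 \<pi> / t)\<close>.\<close>

definition root_eval :: "nat \<Rightarrow> laurent \<Rightarrow> complex" where
  "root_eval t p = (\<Sum>m\<in>Poly_Mapping.keys p. of_int (Poly_Mapping.lookup p m) * cis (2 * pi * of_int (exponent_sum m) / real t))"

lemma exponent_sum_add: "exponent_sum (m + m') = exponent_sum m + exponent_sum m'"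
  unfolding exponent_sum_def by (rule sum_keys_add[of "\<lambda>i c. int i * c"]) (auto simp: distrib_left)

lemma exponent_sum_single: "exponent_sum (Poly_Mapping.single i n) = int i * n"
  by (simp add: exponent_sum_def)

lemma root_eval_add: "root_eval t (p + q) = root_eval t p + root_eval t q"
  unfolding root_eval_def
  by (rule sum_keys_add[of "\<lambda>m c. of_int c * cis (2 * pi * of_int (exponent_sum m) / real t)"])
    (auto simp: distrib_right)

lemma root_eval_single:
  "root_eval t (Poly_Mapping.single m c) = of_int c * cis (2 * pi * of_int (exponent_sum m) / real t)"
  by (simp add: root_eval_def)

lemma root_eval_0: "root_eval t 0 = 0"
  by (simp add: root_eval_def)

lemma root_eval_sum: "root_eval t (\<Sum>a\<in>A. f a) = (\<Sum>a\<in>A. root_eval t (f a))"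
  by (induction A rule: infinite_finite_induct) (simp_all add: root_eval_0 root_eval_add)

lemma root_eval_mult: "root_eval t (p * q) = root_eval t p * root_eval t q"
proof -
  let ?s = "\<lambda>p k. Poly_Mapping.single k (Poly_Mapping.lookup p k) :: laurent"
  have single: "root_eval t (?s p k * ?s q l) = root_eval t (?s p k) * root_eval t (?s q l)" for k l
  proof -
    have "cis (2 * pi * of_int (exponent_sum (k + l)) / real t)
        = cis (2 * pi * of_int (exponent_sum k) / real t) * cis (2 * pi * of_int (exponent_sum l) / real t)"
      by (simp add: cis_mult exponent_sum_add add_divide_distrib distrib_left)
    then show ?thesis
      by (simp add: mult_single root_eval_single)
  qed
  have "p * q = (\<Sum>k\<in>Poly_Mapping.keys p. ?s p k) * (\<Sum>l\<in>Poly_Mapping.keys q. ?s q l)"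
    by (simp only: poly_mapping_eq_sum_single[symmetric])
  also have "root_eval t \<dots> = (\<Sum>k\<in>Poly_Mapping.keys p. root_eval t (?s p k)) * (\<Sum>l\<in>Poly_Mapping.keys q. root_eval t (?s q l))"
    by (simp only: sum_product root_eval_sum single)
  also have "\<dots> = root_eval t p * root_eval t q"
    by (simp only: root_eval_sum[symmetric] poly_mapping_eq_sum_single[symmetric])
  finally show ?thesis .
qed

lemma root_eval_xpow: "root_eval t (xpow i n) = cis (2 * pi * of_int (int i * n) / real t)"
  by (simp only: xpow_def root_eval_single exponent_sum_single of_int_1 mult_1_left)

lemma root_eval_hom: "comm_ring_hom (root_eval t)"
proof unfold_locales
  show "root_eval t 1 = 1"
    using root_eval_xpow[of t 0 0] by simp
qed (simp_all add: root_eval_0 root_eval_add root_eval_mult)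

text \<open>As polynomials in \<open>y\<close>, both sides with \<open>y\<close> for
  \<open>T^m\<close> differ by a polynomial of degree at most \<open>t\<close> with
  \<open>t + 1\<close> roots, namely 0 and the inverses of the \<open>c q\<close>. Then
  \<open>y = T^m\<close> is substituted.\<close>

lemma prod_roots_of_unity:
  fixes c :: "nat \<Rightarrow> complex"
  assumes "0 < t" "inj_on c {..<t}" "\<And>q. q < t \<Longrightarrow> c q ^ t = 1" "0 < m"
  shows "(\<Prod>q<t. 1 - fps_const (c q) * fps_X ^ m) = 1 - fps_X ^ (t * m)"
proof -
  define P where "P = (\<Prod>q<t. [:1, - c q:]) - (1 - Polynomial.monom 1 t)"
  have "P = 0"
  proof (rule ccontr)
    assume "P \<noteq> 0"
    then have fin: "finite {x. poly P x = 0}" and card: "card {x. poly P x = 0} \<le> Polynomial.degree P"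
      by (auto intro: poly_roots_finite card_poly_roots_bound)
    have "Polynomial.degree (\<Prod>q<t. [:1, - c q:]) \<le> t"
    proof -
      have "Polynomial.degree (\<Prod>q<t. [:1, - c q:]) \<le> (\<Sum>q<t. Polynomial.degree [:1, - c q:])"
        using degree_prod_sum_le[of "{..<t}" "\<lambda>q. [:1, - c q:]"] by (simp only: o_def finite_lessThan)
      also have "\<dots> \<le> (\<Sum>q<t. 1)"
        by (intro sum_mono) simp
      finally show ?thesis by simp
    qed
    moreover have "Polynomial.degree (1 - Polynomial.monom 1 t :: complex poly) \<le> t"
      by (rule degree_diff_le) (auto simp: degree_monom_le)
    ultimately have "Polynomial.degree P \<le> t"
      unfolding P_def by (rule degree_diff_le)
    have c_nz: "c q \<noteq> 0" if "q < t" for q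
      using assms(3)[OF that] assms(1) by (auto simp: power_0_left)
    have "poly P 0 = 0"
      using assms(1) by (simp add: P_def poly_prod poly_monom)
    moreover have "poly P (inverse (c q)) = 0" if "q < t" for q
    proof -
      have "(\<Prod>r<t. poly [:1, - c r:] (inverse (c q))) = 0"
        using that c_nz[OF that] by (intro prod_zero bexI[of _ q]) auto
      then show ?thesis
        using assms(3)[OF that] by (simp add: P_def poly_prod poly_monom power_inverse)
    qed
    ultimately have "insert 0 ((\<lambda>q. inverse (c q)) ` {..<t}) \<subseteq> {x. poly P x = 0}"
      by auto
    then have "card (insert 0 ((\<lambda>q. inverse (c q)) ` {..<t})) \<le> card {x. poly P x = 0}"
      by (intro card_mono fin)
    moreover have "card ((\<lambda>q. inverse (c q)) ` {..<t}) = t"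
      using assms(2) by (subst card_image) (auto simp: inj_on_def)
    then have "card (insert 0 ((\<lambda>q. inverse (c q)) ` {..<t})) = Suc t"
      using c_nz by (subst card_insert_disjoint) auto
    ultimately show False
      using card \<open>Polynomial.degree P \<le> t\<close> by linarith
  qed
  then have "fps_of_poly (\<Prod>q<t. [:1, - c q:]) = fps_of_poly (1 - Polynomial.monom 1 t)"
    by (simp add: P_def)
  then have "(\<Prod>q<t. 1 - fps_const (c q) * fps_X) = 1 - fps_X ^ t"
    by (simp add: fps_of_poly_prod fps_of_poly_diff fps_of_poly_monom' fps_of_poly_linear'
        fps_const_neg[symmetric] del: fps_const_neg)
  then have "(\<Prod>q<t. 1 - fps_const (c q) * fps_X) oo fps_X ^ m = (1 - fps_X ^ t) oo fps_X ^ m"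
    by (rule arg_cong)
  moreover have "fps_X ^ t oo fps_X ^ m = (fps_X ^ (t * m) :: complex fps)"
    using assms(4) fps_compose_power[of "fps_X ^ m :: complex fps" fps_X t]
    by (simp add: power_0_left power_mult[symmetric] mult.commute)
  ultimately show ?thesis
    using assms(4) by (simp add: fps_compose_prod_distrib fps_compose_sub_distrib fps_compose_mult_distrib
        power_0_left)
qed

lemma fps_map_of_int_eq_iff:
  "fps_map of_int A = (fps_map of_int B :: 'a::ring_char_0 fps) \<longleftrightarrow> A = B"
  by (simp add: fps_eq_iff)

lemma fps_const_prod: "fps_const (\<Prod>a\<in>A. f a) = (\<Prod>a\<in>A. fps_const (f a :: 'a::comm_ring_1))"
  by (induction A rule: infinite_finite_induct) (simp_all flip: fps_const_mult)

text \<open>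
  Both sides of the theta product are evaluated at \<open>x\<^sub>i = \<zeta>\<^sup>i\<close>, where all the alternants
  on the right-hand side coincide.
\<close>

lemma acoef_euler:
  assumes t: "0 < t"
  shows "Abs_fps (\<lambda>n. acoef t int (int n)) * euler 1 ^ (t - 1) = euler 1 ^ card (pairs_below t)"
proof -
  interpret E: comm_ring_hom "root_eval t" by (rule root_eval_hom)
  interpret F: comm_ring_hom "fps_map (root_eval t)" by (rule E.fps_map_hom)
  interpret I: comm_ring_hom "fps_map (of_int :: int \<Rightarrow> complex)"
    by (rule of_int_hom.fps_map_hom)
  define C where "C = Abs_fps (\<lambda>n. acoef t int (int n))"
  define r where "r p = root_eval t (xpow (Suc p) 1)" for p
  define Q where "Q p q = fps_map (root_eval t) (qpochhammer (fps_X * fps_const (xpow (Suc p) 1 * xpow (Suc q) (- 1))))" for p q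
  define v where "v = root_eval t (alt t int)"
  let ?eu = "euler 1 :: complex fps"
  have r_cis: "r p = cis (2 * pi * real (Suc p) / real t)" for p
    by (simp add: r_def root_eval_xpow)
  have r_power: "r p ^ t = 1" for p
  proof -
    have "r p ^ t = cis (2 * pi * real (Suc p))"
      using t by (simp add: r_cis Complex.DeMoivre)
    also have "\<dots> = 1"
      by (rule cis_multiple_2pi) (simp add: Ints_of_nat)
    finally show ?thesis .
  qed
  have r_nz: "r p \<noteq> 0" for p
    by (simp add: r_cis)
  have r_inj: "inj_on r {..<t}"
  proof -
    have "r p = cis (2 * pi * real p / real t) * cis (2 * pi / real t)" for p
      by (simp add: r_cis cis_mult add_divide_distrib distrib_left add.commute)
    then have "r p = r q \<longleftrightarrow> cis (2 * pi * real p / real t) = cis (2 * pi * real q / real t)" for p q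
      by simp
    moreover have "inj_on (\<lambda>k. cis (2 * pi * real k / real t)) {..<t}"
      using Complex.bij_betw_roots_unity[OF t] by (rule bij_betw_imp_inj_on)
    ultimately show ?thesis by (simp add: inj_on_def)
  qed
  have r_inverse: "root_eval t (xpow (Suc p) (- 1)) = inverse (r p)" for p
  proof -
    have "root_eval t (xpow (Suc p) (- 1)) * r p = 1"
      unfolding r_def E.hom_mult[symmetric] xpow_minus by (rule E.hom_one)
    then show ?thesis
      using r_nz[of p] by (simp add: field_simps)
  qed
  have v_eq: "v = (\<Prod>(i, j)\<in>pairs_below t. r j - r i)"
    by (simp add: v_def alt_int E.hom_prod E.hom_minus r_def case_prod_unfold)
  have "r j - r i \<noteq> 0" if "i < j" "j < t" for i j
    using inj_onD[OF r_inj, of i j] that by auto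
  then have v_nz: "v \<noteq> 0"
    by (auto simp: v_eq)
  have Q_lim: "(\<lambda>N. \<Prod>k<N. 1 - fps_const (r p * inverse (r q)) * fps_X ^ Suc k) \<longlonglongrightarrow> Q p q" for p q
  proof -
    have "(\<lambda>N. fps_map (root_eval t) (\<Prod>k<N. 1 - fps_const (xpow (Suc p) 1 * xpow (Suc q) (- 1)) * fps_X ^ Suc k)) \<longlonglongrightarrow> Q p q"
      unfolding Q_def by (intro fps_map_tendsto qpochhammer_tendsto)
    then show ?thesis
      by (simp only: F.hom_prod F.hom_minus F.hom_one F.hom_mult F.hom_power E.fps_map_X E.fps_map_const
          E.hom_mult r_inverse r_def[symmetric])
  qed
  \<comment> \<open>For fixed \<open>p\<close> the ratios \<open>r p / r q\<close> run through all
    \<open>t\<close>-th roots of unity. The missing ratio at \<open>q = p\<close> is 1, whose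
    product is the Euler factor.\<close>
  have Q_row: "(\<Prod>q\<in>{..<t} - {p}. Q p q) * ?eu = euler t" if "p < t" for p
  proof -
    have "(\<lambda>N. (\<Prod>q\<in>{..<t} - {p}. \<Prod>k<N. 1 - fps_const (r p * inverse (r q)) * fps_X ^ Suc k)
        * (\<Prod>k<N. 1 - fps_X ^ (1 * Suc k))) \<longlonglongrightarrow> (\<Prod>q\<in>{..<t} - {p}. Q p q) * ?eu"
      by (intro fps_tendsto_mult fps_tendsto_prod Q_lim euler_tendsto) simp
    moreover have "(\<Prod>q\<in>{..<t} - {p}. \<Prod>k<N. 1 - fps_const (r p * inverse (r q)) * fps_X ^ Suc k)
        * (\<Prod>k<N. 1 - fps_X ^ (1 * Suc k)) = (\<Prod>k<N. 1 - fps_X ^ (t * Suc k))" for N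
    proof -
      have "(\<Prod>q\<in>{..<t} - {p}. \<Prod>k<N. 1 - fps_const (r p * inverse (r q)) * fps_X ^ Suc k)
          * (\<Prod>k<N. 1 - fps_X ^ (1 * Suc k))
          = (\<Prod>q<t. \<Prod>k<N. 1 - fps_const (r p * inverse (r q)) * fps_X ^ Suc k)"
        using that by (subst (2) prod.remove[of _ p]) (simp_all add: r_nz mult.commute)
      also have "\<dots> = (\<Prod>k<N. \<Prod>q<t. 1 - fps_const (r p * inverse (r q)) * fps_X ^ Suc k)"
        by (rule prod.swap)
      also have "\<dots> = (\<Prod>k<N. 1 - fps_X ^ (t * Suc k))"
      proof (rule prod.cong[OF refl], rule prod_roots_of_unity[OF t])
        show "inj_on (\<lambda>q. r p * inverse (r q)) {..<t}"
          using r_inj by (auto simp: inj_on_def r_nz)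
        show "(r p * inverse (r q)) ^ t = 1" for q
          by (simp add: power_mult_distrib power_inverse r_power)
      qed simp
      finally show ?thesis .
    qed
    ultimately have "(\<lambda>N. \<Prod>k<N. 1 - fps_X ^ (t * Suc k)) \<longlonglongrightarrow> (\<Prod>q\<in>{..<t} - {p}. Q p q) * ?eu"
      by simp
    then show ?thesis
      using euler_tendsto[OF t] by (rule LIMSEQ_unique)
  qed
  define QQ where "QQ = (\<Prod>p<t. \<Prod>q\<in>{..<t} - {p}. Q p q)"
  have "QQ * ?eu ^ t = (\<Prod>p<t. (\<Prod>q\<in>{..<t} - {p}. Q p q) * ?eu)"
    by (simp add: QQ_def prod.distrib)
  also have "\<dots> = (\<Prod>p<t. euler t)"
    by (rule prod.cong) (simp_all only: Q_row lessThan_iff)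
  also have "\<dots> = euler t ^ t" by simp
  finally have QQ_t: "QQ * ?eu ^ t = euler t ^ t" .
  \<comment> \<open>The same power of \<open>euler t\<close> came out of the constant term, so the
    evaluated product is identified with the lattice point series without expanding either.\<close>
  also have "\<dots> = core_series t * ?eu"
  proof -
    have "fps_map of_int (core_series t * euler 1) = (fps_map of_int (euler t ^ t) :: complex fps)"
      by (simp only: core_series_euler_int[OF t])
    then show ?thesis
      using t by (simp add: I.hom_mult I.hom_power of_int_hom.fps_map_euler core_series_def of_int_hom.fps_map_gser)
  qed
  finally have QQ: "QQ * ?eu ^ t = core_series t * ?eu" .
  have eu_t: "?eu ^ t = ?eu ^ (t - 1) * ?eu"
    using t by (cases t) (simp_all add: mult.commute)
  have core: "QQ * ?eu ^ (t - 1) = core_series t"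
    using QQ euler_nonzero[of 1, where 'a = complex] unfolding eu_t by (simp add: mult.assoc[symmetric])
  have "fps_map (root_eval t) (\<Prod>(i, j)\<in>pairs_below t. theta_factor i j)
      = (\<Prod>(i, j)\<in>pairs_below t. fps_const (r j - r i) * (Q i j * Q j i) * ?eu)"
    by (simp add: theta_factor_eq F.hom_prod F.hom_mult E.hom_minus E.fps_map_euler r_def Q_def
        case_prod_unfold mult.commute[of "xpow _ (- 1)"])
  also have "\<dots> = (\<Prod>(i, j)\<in>pairs_below t. fps_const (r j - r i)) * (\<Prod>(i, j)\<in>pairs_below t. Q i j * Q j i)
      * ?eu ^ card (pairs_below t)"
    by (simp add: prod.distrib case_prod_unfold)
  also have "(\<Prod>(i, j)\<in>pairs_below t. fps_const (r j - r i)) = fps_const v"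
    by (simp add: v_eq case_prod_unfold fps_const_prod)
  also have "(\<Prod>(i, j)\<in>pairs_below t. Q i j * Q j i) = QQ"
    unfolding QQ_def by (rule prod_pairs_below_symmetric)
  finally have lhs: "fps_map (root_eval t) (\<Prod>(i, j)\<in>pairs_below t. theta_factor i j)
      = fps_const v * QQ * ?eu ^ card (pairs_below t)" .
  have ev_alt: "root_eval t (alt t (\<lambda>j. int j + int t * \<nu> j)) = v" for \<nu>
  proof -
    have "root_eval t (xpow (Suc i) (int j + int t * \<nu> j)) = root_eval t (xpow (Suc i) (int j))" for i j
    proof -
      have "2 * pi * of_int (int (Suc i) * (int t * \<nu> j)) / real t = 2 * pi * of_int (int (Suc i) * \<nu> j)"
        using t by (simp add: field_simps)
      then have "root_eval t (xpow (Suc i) (int t * \<nu> j)) = cis (2 * pi * of_int (int (Suc i) * \<nu> j))"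
        by (simp only: root_eval_xpow)
      also have "\<dots> = 1"
        by (rule cis_multiple_2pi) (rule Ints_of_int)
      finally show ?thesis
        by (simp add: xpow_add E.hom_mult)
    qed
    then show ?thesis
      unfolding v_def alt_def E.hom_det[symmetric]
      by (intro arg_cong[of _ _ det] eq_matI) auto
  qed
  have "fps_map (root_eval t) (\<Prod>(i, j)\<in>pairs_below t. theta_factor i j)
      = fps_map (root_eval t) (Abs_fps (\<lambda>n. of_int (acoef t int (int n))))
        * gser (charge0 t) (qform t) (\<lambda>\<nu>. v * 1)"
    unfolding theta_product[OF t] F.hom_mult E.fps_map_gser ev_alt by simp
  also have "fps_map (root_eval t) (Abs_fps (\<lambda>n. of_int (acoef t int (int n)))) = fps_map of_int C"
    by (simp add: fps_eq_iff C_def E.hom_of_int)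
  also have "gser (charge0 t) (qform t) (\<lambda>\<nu>. v * 1) = fps_const v * core_series t"
    unfolding gser_const_mult core_series_def ..
  finally have "fps_const v * QQ * ?eu ^ card (pairs_below t)
      = fps_const v * QQ * (fps_map of_int C * ?eu ^ (t - 1))"
    unfolding lhs core[symmetric] by (simp add: mult_ac)
  moreover have "QQ \<noteq> 0"
    using QQ_t euler_nonzero[OF t, where 'a = complex] by auto
  ultimately have "?eu ^ card (pairs_below t) = fps_map of_int C * ?eu ^ (t - 1)"
    using v_nz by simp
  then have "fps_map of_int (euler 1 ^ card (pairs_below t)) = (fps_map of_int (C * euler 1 ^ (t - 1)) :: complex fps)"
    by (simp add: I.hom_mult I.hom_power of_int_hom.fps_map_euler)
  then show ?thesis
    unfolding fps_map_of_int_eq_iff C_def by simp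
qed

text \<open>Macdonald's identity for affine type A. Both sides of \<open>theta_product\<close> are
  multiplied by \<open>euler 1 ^ (t - 1)\<close>, which by \<open>acoef_euler\<close> turns the
  unknown factor into the Euler power of the theta factors; that power then cancels.\<close>

theorem macdonald_identity:
  assumes t: "0 < t"
  shows "fps_const (alt t int) * (qpochhammer fps_X ^ (t - 1) * (\<Prod>(i, j)\<in>pairs_below t.
      qpochhammer (fps_X * fps_const (xpow (Suc i) 1 * xpow (Suc j) (- 1)))
      * qpochhammer (fps_X * fps_const (xpow (Suc i) (- 1) * xpow (Suc j) 1))))
    = gser (charge0 t) (qform t) (\<lambda>\<nu>. alt t (\<lambda>j. int j + int t * \<nu> j))"
proof -
  interpret I: comm_ring_hom "fps_map (of_int :: int \<Rightarrow> laurent)"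
    by (rule of_int_hom.fps_map_hom)
  let ?eu = "euler 1 :: laurent fps"
  have euler_1: "fps_map of_int (euler 1) = ?eu"
    by (rule of_int_hom.fps_map_euler) simp
  let ?C = "Abs_fps (\<lambda>n. of_int (acoef t int (int n))) :: laurent fps"
  let ?S = "gser (charge0 t) (qform t) (\<lambda>\<nu>. alt t (\<lambda>j. int j + int t * \<nu> j))"
  define P where "P = (\<Prod>(i, j)\<in>pairs_below t.
      qpochhammer (fps_X * fps_const (xpow (Suc i) 1 * xpow (Suc j) (- 1)))
      * qpochhammer (fps_X * fps_const (xpow (Suc i) (- 1) * xpow (Suc j) 1)))"
  have "(\<Prod>(i, j)\<in>pairs_below t. theta_factor i j) = fps_const (alt t int) * P * ?eu ^ card (pairs_below t)"
    unfolding theta_factor_eq alt_int P_def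
    by (simp add: prod.distrib case_prod_unfold fps_const_prod)
  then have "fps_const (alt t int) * P * ?eu ^ card (pairs_below t) = ?C * ?S"
    by (simp only: theta_product[OF t])
  then have "fps_const (alt t int) * P * ?eu ^ card (pairs_below t) * ?eu ^ (t - 1) = ?C * ?eu ^ (t - 1) * ?S"
    by (simp only: mult_ac)
  also have "?C = fps_map of_int (Abs_fps (\<lambda>n. acoef t int (int n)))"
    by (simp add: fps_eq_iff)
  also have "\<dots> * ?eu ^ (t - 1) = ?eu ^ card (pairs_below t)"
    using arg_cong[OF acoef_euler[OF t], of "fps_map of_int :: int fps \<Rightarrow> laurent fps"]
    by (simp only: I.hom_mult I.hom_power euler_1)
  finally have "?eu ^ card (pairs_below t) * (fps_const (alt t int) * (?eu ^ (t - 1) * P)) = ?eu ^ card (pairs_below t) * ?S"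
    by (simp only: mult_ac)
  then show ?thesis
    unfolding P_def qpochhammer_X using euler_nonzero[of 1, where 'a = laurent] by simp
qed

subsection \<open>Words of partitions\<close>

definition zeros :: "nat list \<Rightarrow> int set" where
  "zeros l = {k. word l k = 0}"

definition edge :: "nat list \<Rightarrow> nat \<Rightarrow> int" where
  "edge l i = int (part l i) - int i"

lemma zeros_eq: "zeros l = edge l ` {1..}"
  by (auto simp: zeros_def word_def edge_def split: if_splits)

lemma part_antimono:
  assumes "is_partition l" "1 \<le> i" "i \<le> j"
  shows "part l j \<le> part l i"
proof (cases "i < j \<and> j \<le> length l")
  case True
  then have "l ! (j - 1) \<le> l ! (i - 1)"
    using assms by (intro sorted_wrt_nth_less[of "(\<ge>)" l, simplified]) (auto simp: is_partition_def)
  then show ?thesis using True assms by (simp add: part_def)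
next
  case False
  then show ?thesis using assms by (cases "i = j") (auto simp: part_def)
qed

lemma part_pos: "is_partition l \<Longrightarrow> 1 \<le> i \<Longrightarrow> i \<le> length l \<Longrightarrow> 0 < part l i"
  unfolding is_partition_def part_def
  by (metis One_nat_def Suc_le_eq Suc_pred bot_nat_0.not_eq_extremum less_eq_Suc_le nth_mem)

lemma part_eq_0: "length l < i \<Longrightarrow> part l i = 0"
  by (simp add: part_def)

lemma edge_strict_antimono:
  assumes "is_partition l" "1 \<le> i" "i < j"
  shows "edge l j < edge l i"
  using part_antimono[OF assms(1,2), of j] assms(3) by (simp add: edge_def)

lemma edge_less_iff:
  assumes "is_partition l" "1 \<le> i" "1 \<le> j"
  shows "edge l j < edge l i \<longleftrightarrow> i < j"
  using edge_strict_antimono[OF assms(1,2), of j] edge_strict_antimono[OF assms(1,3), of i]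
  by (cases i j rule: linorder_cases) auto

lemma inj_on_edge: "is_partition l \<Longrightarrow> inj_on (edge l) {1..}"
  by (intro inj_onI) (metis atLeast_iff edge_less_iff less_irrefl linorder_neqE_nat)

lemma zeros_below: "k < - int (length l) \<Longrightarrow> k \<in> zeros l"
  unfolding zeros_eq by (rule image_eqI[of _ _ "nat (- k)"]) (auto simp: edge_def part_eq_0)

text \<open>Together with \<open>zeros_below\<close>, this makes minus the number of parts the first
  horizontal step of the border.\<close>

lemma minus_length_notin_zeros:
  assumes "is_partition l"
  shows "- int (length l) \<notin> zeros l"
proof
  assume "- int (length l) \<in> zeros l"
  then obtain i where i: "1 \<le> i" "- int (length l) = edge l i"
    by (auto simp: zeros_eq)
  show False
  proof (cases "i \<le> length l")
    case True
    then show False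
      using part_pos[OF assms i(1)] i(2) by (simp add: edge_def)
  next
    case False
    then show False using i(2) by (simp add: edge_def part_eq_0)
  qed
qed

section \<open>Boxes and hooks as inversions of the word\<close>

definition conj_part :: "nat list \<Rightarrow> nat \<Rightarrow> nat" where
  "conj_part l j = card {a. 1 \<le> a \<and> j \<le> part l a}"

text \<open>The rows meeting column \<open>j\<close> form an initial segment, so their number
  decides membership.\<close>

lemma le_part_iff:
  assumes l: "is_partition l" and j: "1 \<le> j" and a: "1 \<le> a"
  shows "j \<le> part l a \<longleftrightarrow> a \<le> conj_part l j"
proof -
  let ?S = "{a. 1 \<le> a \<and> j \<le> part l a}"
  have sub: "?S \<subseteq> {1..length l}"
    using j by (auto simp: part_def split: if_splits)
  then have fin: "finite ?S" by (rule finite_subset) simp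
  show ?thesis
  proof
    assume "j \<le> part l a"
    then have "{1..a} \<subseteq> ?S"
      using part_antimono[OF l, of _ a] by (auto intro: order.trans)
    then have "card {1..a} \<le> card ?S"
      by (rule card_mono[OF fin])
    then show "a \<le> conj_part l j" by (simp add: conj_part_def)
  next
    assume le: "a \<le> conj_part l j"
    show "j \<le> part l a"
    proof (rule ccontr)
      assume not: "\<not> j \<le> part l a"
      have "?S \<subseteq> {1..<a}"
      proof
        fix b assume b: "b \<in> ?S"
        then have "\<not> a \<le> b"
          using part_antimono[OF l a, of b] not by auto
        with b show "b \<in> {1..<a}" by simp
      qed
      then have "card ?S \<le> card {1..<a}"
        by (intro card_mono) auto
      with le a show False by (simp add: conj_part_def)
    qed
  qed
qed

lemma mem_diagram_iff: "(i, j) \<in> diagram l \<longleftrightarrow> 1 \<le> i \<and> 1 \<le> j \<and> j \<le> part l i"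
  by (auto simp: diagram_def part_def split: if_splits)

text \<open>The index of the horizontal step at the foot of column \<open>j\<close>, as
  \<open>edge\<close> is that of the vertical step at the end of a row.\<close>

definition hole :: "nat list \<Rightarrow> nat \<Rightarrow> int" where
  "hole l j = int j - 1 - int (conj_part l j)"

lemma hole_less_edge_iff:
  assumes "is_partition l" "1 \<le> j" "1 \<le> a"
  shows "hole l j < edge l a \<longleftrightarrow> j \<le> part l a" "hole l j \<noteq> edge l a"
  using le_part_iff[OF assms] by (auto simp: hole_def edge_def)

text \<open>The hook is a row segment of \<open>part l i - j + 1\<close> boxes and a column segment
  of \<open>conj_part l j - i\<close> boxes; the sum is the distance between the border steps at its
  two ends.\<close>

lemma hook_length_eq:
  assumes l: "is_partition l" and ij: "(i, j) \<in> diagram l"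
  shows "int (hook_length l (i, j)) = edge l i - hole l j"
proof -
  have i: "1 \<le> i" and j: "1 \<le> j" "j \<le> part l i"
    using ij by (auto simp: mem_diagram_iff)
  have ic: "i \<le> conj_part l j"
    using le_part_iff[OF l j(1) i] j(2) by simp
  have "hook l (i, j) = {i} \<times> {j..part l i} \<union> {i<..conj_part l j} \<times> {j}"
    using i j le_part_iff[OF l j(1)] by (auto simp: mem_diagram_iff)
  then have "hook_length l (i, j) = card ({i} \<times> {j..part l i}) + card ({i<..conj_part l j} \<times> {j})"
    unfolding hook_length_def by (simp only:) (rule card_Un_disjoint; auto)
  also have "\<dots> = (Suc (part l i) - j) + (conj_part l j - i)"
    by (simp add: card_cartesian_product)
  finally show ?thesis
    using j(2) ic by (simp add: edge_def hole_def of_nat_diff)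
qed

definition inversions :: "int set \<Rightarrow> (int \<times> int) set" where
  "inversions Z = {(k, m). k < m \<and> k \<notin> Z \<and> m \<in> Z}"

text \<open>A box lies in the diagram exactly if the step below its column precedes the step ending
  its row. Surjectivity also requires every position outside \<open>zeros\<close> to be the foot of
  a column.\<close>

lemma bij_betw_diagram_inversions:
  assumes l: "is_partition l"
  shows "bij_betw (\<lambda>(i, j). (hole l j, edge l i)) (diagram l) (inversions (zeros l))"
proof -
  have hole_less: "hole l j < hole l j'" if "1 \<le> j" "j < j'" for j j'
  proof -
    have "conj_part l j' \<le> conj_part l j"
    proof (cases "conj_part l j' = 0")
      case False
      then have "j' \<le> part l (conj_part l j')"
        using that by (subst le_part_iff[OF l]) auto
      then have "j \<le> part l (conj_part l j')"
        using that by simp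
      then show ?thesis
        using that False by (subst (asm) le_part_iff[OF l]) auto
    qed simp
    with that show ?thesis by (simp add: hole_def)
  qed
  show ?thesis
  proof (rule bij_betwI')
    fix x y assume "x \<in> diagram l" "y \<in> diagram l"
    then obtain i j i' j' where x: "x = (i, j)" "1 \<le> i" "1 \<le> j" and y: "y = (i', j')" "1 \<le> i'" "1 \<le> j'"
      by (cases x; cases y) (auto simp: mem_diagram_iff)
    have "edge l i = edge l i' \<longleftrightarrow> i = i'"
      using inj_onD[OF inj_on_edge[OF l], of i i'] x y by auto
    moreover have "hole l j = hole l j' \<longleftrightarrow> j = j'"
      using hole_less[of j j'] hole_less[of j' j] x y by (cases j j' rule: linorder_cases) auto
    ultimately show "((case x of (i, j) \<Rightarrow> (hole l j, edge l i)) = (case y of (i, j) \<Rightarrow> (hole l j, edge l i)))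
        \<longleftrightarrow> x = y"
      by (auto simp: x y)
  next
    fix x assume "x \<in> diagram l"
    then obtain i j where x: "x = (i, j)" "1 \<le> i" "1 \<le> j" "j \<le> part l i"
      by (cases x) (auto simp: mem_diagram_iff)
    have "hole l j \<notin> zeros l"
      using hole_less_edge_iff(2)[OF l x(3)] by (auto simp: zeros_eq)
    moreover have "edge l i \<in> zeros l"
      using x by (auto simp: zeros_eq)
    ultimately show "(case x of (i, j) \<Rightarrow> (hole l j, edge l i)) \<in> inversions (zeros l)"
      using hole_less_edge_iff(1)[OF l x(3,2)] x by (simp add: inversions_def)
  next
    fix y assume "y \<in> inversions (zeros l)"
    then obtain k i where y: "y = (k, edge l i)" "k < edge l i" "k \<notin> zeros l" "1 \<le> i"
      by (auto simp: inversions_def zeros_eq)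
    let ?R = "{a. 1 \<le> a \<and> k < edge l a}"
    have "?R \<subseteq> {..length l + nat (- k)}"
    proof
      fix a assume "a \<in> ?R"
      then show "a \<in> {..length l + nat (- k)}"
        by (cases "a \<le> length l") (auto simp: edge_def part_eq_0)
    qed
    then have fin: "finite ?R" by (rule finite_subset) simp
    \<comment> \<open>The rows ending after position \<open>k\<close> are \<open>1, ..., r\<close>,
      so a column with foot at \<open>k\<close> must have length \<open>r\<close>.\<close>
    define r where "r = Max ?R"
    have "i \<in> ?R" using y by simp
    then have r: "1 \<le> r" "k < edge l r" "i \<le> r"
      using Max_in[OF fin] Max_ge[OF fin, of i] by (auto simp: r_def)
    have "\<not> k < edge l (Suc r)"
      using Max_ge[OF fin, of "Suc r"] by (auto simp: r_def)
    moreover have "k \<noteq> edge l (Suc r)"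
      using y(3) by (auto simp: zeros_eq)
    ultimately have r': "edge l (Suc r) < k" by simp
    \<comment> \<open>The solution of \<open>hole l j = k\<close> when the column has length
      \<open>r\<close>.\<close>
    define j where "j = nat (k + 1 + int r)"
    have j: "int j = k + 1 + int r" "1 \<le> j"
      using r' by (auto simp: j_def edge_def)
    have "j \<le> part l r" "\<not> j \<le> part l (Suc r)"
      using r(2) r' j(1) by (auto simp: edge_def)
    then have "r \<le> conj_part l j" "\<not> Suc r \<le> conj_part l j"
      using le_part_iff[OF l j(2)] r(1) by auto
    then have "hole l j = k"
      using j(1) by (simp add: hole_def)
    moreover have "j \<le> part l i"
      using hole_less_edge_iff(1)[OF l j(2) y(4)] y(2) \<open>hole l j = k\<close> by simp
    ultimately show "\<exists>x\<in>diagram l. y = (case x of (i, j) \<Rightarrow> (hole l j, edge l i))"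
      using y j(2) by (intro bexI[of _ "(i, j)"]) (auto simp: mem_diagram_iff)
  qed
qed

text \<open>A hook length divisible by \<open>t\<close> is an inversion whose distance is a multiple
  of \<open>t\<close>. If no zero has a hole \<open>t\<close> steps before it, iterating excludes
  all multiples.\<close>

lemma cores_iff:
  assumes t: "0 < t"
  shows "l \<in> cores t \<longleftrightarrow> is_partition l \<and> (\<forall>m\<in>zeros l. m - int t \<in> zeros l)"
proof (cases "is_partition l")
  case l: True
  let ?f = "\<lambda>(i, j). (hole l j, edge l i)"
  have "t dvd hook_length l s \<longleftrightarrow> (case ?f s of (k, m) \<Rightarrow> int t dvd m - k)" if "s \<in> diagram l" for s
  proof -
    obtain i j where s: "s = (i, j)" by (cases s)
    have "t dvd hook_length l s \<longleftrightarrow> int t dvd int (hook_length l s)"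
      by simp
    then show ?thesis
      using that unfolding s by (simp only: hook_length_eq[OF l] split)
  qed
  then have "l \<in> cores t \<longleftrightarrow> (\<forall>s\<in>diagram l. \<not> (case ?f s of (k, m) \<Rightarrow> int t dvd m - k))"
    using l by (simp add: cores_def)
  also have "\<dots> \<longleftrightarrow> (\<forall>y\<in>?f ` diagram l. \<not> (case y of (k, m) \<Rightarrow> int t dvd m - k))"
    by simp
  also have "?f ` diagram l = inversions (zeros l)"
    using bij_betw_diagram_inversions[OF l] by (rule bij_betw_imp_surj_on)
  also have "(\<forall>y\<in>inversions (zeros l). \<not> (case y of (k, m) \<Rightarrow> int t dvd m - k))
      \<longleftrightarrow> (\<forall>m\<in>zeros l. m - int t \<in> zeros l)"
  proof
    assume *: "\<forall>y\<in>inversions (zeros l). \<not> (case y of (k, m) \<Rightarrow> int t dvd m - k)"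
    show "\<forall>m\<in>zeros l. m - int t \<in> zeros l"
    proof (rule ballI, rule ccontr)
      fix m assume "m \<in> zeros l" "m - int t \<notin> zeros l"
      then have "(m - int t, m) \<in> inversions (zeros l)"
        using t by (simp add: inversions_def)
      with * show False by force
    qed
  next
    assume closed: "\<forall>m\<in>zeros l. m - int t \<in> zeros l"
    have *: "m - int t * int c \<in> zeros l" if "m \<in> zeros l" for m c
      using that
    proof (induction c)
      case (Suc c)
      then have "m - int t * int c - int t \<in> zeros l"
        using closed by simp
      then show ?case by (simp add: algebra_simps)
    qed simp
    show "\<forall>y\<in>inversions (zeros l). \<not> (case y of (k, m) \<Rightarrow> int t dvd m - k)"
    proof (clarsimp simp: inversions_def)
      fix k m assume km: "k < m" "k \<notin> zeros l" "m \<in> zeros l" "int t dvd m - k"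
      then obtain c where c: "m - k = int t * c" by (auto elim: dvdE)
      then have "0 < int t * c" using km by simp
      then have "0 \<le> c" using t by (simp add: zero_less_mult_iff)
      then have "m - int t * int (nat c) = k" using c by simp
      with *[OF km(3), of "nat c"] km(2) show False by simp
    qed
  qed
  finally show ?thesis using l by simp
qed (simp add: cores_def)

lemma bij_betw_Collect_image:
  "bij_betw f A B \<Longrightarrow> bij_betw f {x \<in> A. P (f x)} {y \<in> B. P y}"
  by (auto simp: bij_betw_def inj_on_def)

lemma card_short_hooks:
  assumes l: "is_partition l"
  shows "card (short_hooks t l) = card {(k, m) \<in> inversions (zeros l). m - k < int t}"
proof -
  let ?f = "\<lambda>(i, j). (hole l j, edge l i)"
  have bij: "bij_betw ?f (diagram l) (inversions (zeros l))"
    by (rule bij_betw_diagram_inversions[OF l])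
  have "hook_length l s < t \<longleftrightarrow> (case ?f s of (k, m) \<Rightarrow> m - k < int t)" if "s \<in> diagram l" for s
  proof -
    obtain i j where s: "s = (i, j)" by (cases s)
    have "hook_length l s < t \<longleftrightarrow> int (hook_length l s) < int t"
      by simp
    then show ?thesis
      using that unfolding s by (simp only: hook_length_eq[OF l] split)
  qed
  then have "short_hooks t l = {s \<in> diagram l. case ?f s of (k, m) \<Rightarrow> m - k < int t}"
    unfolding short_hooks_def by (intro Collect_cong conj_cong refl)
  moreover have "bij_betw ?f {s \<in> diagram l. case ?f s of (k, m) \<Rightarrow> m - k < int t}
      {y \<in> inversions (zeros l). case y of (k, m) \<Rightarrow> m - k < int t}"
    by (rule bij_betw_Collect_image[OF bij])
  moreover have "{(k, m) \<in> inversions (zeros l). m - k < int t}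
      = {y \<in> inversions (zeros l). case y of (k, m) \<Rightarrow> m - k < int t}"
    by auto
  ultimately show ?thesis
    by (simp only: bij_betw_same_card)
qed

section \<open>Finite windows and reconstruction of partitions\<close>

lemma zeros_window:
  assumes l: "is_partition l" and N: "length l \<le> N"
  shows "{k \<in> zeros l. - int N \<le> k} = edge l ` {1..N}"
proof -
  have "- int N \<le> edge l i \<longleftrightarrow> i \<le> N" if "1 \<le> i" for i
  proof (cases "i \<le> length l")
    case True
    then show ?thesis using N by (simp add: edge_def)
  next
    case False
    then show ?thesis by (simp add: edge_def part_eq_0)
  qed
  then show ?thesis
    unfolding zeros_eq by (auto simp: image_iff)
qed

lemma sum_part:
  assumes "length l \<le> N"
  shows "(\<Sum>i=1..N. part l i) = sum_list l"
proof -
  have "(\<Sum>i=1..N. part l i) = (\<Sum>i=1..length l. part l i)"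
    using assms by (intro sum.mono_neutral_right) (auto simp: part_def)
  also have "\<dots> = (\<Sum>i<length l. part l (Suc i))"
    by (simp add: sum.atLeast1_atMost_eq)
  also have "\<dots> = sum_list l"
    by (simp add: part_def sum_list_sum_nth atLeast0LessThan)
  finally show ?thesis .
qed

text \<open>A window from \<open>- N\<close> on holds the ends of the first \<open>N\<close> rows.
  Its cardinality detects the charge and its sum the size, and both can also be computed on the
  abacus.\<close>

lemma zeros_window_card_sum:
  assumes l: "is_partition l" and N: "length l \<le> N"
  shows "card {k \<in> zeros l. - int N \<le> k} = N"
    and "(\<Sum>k | k \<in> zeros l \<and> - int N \<le> k. k) = int (sum_list l) - (\<Sum>i=1..N. int i)"
proof -
  have inj: "inj_on (edge l) {1..N}"
    by (rule inj_on_subset[OF inj_on_edge[OF l]]) auto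
  show "card {k \<in> zeros l. - int N \<le> k} = N"
    unfolding zeros_window[OF assms] using card_image[OF inj] by simp
  have "(\<Sum>k | k \<in> zeros l \<and> - int N \<le> k. k) = (\<Sum>i=1..N. int (part l i) - int i)"
    unfolding zeros_window[OF assms] by (subst sum.reindex[OF inj]) (simp add: edge_def)
  also have "\<dots> = int (\<Sum>i=1..N. part l i) - (\<Sum>i=1..N. int i)"
    by (simp add: sum_subtractf)
  finally show "(\<Sum>k | k \<in> zeros l \<and> - int N \<le> k. k) = int (sum_list l) - (\<Sum>i=1..N. int i)"
    by (simp only: sum_part[OF N])
qed

lemma sorted_list_eq_edges:
  assumes l: "is_partition l"
  shows "sorted_list_of_set (edge l ` {1..N}) = rev (map (edge l) [1..<Suc N])"
proof -
  have "sorted (rev (map (edge l) [1..<Suc N]))"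
    using edge_strict_antimono[OF l]
    by (auto simp: sorted_wrt_rev sorted_wrt_map intro!: sorted_wrt_mono_rel[OF _ sorted_wrt_upt] less_imp_le simp del: upt_Suc)
  moreover have "distinct (rev (map (edge l) [1..<Suc N]))"
    using inj_on_subset[OF inj_on_edge[OF l], of "{1..N}"] by (auto simp: distinct_map atLeastLessThanSuc_atLeastAtMost simp del: upt_Suc)
  moreover have "set (rev (map (edge l) [1..<Suc N])) = edge l ` {1..N}"
    by (simp only: set_rev set_map set_upt atLeastLessThanSuc_atLeastAtMost)
  ultimately show ?thesis
    by (intro sorted_distinct_set_unique) auto
qed

text \<open>Row ends decrease strictly, so their set determines them in order; the number of
  positive parts then gives the length.\<close>

lemma partition_eqI:
  assumes "is_partition l" "is_partition l'" "zeros l = zeros l'"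
  shows "l = l'"
proof -
  define N where "N = max (length l) (length l')"
  have "edge l ` {1..N} = edge l' ` {1..N}"
    using zeros_window[OF assms(1), of N] zeros_window[OF assms(2), of N] assms(3) by (simp add: N_def)
  then have "rev (map (edge l) [1..<Suc N]) = rev (map (edge l') [1..<Suc N])"
    unfolding sorted_list_eq_edges[OF assms(1), symmetric] sorted_list_eq_edges[OF assms(2), symmetric]
    by (rule arg_cong)
  then have edges: "edge l i = edge l' i" if "1 \<le> i" "i \<le> N" for i
    using that by (auto simp del: upt_Suc)
  have parts: "part l i = part l' i" if "1 \<le> i" for i
  proof (cases "i \<le> N")
    case True
    then show ?thesis using edges[OF that] by (simp add: edge_def)
  next
    case False
    then show ?thesis by (simp add: N_def part_eq_0)
  qed
  have "length l = length l'"
  proof (rule ccontr)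
    assume "length l \<noteq> length l'"
    then consider "length l < length l'" | "length l' < length l" by linarith
    then show False
    proof cases
      case 1
      then show ?thesis
        using part_pos[OF assms(2), of "length l'"] parts[of "length l'"] by (simp add: part_eq_0)
    next
      case 2
      then show ?thesis
        using part_pos[OF assms(1), of "length l"] parts[of "length l"] by (simp add: part_eq_0)
    qed
  qed
  then show ?thesis
  proof (rule nth_equalityI)
    fix i assume "i < length l"
    then show "l ! i = l' ! i"
      using parts[of "Suc i"] \<open>length l = length l'\<close> by (simp add: part_def)
  qed
qed

text \<open>The cardinality condition says that \<open>Z\<close> has charge 0. The window listed
  decreasingly gives the row ends, and solving \<open>edge\<close> for the parts gives a decreasing
  list.\<close>

lemma partition_exists:
  assumes below: "\<And>k. k < - int N \<Longrightarrow> k \<in> Z" and fin: "finite {k \<in> Z. - int N \<le> k}"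
    and card: "card {k \<in> Z. - int N \<le> k} = N"
  shows "\<exists>l. is_partition l \<and> zeros l = Z"
proof -
  let ?W = "{k \<in> Z. - int N \<le> k}"
  define xs where "xs = rev (sorted_list_of_set ?W)"
  have len: "length xs = N"
    using card by (simp add: xs_def)
  have set: "set xs = ?W"
    using fin by (simp add: xs_def)
  have "sorted_wrt (<) (sorted_list_of_set ?W)"
    by (rule strict_sorted_list_of_set)
  then have dec: "xs ! j < xs ! i" if "i < j" "j < N" for i j
    using that len sorted_wrt_nth_less[of "(>)" xs i j] by (simp add: xs_def sorted_wrt_rev)
  have gap: "xs ! j + int (j - i) \<le> xs ! i" if "i \<le> j" "j < N" for i j
    using that
  proof (induction rule: dec_induct)
    case (step n)
    then show ?case using dec[of n "Suc n"] by (simp add: Suc_diff_le)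
  qed simp
  \<comment> \<open>Inverse to \<open>edge\<close>: the part with number \<open>i + 1\<close>, as
    lists count from 0.\<close>
  define y where "y i = xs ! i + int (Suc i)" for i
  have y_nonneg: "0 \<le> y i" if "i < N" for i
  proof -
    have "xs ! (N - 1) \<in> ?W"
      unfolding set[symmetric] using that len by (intro nth_mem) simp
    then have "- int N \<le> xs ! (N - 1)" by simp
    moreover have "i \<le> N - 1" "N - 1 < N" "int (N - 1 - i) = int N - 1 - int i"
      using that by auto
    ultimately show ?thesis
      using gap[of i "N - 1"] by (simp add: y_def)
  qed
  have y_antimono: "y j \<le> y i" if "i \<le> j" "j < N" for i j
    using gap[OF that] that by (simp add: y_def)
  define ys where "ys = map (\<lambda>i. nat (y i)) [0..<N]"
  define l where "l = filter (\<lambda>x. 0 < x) ys"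
  have sorted: "sorted_wrt (\<ge>) ys"
    by (auto simp: ys_def sorted_wrt_iff_nth_less intro!: nat_mono y_antimono)
  then have l: "is_partition l"
    by (auto simp: is_partition_def l_def intro: sorted_wrt_filter)
  \<comment> \<open>In a decreasing list the zeros form a tail, so removing them keeps the positions
    of the other parts.\<close>
  have ys_eq: "ys = l @ replicate (length ys - length l) 0"
    using sorted unfolding l_def
  proof (induction ys)
    case (Cons a ys)
    show ?case
    proof (cases "0 < a")
      case True
      then show ?thesis using Cons by simp
    next
      case False
      then have "\<forall>b\<in>set (a # ys). b = 0" using Cons.prems by auto
      then have "filter (\<lambda>x. 0 < x) (a # ys) = []" "a # ys = replicate (length (a # ys)) 0"
        by (auto simp: filter_empty_conv intro: replicate_eqI)
      then show ?thesis by simp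
    qed
  qed simp
  have length_l: "length l \<le> N"
    unfolding l_def ys_def by (rule order.trans[OF length_filter_le]) simp
  have part_l: "part l (Suc i) = nat (y i)" if "i < N" for i
  proof -
    have "length ys = N" by (simp add: ys_def)
    then have "part l (Suc i) = (l @ replicate (length ys - length l) 0) ! i"
      using that by (simp add: part_def nth_append)
    also have "\<dots> = ys ! i"
      using ys_eq by (rule arg_cong[OF sym])
    finally show ?thesis
      using that by (simp add: ys_def)
  qed
  have "edge l (Suc i) = xs ! i" if "i < N" for i
    using y_nonneg[OF that] by (simp add: edge_def part_l[OF that]) (simp add: y_def)
  then have "(\<lambda>i. edge l (Suc i)) ` {..<N} = (\<lambda>i. xs ! i) ` {..<N}"
    by (intro image_cong) auto
  also have "\<dots> = ?W"
    unfolding set[symmetric] by (auto simp: len[symmetric] in_set_conv_nth)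
  also have "(\<lambda>i. edge l (Suc i)) ` {..<N} = edge l ` {1..N}"
    by (simp only: image_image[symmetric] image_Suc_lessThan)
  finally have "{k \<in> zeros l. - int N \<le> k} = ?W"
    by (simp only: zeros_window[OF l length_l])
  moreover have "k \<in> zeros l \<longleftrightarrow> k \<in> Z" if "k < - int N" for k
    using that below zeros_below[of k l] length_l by auto
  ultimately have "zeros l = Z"
    by (auto simp: set_eq_iff) (metis not_le)+
  with l show ?thesis by blast
qed

subsection \<open>Cores and charges\<close>

text \<open>The flush abacus with \<open>t\<close> runners: on the runner of residue
  \<open>p\<close>, exactly the levels below \<open>\<nu> p\<close> are occupied.\<close>

definition abacus :: "nat \<Rightarrow> (nat \<Rightarrow> int) \<Rightarrow> int set" where
  "abacus t \<nu> = {x. x div int t < \<nu> (nat (x mod int t))}"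

lemma mem_abacus_iff: "p < t \<Longrightarrow> int p + int t * k \<in> abacus t \<nu> \<longleftrightarrow> k < \<nu> p"
  by (simp add: abacus_def add.commute[of "int p"] div_add1_eq)

lemma int_residue_cases:
  assumes "0 < t"
  obtains p k where "p < t" "x = int p + int t * k"
proof (rule that)
  show "nat (x mod int t) < t"
    using assms by (simp add: nat_less_iff)
  show "x = int (nat (x mod int t)) + int t * (x div int t)"
    using assms by simp
qed

lemma residue_eq_iff:
  assumes "p < t" "q < t"
  shows "int p + int t * k = int q + int t * m \<longleftrightarrow> p = q \<and> k = m"
proof
  assume eq: "int p + int t * k = int q + int t * m"
  then have "(int p + int t * k) mod int t = (int q + int t * m) mod int t"
    by simp
  then have "p = q" using assms by simp
  with eq assms show "p = q \<and> k = m" by simp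
qed auto

text \<open>The last zero on runner \<open>p\<close> is at level \<open>\<nu> p - 1\<close>, and
  \<open>beta\<close> lies one period above it, at the first free position.\<close>

lemma beta_abacus:
  assumes "zeros l = abacus t \<nu>" "p < t"
  shows "beta t l p = int p + int t * \<nu> p"
proof -
  have zero_iff: "word l (k * int t + int p) = 0 \<longleftrightarrow> k < \<nu> p" for k
  proof -
    have "word l (k * int t + int p) = 0 \<longleftrightarrow> int p + int t * k \<in> zeros l"
      by (simp add: zeros_def add.commute mult.commute)
    then show ?thesis
      by (simp only: assms(1) mem_abacus_iff[OF assms(2)])
  qed
  show ?thesis
    unfolding beta_def zero_iff
  proof (rule Greatest_equality)
    show "\<exists>k. int p + int t * \<nu> p = (k + 1) * int t + int p \<and> k < \<nu> p"
      by (rule exI[of _ "\<nu> p - 1"]) (simp add: algebra_simps)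
  next
    fix b assume "\<exists>k. b = (k + 1) * int t + int p \<and> k < \<nu> p"
    then obtain k where k: "b = (k + 1) * int t + int p" "k < \<nu> p" by blast
    then have "(k + 1) * int t \<le> \<nu> p * int t"
      by (intro mult_right_mono) auto
    then show "b \<le> int p + int t * \<nu> p"
      using k(1) by (simp add: mult.commute)
  qed
qed

definition charges :: "nat \<Rightarrow> nat list \<Rightarrow> nat \<Rightarrow> int" where
  "charges t l = restrict (\<lambda>p. beta t l p div int t) {..<t}"

lemma charges_eqI:
  assumes "zeros l = abacus t \<nu>" "\<nu> \<in> extensional {..<t}"
  shows "charges t l = \<nu>"
proof (rule extensionalityI[OF _ assms(2)])
  show "charges t l \<in> extensional {..<t}" by (simp add: charges_def)
  fix p assume "p \<in> {..<t}"
  then show "charges t l p = \<nu> p"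
    using beta_abacus[OF assms(1), of p] by (simp add: charges_def)
qed

lemma int_set_has_max:
  fixes S :: "int set"
  assumes "x \<in> S" "\<And>y. y \<in> S \<Longrightarrow> y \<le> b"
  shows "\<exists>m\<in>S. \<forall>y\<in>S. y \<le> m"
proof -
  let ?T = "{y \<in> S. x \<le> y}"
  have fin: "finite ?T"
    by (rule finite_subset[of _ "{x..b}"]) (use assms(2) in auto)
  have "Max ?T \<in> ?T"
    using fin assms(1) by (intro Max_in) auto
  moreover have "y \<le> Max ?T" if "y \<in> S" for y
  proof (cases "x \<le> y")
    case True
    then show ?thesis using fin that by (intro Max_ge) auto
  next
    case False
    moreover have "x \<le> Max ?T" using fin assms(1) by (intro Max_ge) auto
    ultimately show ?thesis by simp
  qed
  ultimately show ?thesis by blast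
qed

text \<open>On each runner the zeros are closed under going down one level, exist far below, and are
  bounded by the first part; hence they form a ray.\<close>

lemma core_zeros_abacus:
  assumes t: "0 < t" and l: "l \<in> cores t"
  shows "\<exists>\<nu>\<in>extensional {..<t}. zeros l = abacus t \<nu>"
proof -
  have part: "is_partition l" and closed: "\<And>m. m \<in> zeros l \<Longrightarrow> m - int t \<in> zeros l"
    using l unfolding cores_iff[OF t] by auto
  have closed': "x - int t * int c \<in> zeros l" if "x \<in> zeros l" for x c
    using that
  proof (induction c)
    case (Suc c)
    then show ?case using closed[of "x - int t * int c"] by (simp add: algebra_simps)
  qed simp
  have "\<exists>n. \<forall>k. int p + int t * k \<in> zeros l \<longleftrightarrow> k < n" if p: "p < t" for p
  proof -
    let ?S = "{k. int p + int t * k \<in> zeros l}"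
    \<comment> \<open>The final \<open>- 1\<close> absorbs the residue \<open>p < t\<close>, so that
      the position falls below \<open>- int (length l)\<close>.\<close>
    have "- int (Suc (length l)) - 1 \<in> ?S"
    proof -
      have "int p + int t * (- int (Suc (length l)) - 1) \<le> - int t * int (Suc (length l))"
        using p by (simp add: algebra_simps)
      also have "\<dots> \<le> - 1 * int (Suc (length l))"
        using t by (intro mult_right_mono) auto
      finally have "int p + int t * (- int (Suc (length l)) - 1) < - int (length l)"
        by simp
      then show ?thesis by (simp only: mem_Collect_eq zeros_below)
    qed
    moreover have "k \<le> int (part l 1)" if "k \<in> ?S" for k
    proof (rule ccontr)
      assume "\<not> k \<le> int (part l 1)"
      then have "1 * int (part l 1) \<le> int t * k"
        using t by (intro mult_mono) auto
      moreover have "int p + int t * k \<in> edge l ` {1..}"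
        using that by (simp only: zeros_eq mem_Collect_eq)
      then obtain i where "1 \<le> i" "int p + int t * k = edge l i"
        by (auto elim!: imageE)
      then have "int p + int t * k \<le> int (part l 1) - 1"
        using part_antimono[OF part, of 1 i] by (simp add: edge_def)
      ultimately show False by simp
    qed
    ultimately obtain m where m: "m \<in> ?S" "\<And>k. k \<in> ?S \<Longrightarrow> k \<le> m"
      using int_set_has_max[of _ ?S "int (part l 1)"] by blast
    have "int p + int t * k \<in> zeros l" if "k \<le> m" for k
    proof -
      have "int p + int t * m - int t * int (nat (m - k)) \<in> zeros l"
        using m(1) by (intro closed') simp
      then show ?thesis using that by (simp add: algebra_simps)
    qed
    then have "int p + int t * k \<in> zeros l \<longleftrightarrow> k < m + 1" for k
      using m(2)[of k] by auto
    then show ?thesis by blast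
  qed
  then obtain n where n: "\<And>p k. p < t \<Longrightarrow> int p + int t * k \<in> zeros l \<longleftrightarrow> k < n p"
    by metis
  have "zeros l = abacus t (restrict n {..<t})"
  proof (rule Set.set_eqI)
    fix x
    obtain p k where "p < t" "x = int p + int t * k"
      using int_residue_cases[OF t] .
    then show "x \<in> zeros l \<longleftrightarrow> x \<in> abacus t (restrict n {..<t})"
      by (simp add: n mem_abacus_iff)
  qed
  then show ?thesis
    by (intro bexI[of _ "restrict n {..<t}"]) auto
qed

section \<open>Charge and size read from the abacus\<close>

lemma sum_int_atLeastLessThan:
  assumes "m \<le> (n::int)"
  shows "(\<Sum>k\<in>{m..<n}. k) = tri n - tri m"
  using assms
proof (induction n rule: int_ge_induct)
  case (step n)
  then have "{m..<n + 1} = insert n {m..<n}" by auto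
  then show ?case using step by (simp add: tri_Suc)
qed simp

text \<open>The window starts at a multiple of \<open>t\<close> and hence at level
  \<open>- M\<close> on every runner; runner \<open>p\<close> contributes the levels from there to
  \<open>\<nu> p - 1\<close>.\<close>

lemma abacus_window:
  assumes t: "0 < t" and M: "\<And>p. p < t \<Longrightarrow> - int M \<le> \<nu> p"
  shows "finite {x \<in> abacus t \<nu>. - int (t * M) \<le> x}"
    and "int (card {x \<in> abacus t \<nu>. - int (t * M) \<le> x}) = (\<Sum>p<t. \<nu> p) + int (t * M)"
    and "(\<Sum>x | x \<in> abacus t \<nu> \<and> - int (t * M) \<le> x. x)
      = (\<Sum>p<t. int p * (\<nu> p + int M) + int t * (tri (\<nu> p) - tri (- int M)))"
    and "\<And>x. x < - int (t * M) \<Longrightarrow> x \<in> abacus t \<nu>"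
proof -
  let ?I = "SIGMA p:{..<t}. {- int M..<\<nu> p}" and ?f = "\<lambda>(p, k). int p + int t * k"
  have window_iff: "- int (t * M) \<le> int p + int t * k \<longleftrightarrow> - int M \<le> k" if "p < t" for p k
  proof
    assume "- int M \<le> k"
    then have "int t * (- int M) \<le> int t * k" by (intro mult_left_mono) auto
    then show "- int (t * M) \<le> int p + int t * k" by simp
  next
    assume *: "- int (t * M) \<le> int p + int t * k"
    show "- int M \<le> k"
    proof (rule ccontr)
      assume "\<not> - int M \<le> k"
      then have "int t * k \<le> int t * (- int M - 1)" by (intro mult_left_mono) auto
      with * that show False by (simp add: algebra_simps)
    qed
  qed
  have bij: "bij_betw ?f ?I {x \<in> abacus t \<nu>. - int (t * M) \<le> x}"
  proof (rule bij_betwI')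
    fix x y assume "x \<in> ?I" "y \<in> ?I"
    then show "(?f x = ?f y) = (x = y)"
      using residue_eq_iff[of "fst x" t "fst y" "snd x" "snd y"] by (cases x; cases y) auto
  next
    fix x assume "x \<in> ?I"
    then obtain p k where "x = (p, k)" "p < t" "- int M \<le> k" "k < \<nu> p" by auto
    then show "?f x \<in> {x \<in> abacus t \<nu>. - int (t * M) \<le> x}"
      using window_iff[of p k] by (simp add: mem_abacus_iff)
  next
    fix y assume y: "y \<in> {x \<in> abacus t \<nu>. - int (t * M) \<le> x}"
    obtain p k where pk: "p < t" "y = int p + int t * k"
      using int_residue_cases[OF t] .
    with y have "k < \<nu> p" "- int M \<le> k"
      using window_iff[of p k] by (auto simp: mem_abacus_iff)
    with pk show "\<exists>x\<in>?I. y = ?f x"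
      by (intro bexI[of _ "(p, k)"]) auto
  qed
  show "finite {x \<in> abacus t \<nu>. - int (t * M) \<le> x}"
    using bij_betw_finite[OF bij] by simp
  have "card {x \<in> abacus t \<nu>. - int (t * M) \<le> x} = (\<Sum>p<t. nat (\<nu> p + int M))"
    using bij_betw_same_card[OF bij] by simp
  then have "int (card {x \<in> abacus t \<nu>. - int (t * M) \<le> x}) = (\<Sum>p<t. int (nat (\<nu> p + int M)))"
    by (simp only: of_nat_sum)
  also have "\<dots> = (\<Sum>p<t. \<nu> p + int M)"
  proof (rule sum.cong[OF refl])
    fix p assume "p \<in> {..<t}"
    then show "int (nat (\<nu> p + int M)) = \<nu> p + int M"
      using M[of p] by simp
  qed
  finally show "int (card {x \<in> abacus t \<nu>. - int (t * M) \<le> x}) = (\<Sum>p<t. \<nu> p) + int (t * M)"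
    by (simp add: sum.distrib)
  have "(\<Sum>x | x \<in> abacus t \<nu> \<and> - int (t * M) \<le> x. x) = (\<Sum>z\<in>?I. ?f z)"
    by (rule sum.reindex_bij_betw[OF bij, symmetric])
  also have "\<dots> = (\<Sum>p<t. \<Sum>k\<in>{- int M..<\<nu> p}. int p + int t * k)"
    by (subst sum.Sigma) auto
  also have "\<dots> = (\<Sum>p<t. int p * (\<nu> p + int M) + int t * (tri (\<nu> p) - tri (- int M)))"
  proof (rule sum.cong[OF refl])
    fix p assume "p \<in> {..<t}"
    then have "- int M \<le> \<nu> p" using M by simp
    moreover have "(\<Sum>k\<in>{- int M..<\<nu> p}. int p + int t * k)
        = (\<Sum>k\<in>{- int M..<\<nu> p}. int p) + int t * (\<Sum>k\<in>{- int M..<\<nu> p}. k)"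
      by (simp only: sum.distrib sum_distrib_left)
    ultimately show "(\<Sum>k\<in>{- int M..<\<nu> p}. int p + int t * k)
        = int p * (\<nu> p + int M) + int t * (tri (\<nu> p) - tri (- int M))"
      by (simp add: sum_int_atLeastLessThan mult.commute)
  qed
  finally show "(\<Sum>x | x \<in> abacus t \<nu> \<and> - int (t * M) \<le> x. x)
      = (\<Sum>p<t. int p * (\<nu> p + int M) + int t * (tri (\<nu> p) - tri (- int M)))" .
  show "x \<in> abacus t \<nu>" if "x < - int (t * M)" for x
  proof -
    obtain p k where pk: "p < t" "x = int p + int t * k"
      using int_residue_cases[OF t] .
    then have "k < - int M"
      using that window_iff[of p k] by auto
    then show ?thesis
      using pk M[of p] by (simp add: mem_abacus_iff)
  qed
qed

lemma exists_lower_bound: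
  fixes \<nu> :: "nat \<Rightarrow> int"
  shows "\<exists>M\<ge>N. \<forall>p<t. - int M \<le> \<nu> p"
proof (induction t)
  case (Suc t)
  then obtain M where "N \<le> M" "\<forall>p<t. - int M \<le> \<nu> p" by blast
  then show ?case
    by (intro exI[of _ "max M (nat (- \<nu> t))"]) (auto simp: less_Suc_eq)
qed auto

text \<open>The same window is counted and summed by rows and by runners: cardinalities give the
  charge, sums the size.\<close>

lemma abacus_partition:
  assumes t: "0 < t" and l: "is_partition l" and Z: "zeros l = abacus t \<nu>"
  shows "(\<Sum>p<t. \<nu> p) = 0" "sum_list l = qform t \<nu>"
proof -
  obtain M where M: "length l \<le> M" "\<And>p. p < t \<Longrightarrow> - int M \<le> \<nu> p"
    using exists_lower_bound[of "length l" t \<nu>] by blast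
  have "1 * M \<le> t * M" using t by (intro mult_le_mono1) simp
  then have N: "length l \<le> t * M"
    using order.trans[OF M(1)] by (simp only: mult_1)
  note window = abacus_window[of t M \<nu>, OF t M(2)]
  note part = zeros_window_card_sum[OF l N, unfolded Z]
  show charge: "(\<Sum>p<t. \<nu> p) = 0"
    using window(2) part(1) by simp
  have "int (sum_list l) = (\<Sum>p<t. int p * (\<nu> p + int M) + int t * (tri (\<nu> p) - tri (- int M)))
      + (\<Sum>i=1..t * M. int i)"
    using window(3) part(2) by simp
  also have "(\<Sum>p<t. int p * (\<nu> p + int M) + int t * (tri (\<nu> p) - tri (- int M)))
      = int (qform t \<nu>) + (\<Sum>p<t. int p) * int M - int t * int t * tri (- int M)"
    unfolding int_qform by (simp add: sum.distrib sum_subtractf sum_distrib_left sum_distrib_right algebra_simps)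
  \<comment> \<open>After doubling, the triangular numbers are polynomials and all terms with
    \<open>M\<close> cancel.\<close>
  finally have "2 * int (sum_list l) = 2 * int (qform t \<nu>)
      + (2 * (\<Sum>p<t. int p)) * int M - int t * int t * (2 * tri (- int M)) + 2 * (\<Sum>i=1..t * M. int i)"
    by simp
  moreover have "2 * (\<Sum>p<t. int p) = int t * (int t - 1)"
    by (induction t) (simp_all add: algebra_simps)
  moreover have "2 * (\<Sum>i=1..n. int i) = int n * (int n + 1)" for n
    by (induction n) (simp_all add: algebra_simps)
  ultimately have "2 * int (sum_list l) = 2 * int (qform t \<nu>)"
    by (simp add: two_tri algebra_simps)
  then show "sum_list l = qform t \<nu>" by simp
qed

lemma core_zeros_charges:
  assumes "0 < t" "l \<in> cores t"
  shows "zeros l = abacus t (charges t l)" "charges t l \<in> charge0 t"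
proof -
  obtain \<nu> where \<nu>: "\<nu> \<in> extensional {..<t}" "zeros l = abacus t \<nu>"
    using core_zeros_abacus[OF assms] by blast
  then have "charges t l = \<nu>"
    by (intro charges_eqI)
  with \<nu> show "zeros l = abacus t (charges t l)" by simp
  then have "(\<Sum>p<t. charges t l p) = 0"
    using assms by (intro abacus_partition(1)[of t l]) (auto simp: cores_def)
  then show "charges t l \<in> charge0 t"
    by (auto simp: charge0_def charges_def)
qed

lemma bij_betw_charges:
  assumes t: "0 < t"
  shows "bij_betw (charges t) (cores t) (charge0 t)"
proof (rule bij_betwI')
  fix l l' assume "l \<in> cores t" "l' \<in> cores t"
  then show "(charges t l = charges t l') = (l = l')"
    using core_zeros_charges(1)[OF t] by (metis cores_iff[OF t] partition_eqI)
next
  fix \<nu> assume \<nu>: "\<nu> \<in> charge0 t"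
  then have ext: "\<nu> \<in> extensional {..<t}"
    by (auto simp: charge0_def PiE_def)
  obtain M where M: "\<And>p. p < t \<Longrightarrow> - int M \<le> \<nu> p"
    using exists_lower_bound[of 0 t \<nu>] by blast
  note window = abacus_window[of t M \<nu>, OF t M]
  \<comment> \<open>Charge 0 is precisely the cardinality condition of
    \<open>partition_exists\<close>.\<close>
  have "card {x \<in> abacus t \<nu>. - int (t * M) \<le> x} = t * M"
    using window(2) \<nu> by (simp add: charge0_def flip: of_nat_mult)
  then obtain l where l: "is_partition l" "zeros l = abacus t \<nu>"
    using partition_exists[of "t * M" "abacus t \<nu>"] window(1,4) by blast
  have "m - int t \<in> abacus t \<nu>" if m: "m \<in> abacus t \<nu>" for m
  proof -
    obtain p k where pk: "p < t" "m = int p + int t * k"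
      using int_residue_cases[OF t] .
    then have "k - 1 < \<nu> p" using m by (simp add: mem_abacus_iff)
    then have "int p + int t * (k - 1) \<in> abacus t \<nu>"
      using pk(1) by (simp only: mem_abacus_iff)
    then show ?thesis using pk(2) by (simp add: algebra_simps)
  qed
  then have "l \<in> cores t"
    using l by (simp add: cores_iff[OF t])
  then show "\<exists>l\<in>cores t. \<nu> = charges t l"
    using charges_eqI[OF l(2) ext] by (intro bexI[of _ l]) auto
qed (rule core_zeros_charges(2)[OF t])

section \<open>Number of parts and short hooks of a core\<close>

lemma core_beta:
  assumes "0 < t" "l \<in> cores t" "p < t"
  shows "beta t l p = int p + int t * charges t l p"
  using beta_abacus[OF core_zeros_charges(1)[OF assms(1,2)] assms(3)] .

text \<open>The smallest position that is not a zero is minus the number of parts. It is the first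
  free position of its runner, and no other runner has one below it.\<close>

lemma core_length:
  assumes t: "0 < t" and l: "l \<in> cores t"
  shows "\<exists>p<t. beta t l p = - int (length l)" "\<And>p. p < t \<Longrightarrow> - int (length l) \<le> beta t l p"
proof -
  have part: "is_partition l" using l by (simp add: cores_def)
  note Z = core_zeros_charges(1)[OF t l]
  obtain p k where pk: "p < t" "- int (length l) = int p + int t * k"
    using int_residue_cases[OF t] .
  have "\<not> k < charges t l p"
    using minus_length_notin_zeros[OF part] unfolding Z pk(2) mem_abacus_iff[OF pk(1)] .
  moreover have "- int (length l) - int t \<in> zeros l"
    using t by (intro zeros_below) simp
  then have "int p + int t * (k - 1) \<in> abacus t (charges t l)"
    unfolding Z pk(2) by (simp add: algebra_simps)
  then have "k - 1 < charges t l p"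
    unfolding mem_abacus_iff[OF pk(1)] .
  ultimately have "charges t l p = k" by simp
  then show "\<exists>p<t. beta t l p = - int (length l)"
    using pk core_beta[OF t l pk(1)] by auto
  show "- int (length l) \<le> beta t l p" if "p < t" for p
  proof (rule ccontr)
    assume "\<not> - int (length l) \<le> beta t l p"
    then have "beta t l p \<in> zeros l" by (intro zeros_below) simp
    then show False
      unfolding core_beta[OF t l that] Z mem_abacus_iff[OF that] by simp
  qed
qed

text \<open>For a hole \<open>k\<close> on runner \<open>p\<close>, only one position of runner
  \<open>q\<close> lies less than \<open>t\<close> steps ahead. Let \<open>k\<close> be
  \<open>a\<close> levels above the first free one; that position is a zero exactly for
  \<open>a\<close> below \<open>(beta t l q - beta t l p) div int t\<close>.\<close>

lemma core_short_hooks: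
  assumes t: "0 < t" and l: "l \<in> cores t"
  shows "card (short_hooks t l) = (\<Sum>p<t. \<Sum>q<t. nat ((beta t l q - beta t l p) div int t))"
proof -
  define \<nu> where "\<nu> = charges t l"
  have \<beta>: "beta t l p = int p + int t * \<nu> p" if "p < t" for p
    using core_beta[OF t l that] by (simp add: \<nu>_def)
  have Z: "zeros l = abacus t \<nu>"
    using core_zeros_charges(1)[OF t l] by (simp add: \<nu>_def)
  let ?D = "\<lambda>p q. (beta t l q - beta t l p) div int t"
  let ?I = "SIGMA z:{..<t} \<times> {..<t}. {0..<?D (fst z) (snd z)}"
  let ?J = "{(k, m) \<in> inversions (zeros l). m - k < int t}"
  let ?f = "\<lambda>((p, q), a). (int p + int t * (\<nu> p + a), int q + int t * (\<nu> q - ?D p q + a))"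
  \<comment> \<open>The distance is independent of \<open>a\<close> and less than \<open>t\<close>;
    it vanishes only for \<open>p = q\<close>, where the range of \<open>a\<close> is empty.\<close>
  have diff: "(int q + int t * (\<nu> q - ?D p q + a)) - (int p + int t * (\<nu> p + a))
      = (beta t l q - beta t l p) mod int t" if "p < t" "q < t" for p q a
  proof -
    have "beta t l q - beta t l p = int t * ?D p q + (beta t l q - beta t l p) mod int t"
      by simp
    then show ?thesis
      using \<beta>[OF that(1)] \<beta>[OF that(2)] by (simp add: algebra_simps)
  qed
  have "bij_betw ?f ?I ?J"
  proof (rule bij_betwI')
    fix x y assume "x \<in> ?I" "y \<in> ?I"
    then obtain p q a p' q' a' where
      x: "x = ((p, q), a)" "p < t" "q < t" and y: "y = ((p', q'), a')" "p' < t" "q' < t"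
      by auto
    show "(?f x = ?f y) = (x = y)"
      using residue_eq_iff[OF x(2) y(2), of "\<nu> p + a" "\<nu> p' + a'"]
        residue_eq_iff[OF x(3) y(3), of "\<nu> q - ?D p q + a" "\<nu> q' - ?D p' q' + a'"]
      unfolding x(1) y(1) by auto
  next
    fix x assume "x \<in> ?I"
    then obtain p q a where x: "x = ((p, q), a)" "p < t" "q < t" "0 \<le> a" "a < ?D p q"
      by auto
    have "(beta t l q - beta t l p) mod int t \<noteq> 0"
    proof
      assume "(beta t l q - beta t l p) mod int t = 0"
      then have "beta t l q mod int t = beta t l p mod int t"
        by (simp add: mod_eq_dvd_iff mod_eq_0_iff_dvd)
      then have "p = q"
        using x(2,3) by (simp add: \<beta>)
      with x(4,5) show False by simp
    qed
    moreover have "0 \<le> (beta t l q - beta t l p) mod int t" "(beta t l q - beta t l p) mod int t < int t"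
      using t by auto
    ultimately have "0 < snd (?f x) - fst (?f x)" "snd (?f x) - fst (?f x) < int t"
      unfolding x(1) split fst_conv snd_conv diff[OF x(2,3)] by auto
    moreover have "fst (?f x) \<notin> zeros l" "snd (?f x) \<in> zeros l"
      unfolding x(1) split fst_conv snd_conv Z mem_abacus_iff[OF x(2)] mem_abacus_iff[OF x(3)]
      using x(4,5) by auto
    ultimately show "?f x \<in> ?J"
      by (auto simp: inversions_def case_prod_unfold)
  next
    fix y assume "y \<in> ?J"
    then obtain k m where y: "y = (k, m)" "k < m" "k \<notin> zeros l" "m \<in> zeros l" "m - k < int t"
      by (auto simp: inversions_def)
    obtain p c where p: "p < t" "k = int p + int t * c"
      using int_residue_cases[OF t] .
    obtain q d where q: "q < t" "m = int q + int t * d"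
      using int_residue_cases[OF t] .
    have c: "\<nu> p \<le> c" and d: "d < \<nu> q"
      using y(3,4) unfolding Z p(2) q(2) mem_abacus_iff[OF p(1)] mem_abacus_iff[OF q(1)] by auto
    have "beta t l q - beta t l p = int t * (\<nu> q - d + (c - \<nu> p)) + (m - k)"
      unfolding \<beta>[OF p(1)] \<beta>[OF q(1)] p(2) q(2) by (simp add: algebra_simps)
    then have "?D p q = \<nu> q - d + (c - \<nu> p) + (m - k) div int t"
      using t by simp
    also have "(m - k) div int t = 0"
      using y(2,5) by (intro div_pos_pos_trivial) auto
    finally have D: "?D p q = \<nu> q - d + (c - \<nu> p)" by simp
    show "\<exists>x\<in>?I. y = ?f x"
      using c d p q D y(1) by (intro bexI[of _ "((p, q), c - \<nu> p)"]) auto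
  qed
  then have "card ?J = card ?I"
    by (rule bij_betw_same_card[symmetric])
  also have "\<dots> = (\<Sum>z\<in>{..<t} \<times> {..<t}. nat (?D (fst z) (snd z)))"
    by (subst card_SigmaI) auto
  also have "\<dots> = (\<Sum>p<t. \<Sum>q<t. nat (?D p q))"
    by (simp add: sum.cartesian_product case_prod_unfold)
  finally show ?thesis
    using l by (simp add: card_short_hooks cores_def)
qed

subsection \<open>The summands\<close>

lemma sum_pairs_below_charge0:
  assumes "\<nu> \<in> charge0 t"
  shows "(\<Sum>(i, j)\<in>pairs_below t. \<nu> i + \<nu> j) = 0"
  using assms by (intro sum_pairs_below_add) (simp add: charge0_def)

lemma psgn_int_nat: "psgn (int n) = (- 1) ^ n"
  by (simp add: psgn_def)

text \<open>For \<open>i < j\<close> the two quotients are \<open>\<nu> j - \<nu> i\<close> and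
  \<open>\<nu> i - \<nu> j - 1\<close>, and only the nonnegative one counts. It has the parity of
  \<open>\<nu> i + \<nu> j\<close>, increased by one exactly if the two \<open>beta\<close> values
  are inverted.\<close>

lemma core_short_hooks_sign:
  assumes t: "0 < t" and l: "l \<in> cores t"
  shows "(- 1) ^ card (short_hooks t l) = (\<Prod>(i, j)\<in>pairs_below t. sgn (beta t l j - beta t l i))"
proof -
  define \<nu> where "\<nu> = charges t l"
  let ?g = "\<lambda>p q. int (nat ((beta t l q - beta t l p) div int t))"
  have pair: "psgn (?g i j + ?g j i) = psgn (\<nu> i + \<nu> j) * sgn (beta t l j - beta t l i)"
    if ij: "i < j" "j < t" for i j
  proof -
    have \<beta>: "beta t l i = int i + int t * \<nu> i" "beta t l j = int j + int t * \<nu> j"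
      using core_beta[OF t l] ij by (simp_all add: \<nu>_def)
    have d1: "(beta t l j - beta t l i) div int t = \<nu> j - \<nu> i"
    proof -
      have "beta t l j - beta t l i = (int j - int i) + int t * (\<nu> j - \<nu> i)"
        unfolding \<beta> by (simp add: algebra_simps)
      moreover have "(int j - int i) div int t = 0"
        using ij by (intro div_pos_pos_trivial) auto
      ultimately show ?thesis using t by simp
    qed
    have d2: "(beta t l i - beta t l j) div int t = \<nu> i - \<nu> j - 1"
    proof -
      have "beta t l i - beta t l j = (int t - (int j - int i)) + int t * (\<nu> i - \<nu> j - 1)"
        unfolding \<beta> by (simp add: algebra_simps)
      moreover have "(int t - (int j - int i)) div int t = 0"
        using ij by (intro div_pos_pos_trivial) auto
      ultimately show ?thesis using t by simp
    qed
    show ?thesis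
    proof (cases "\<nu> i \<le> \<nu> j")
      case True
      then have "int t * \<nu> i \<le> int t * \<nu> j" by (intro mult_left_mono) auto
      then have "0 < beta t l j - beta t l i"
        using ij unfolding \<beta> by linarith
      then have "sgn (beta t l j - beta t l i) = 1"
        by (rule sgn_pos)
      moreover have "?g i j + ?g j i = \<nu> i + \<nu> j + 2 * (- \<nu> i)"
        unfolding d1 d2 using True by simp
      ultimately show ?thesis
        by (simp only: psgn_add) (simp add: psgn_def)
    next
      case False
      then have "int t * (\<nu> j + 1) \<le> int t * \<nu> i" by (intro mult_left_mono) auto
      then have "int t * \<nu> j + int t \<le> int t * \<nu> i"
        by (simp add: algebra_simps)
      then have "beta t l j - beta t l i < 0"
        using ij unfolding \<beta> by linarith
      then have "sgn (beta t l j - beta t l i) = - 1"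
        by (rule sgn_neg)
      moreover have "?g i j + ?g j i = \<nu> i + \<nu> j + 2 * (- \<nu> j) + (- 1)"
        unfolding d1 d2 using False by simp
      ultimately show ?thesis
        by (simp only: psgn_add) (simp add: psgn_def)
    qed
  qed
  have "int (card (short_hooks t l)) = (\<Sum>p<t. \<Sum>q<t. ?g p q)"
    by (simp only: core_short_hooks[OF t l] of_nat_sum)
  also have "\<dots> = (\<Sum>p<t. \<Sum>q\<in>{..<t} - {p}. ?g p q)"
    by (intro sum.cong refl sum.mono_neutral_right) auto
  also have "\<dots> = (\<Sum>(i, j)\<in>pairs_below t. ?g i j + ?g j i)"
    by (rule sum_pairs_below_symmetric[symmetric])
  finally have "(- 1) ^ card (short_hooks t l) = psgn (\<Sum>(i, j)\<in>pairs_below t. ?g i j + ?g j i)"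
    by (simp only: psgn_int_nat[symmetric])
  also have "\<dots> = (\<Prod>z\<in>pairs_below t. psgn (case z of (i, j) \<Rightarrow> ?g i j + ?g j i))"
    by (rule psgn_sum)
  also have "\<dots> = (\<Prod>z\<in>pairs_below t. psgn (case z of (i, j) \<Rightarrow> \<nu> i + \<nu> j)
      * (case z of (i, j) \<Rightarrow> sgn (beta t l j - beta t l i)))"
  proof (rule prod.cong[OF refl])
    fix z assume "z \<in> pairs_below t"
    then obtain i j where "z = (i, j)" "i < j" "j < t" by auto
    then show "psgn (case z of (i, j) \<Rightarrow> ?g i j + ?g j i) = psgn (case z of (i, j) \<Rightarrow> \<nu> i + \<nu> j)
        * (case z of (i, j) \<Rightarrow> sgn (beta t l j - beta t l i))"
      by (simp only: split pair)
  qed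
  also have "\<dots> = psgn (\<Sum>(i, j)\<in>pairs_below t. \<nu> i + \<nu> j)
      * (\<Prod>(i, j)\<in>pairs_below t. sgn (beta t l j - beta t l i))"
    by (simp only: prod.distrib psgn_sum)
  also have "(\<Sum>(i, j)\<in>pairs_below t. \<nu> i + \<nu> j) = 0"
    unfolding \<nu>_def by (rule sum_pairs_below_charge0[OF core_zeros_charges(2)[OF t l]])
  finally show ?thesis by simp
qed

text \<open>The values of \<open>beta\<close> have distinct residues, so sorting them is strict and
  amounts to a permutation; the last entry is their minimum, known from
  \<open>core_length\<close>.\<close>

lemma V_coding_core:
  assumes t: "0 < t" and l: "l \<in> cores t"
  shows "\<exists>\<pi>. \<pi> permutes {0..<t} \<and> (\<forall>j<t. V_coding t t l ! j = beta t l (\<pi> j))"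
    and "\<And>i j. i < j \<Longrightarrow> j < t \<Longrightarrow> V_coding t t l ! j < V_coding t t l ! i"
    and "V_coding t t l ! (t - 1) = - int (length l)"
proof -
  let ?bs = "map (beta t l) [0..<t]"
  define vs where "vs = V_coding t t l"
  have vs: "vs = rev (sort ?bs)"
    by (simp add: vs_def V_coding_def)
  have len: "length vs = t" by (simp add: vs)
  have inj: "inj_on (beta t l) {..<t}"
  proof (rule inj_onI)
    fix p q assume "p \<in> {..<t}" "q \<in> {..<t}" "beta t l p = beta t l q"
    then show "p = q"
      using core_beta[OF t l, of p] core_beta[OF t l, of q]
        residue_eq_iff[of p t q "charges t l p" "charges t l q"] by simp
  qed
  have "mset vs = mset ?bs" by (simp add: vs)
  then obtain \<pi> where \<pi>: "\<pi> permutes {..<length ?bs}" "permute_list \<pi> ?bs = vs"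
    using mset_eq_permutation by metis
  have perm: "\<pi> permutes {0..<t}"
    using \<pi>(1) by (simp add: atLeast0LessThan)
  have vs_nth: "vs ! j = beta t l (\<pi> j)" if "j < t" for j
  proof -
    have "\<pi> j < t" using permutes_in_image[OF perm, of j] that by simp
    then show ?thesis
      using permute_list_nth[OF \<pi>(1), of j] that by (simp add: \<pi>(2))
  qed
  with perm show "\<exists>\<pi>. \<pi> permutes {0..<t} \<and> (\<forall>j<t. V_coding t t l ! j = beta t l (\<pi> j))"
    unfolding vs_def by blast
  have "distinct vs"
    using inj by (simp add: vs distinct_map atLeast0LessThan)
  have dec: "vs ! j < vs ! i" if "i < j" "j < t" for i j
  proof -
    have "sorted_wrt (\<ge>) vs"
      by (simp add: vs sorted_wrt_rev)
    then have "vs ! j \<le> vs ! i"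
      using that len sorted_wrt_nth_less[of "(\<ge>)" vs i j] by simp
    moreover have "vs ! j \<noteq> vs ! i"
      using \<open>distinct vs\<close> that len by (simp add: nth_eq_iff_index_eq)
    ultimately show ?thesis by simp
  qed
  then show "V_coding t t l ! j < V_coding t t l ! i" if "i < j" "j < t" for i j
    using that by (simp add: vs_def)
  have "- int (length l) \<in> set vs"
    using core_length(1)[OF t l] by (force simp: vs)
  then obtain j where j: "j < t" "vs ! j = - int (length l)"
    using len by (auto simp: in_set_conv_nth)
  have "vs ! (t - 1) \<in> set vs"
    using len t by (intro nth_mem) simp
  then have "- int (length l) \<le> vs ! (t - 1)"
    using core_length(2)[OF t l] by (auto simp: vs)
  moreover have "vs ! (t - 1) \<le> vs ! j"
  proof (cases "j = t - 1")
    case False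
    then have "j < t - 1" "t - 1 < t" using j(1) by auto
    then show ?thesis using dec by (intro less_imp_le)
  qed simp
  ultimately show "V_coding t t l ! (t - 1) = - int (length l)"
    using j(2) by (simp add: vs_def)
qed

text \<open>Strict decrease gives \<open>v j - v (t - 1) \<ge> t - 1 - j\<close>, so neither
  \<open>nat\<close> nor the natural subtraction truncates. As the last entry is minus the number of
  parts, the Schur exponents are the coding shifted by that number.\<close>

lemma coding_partition_core:
  assumes t: "0 < t" and l: "l \<in> cores t" and j: "j < t"
  shows "int (coding_partition t l (Suc j) + t - Suc j) = V_coding t t l ! j + int (length l)"
proof -
  define v where "v j = V_coding t t l ! j" for j
  have gap: "v j + int (j - i) \<le> v i" if "i \<le> j" "j < t" for i j
    using that
  proof (induction rule: dec_induct)
    case (step n)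
    then show ?case
      using V_coding_core(2)[OF t l, of n "Suc n"] by (simp add: v_def Suc_diff_le)
  qed simp
  have "v (t - 1) + int (t - 1 - j) \<le> v j"
    using j by (intro gap) auto
  moreover have "int (t - 1 - j) = int t - int (Suc j)"
    using j by (simp add: of_nat_diff)
  ultimately have "int (coding_partition t l (Suc j)) = v j - v (t - 1) + int (Suc j) - int t"
    by (simp add: coding_partition_def v_def)
  then show ?thesis
    using V_coding_core(3)[OF t l] j by (simp add: v_def of_nat_diff)
qed

definition core_coeff :: "nat \<Rightarrow> nat list \<Rightarrow> laurent" where
  "core_coeff t l = (- 1) ^ card (short_hooks t l)
    * (schur t (coding_partition t l) * (\<Prod>i=1..t. xpow i (- int (length l))))"

text \<open>The negative powers of the variables undo the shift of the Schur exponents, and the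
  short hooks supply the sign lost by sorting the \<open>beta\<close> values, once the reversal in
  the Schur denominator is accounted for.\<close>

lemma core_coeff_mult_alt:
  assumes t: "0 < t" and l: "l \<in> cores t"
  shows "core_coeff t l * alt t int = alt t (\<lambda>j. int j + int t * charges t l j)"
proof -
  let ?\<rho> = "rev_perm t"
  let ?H = "(- 1) ^ card (short_hooks t l)"
  obtain \<pi> where \<pi>: "\<pi> permutes {0..<t}" "\<And>j. j < t \<Longrightarrow> V_coding t t l ! j = beta t l (\<pi> j)"
    using V_coding_core(1)[OF t l] by blast
  have alt_cong: "alt t e = alt t e'" if "\<And>j. j < t \<Longrightarrow> e j = e' j" for e e'
    unfolding alt_def using that by (intro arg_cong[of _ _ det] cong_mat) auto
  have sign: "sign \<pi> = sign ?\<rho> * ?H"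
  proof -
    \<comment> \<open>Sorting decreasingly makes all differences negative, just as reversal does, so
      the two products of signs coincide.\<close>
    have neg: "sgn (beta t l (\<pi> j) - beta t l (\<pi> i)) = - 1" "sgn (int (?\<rho> j) - int (?\<rho> i)) = - 1"
      if "i < j" "j < t" for i j
      using that V_coding_core(2)[OF t l that] by (simp_all add: \<pi>(2) rev_perm_def of_nat_diff)
    have "(\<Prod>(i, j)\<in>pairs_below t. beta t l (\<pi> j) - beta t l (\<pi> i))
        = sign \<pi> * (\<Prod>(i, j)\<in>pairs_below t. beta t l j - beta t l i)"
      using signof_prod_pairs_below[OF \<pi>(1), of "beta t l"] by (simp only: of_int_eq_id id_apply)
    then have "sgn (\<Prod>(i, j)\<in>pairs_below t. beta t l (\<pi> j) - beta t l (\<pi> i))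
        = sgn (sign \<pi>) * sgn (\<Prod>(i, j)\<in>pairs_below t. beta t l j - beta t l i)"
      by (simp only: sgn_mult)
    then have "(\<Prod>(i, j)\<in>pairs_below t. sgn (beta t l (\<pi> j) - beta t l (\<pi> i))) = sgn (sign \<pi>) * ?H"
      by (simp add: sgn_prod case_prod_unfold core_short_hooks_sign[OF t l])
    moreover have "sgn (sign \<pi>) = sign \<pi>" by (simp add: sign_def)
    moreover have "(\<Prod>(i, j)\<in>pairs_below t. sgn (beta t l (\<pi> j) - beta t l (\<pi> i))) = sign ?\<rho>"
      unfolding sign_eq_prod_sgn[OF rev_perm_permutes] by (intro prod.cong) (auto simp: neg)
    ultimately have "sign ?\<rho> = sign \<pi> * ?H" by simp
    then have "sign ?\<rho> * ?H = sign \<pi> * (?H * ?H)" by simp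
    also have "?H * ?H = (1 :: int)" by (simp flip: power_add mult_2)
    finally show ?thesis by simp
  qed
  have mono: "(\<Prod>i=1..t. xpow i c) = monomial t (\<lambda>_. c)" for c
    by (simp add: monomial_def prod.atLeast1_atMost_eq)
  have inv: "monomial t (\<lambda>_. - int (length l)) * monomial t (\<lambda>_. int (length l)) = 1"
    by (simp add: monomial_def flip: prod.distrib xpow_add)
  have "alternant t (\<lambda>j. coding_partition t l j + t - j) = alt t (\<lambda>j. beta t l (\<pi> j) + int (length l))"
    unfolding alternant_eq_alt using coding_partition_core[OF t l] \<pi>(2) by (intro alt_cong) simp
  also have "\<dots> = monomial t (\<lambda>_. int (length l)) * (signof \<pi> * alt t (beta t l))"
    by (simp only: alt_shift alt_permute[OF \<pi>(1)])
  also have "alt t (beta t l) = alt t (\<lambda>j. int j + int t * charges t l j)"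
    by (intro alt_cong) (simp add: core_beta[OF t l])
  finally have schur_eq: "schur t (coding_partition t l) * (signof ?\<rho> * alt t int)
      = monomial t (\<lambda>_. int (length l)) * (signof \<pi> * alt t (\<lambda>j. int j + int t * charges t l j))"
    by (simp only: schur_mult_vandermonde[of t "coding_partition t l", unfolded alternant_vandermonde, symmetric])
  let ?A = "alt t (\<lambda>j. int j + int t * charges t l j)"
  have signof_\<pi>: "signof \<pi> = (signof ?\<rho> * ?H :: laurent)"
    by (simp add: sign)
  have HH: "?H * ?H = (1 :: laurent)"
    by (simp flip: power_add mult_2)
  have "core_coeff t l * alt t int
      = (signof ?\<rho> * signof ?\<rho>) * (?H * (schur t (coding_partition t l) * monomial t (\<lambda>_. - int (length l))) * alt t int)"
    by (simp only: core_coeff_def mono signof_mult_signof mult_1_left)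
  also have "\<dots> = ?H * signof ?\<rho> * monomial t (\<lambda>_. - int (length l)) * (schur t (coding_partition t l) * (signof ?\<rho> * alt t int))"
    by (simp only: mult_ac)
  also have "\<dots> = ?H * signof ?\<rho> * (monomial t (\<lambda>_. - int (length l)) * monomial t (\<lambda>_. int (length l))) * (signof \<pi> * ?A)"
    unfolding schur_eq by (simp only: mult_ac)
  also have "\<dots> = (?H * ?H) * (signof ?\<rho> * signof ?\<rho>) * ?A"
    unfolding inv signof_\<pi> by (simp only: mult_1_right mult_1_left mult_ac)
  finally show ?thesis
    by (simp only: HH signof_mult_signof mult_1_left)
qed

theorem theorem1p2:
  fixes t :: nat
  assumes "t \<ge> 1"
  shows "((\<lambda>\<omega>. (-1) ^ card (short_hooks t \<omega>) * fps_X ^ sum_list \<omega>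
              * fps_const (schur t (coding_partition t \<omega>) * (\<Prod>i=1..t. xpow i (- int (length \<omega>)))))
          has_sum
          (qpochhammer fps_X ^ (t - 1)
           * (\<Prod>(i, j)\<in>{(i, j). 1 \<le> i \<and> i < j \<and> j \<le> t}.
                qpochhammer (fps_X * fps_const (xpow i 1 * xpow j (-1)))
                * qpochhammer (fps_X * fps_const (xpow i (-1) * xpow j 1)))))
         (cores t)"
proof -
  have t: "0 < t" using assms by simp
  let ?rhs = "qpochhammer fps_X ^ (t - 1)
           * (\<Prod>(i, j)\<in>{(i, j). 1 \<le> i \<and> i < j \<and> j \<le> t}.
                qpochhammer (fps_X * fps_const (xpow i 1 * xpow j (-1)))
                * qpochhammer (fps_X * fps_const (xpow i (-1) * xpow j 1)))"
  have size: "sum_list l = qform t (charges t l)" if "l \<in> cores t" for l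
    using that core_zeros_charges(1)[OF t that] by (intro abacus_partition(2)[OF t]) (auto simp: cores_def)
  have bij: "bij_betw (charges t) (cores t) (charge0 t)"
    by (rule bij_betw_charges[OF t])
  \<comment> \<open>Finiteness in each size is transported from the lattice, on which
    \<open>qform\<close> is graded.\<close>
  have graded: "graded (cores t) sum_list"
    unfolding graded_def
  proof
    fix n
    have "charges t ` {l \<in> cores t. sum_list l \<le> n} \<subseteq> {\<nu> \<in> charge0 t. qform t \<nu> \<le> n}"
      using bij size by (auto simp: bij_betw_def)
    then have "finite (charges t ` {l \<in> cores t. sum_list l \<le> n})"
      by (rule finite_subset) (use graded_charge0 in \<open>auto simp: graded_def\<close>)
    then show "finite {l \<in> cores t. sum_list l \<le> n}"
      by (rule finite_imageD) (use bij in \<open>auto simp: bij_betw_def inj_on_def\<close>)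
  qed
  have "fps_const (alt t int) * gser (cores t) sum_list (core_coeff t)
      = gser (cores t) sum_list (\<lambda>l. alt t int * core_coeff t l)"
    by (simp only: gser_const_mult)
  also have "\<dots> = gser (cores t) (qform t \<circ> charges t) ((\<lambda>\<nu>. alt t (\<lambda>j. int j + int t * \<nu> j)) \<circ> charges t)"
    using size core_coeff_mult_alt[OF t] by (intro gser_cong) (simp_all add: mult.commute)
  also have "\<dots> = gser (charge0 t) (qform t) (\<lambda>\<nu>. alt t (\<lambda>j. int j + int t * \<nu> j))"
    by (rule gser_reindex[OF bij, symmetric])
  also have "\<dots> = fps_const (alt t int) * ?rhs"
  proof -
    \<comment> \<open>Variables are numbered from 1 in the statement, pairs in the identity from
      0.\<close>
    have "bij_betw (map_prod Suc Suc) (pairs_below t) {(i, j). 1 \<le> i \<and> i < j \<and> j \<le> t}"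
      by (rule bij_betw_byWitness[of _ "map_prod (\<lambda>i. i - 1) (\<lambda>j. j - 1)"]) auto
    from prod.reindex_bij_betw[OF this, symmetric]
    have "(\<Prod>(i, j)\<in>{(i, j). 1 \<le> i \<and> i < j \<and> j \<le> t}. g i j)
        = (\<Prod>z\<in>pairs_below t. case map_prod Suc Suc z of (i, j) \<Rightarrow> g i j)" for g :: "nat \<Rightarrow> nat \<Rightarrow> laurent fps" .
    moreover have "(\<Prod>z\<in>pairs_below t. case map_prod Suc Suc z of (i, j) \<Rightarrow> g i j)
        = (\<Prod>(i, j)\<in>pairs_below t. g (Suc i) (Suc j))" for g :: "nat \<Rightarrow> nat \<Rightarrow> laurent fps"
      by (intro prod.cong) auto
    ultimately show ?thesis
      by (simp only: macdonald_identity[OF t, symmetric])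
  qed
  finally have "gser (cores t) sum_list (core_coeff t) = ?rhs"
    using alt_int_nonzero[of t] by simp
  then have "((\<lambda>l. fps_const (core_coeff t l) * fps_X ^ sum_list l) has_sum ?rhs) (cores t)"
    using gser_has_sum[OF graded, of "core_coeff t"] by simp
  moreover have "fps_const (core_coeff t l) * fps_X ^ sum_list l
      = (-1) ^ card (short_hooks t l) * fps_X ^ sum_list l
        * fps_const (schur t (coding_partition t l) * (\<Prod>i=1..t. xpow i (- int (length l))))" for l
  proof -
    have "fps_const ((- 1) ^ n :: laurent) = (- 1) ^ n" for n
      by (induction n) (simp_all flip: fps_const_mult fps_const_neg)
    then show ?thesis
      by (simp add: core_coeff_def mult_ac flip: fps_const_mult)
  qed
  ultimately show ?thesis by simp
qed

end
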